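(* Let $\lambda=\lambda(n)\ge0$ and let $c\le 1+\lambda n^{-1/3}$. Let $G\in\mathcal{G}(n,c/n)$ be an Erdős–Rényi random graph, and let $I$ be any boolean RCSP instance over any ring $R$ with constraint graph $G$. Then there is an algorithm that calculates the partition function $Z_I$ using an expected $O(n)\exp(1+\lambda^3)$ ring operations (the expectation being over the random graph $G$).
   Context: $\mathcal{G}(n,p)$ is the random graph on $n$ vertices in which each pair is an edge independently with probability $p$. An RCSP (Ring CSP) instance $I$ over a ring $R$ with constraint graph $G=(V,E)$ and domain $[k]=\{0,\dots,k-1\}$ consists of ring elements $r_\emptyset$, $r_v(i)$ for each $v\in V$, $i\in[k]$, and $r_{xy}(i,j)$ for each edge $xy\in E$ and $i,j\in[k]$ (with $r_{xy}(i,j)$ and $r_{yx}(j,i)$ denoting the same element). The score of an assignment $\sigma:V\to[k]$ is $I(\sigma)=r_\emptyset\prod_{v\in V}r_v(\sigma(v))\prod_{xy\in E}r_{xy}(\sigma(x),\sigma(y))$, and the partition function is $Z_I=\sum_{\sigma:V\to[k]}I(\sigma)$. The instance is boolean if $k=2$. Ring operations are additions and multiplications in $R$. *)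

theory Defs
  imports
    "HOL-Algebra.Ring"
    "HOL-Library.FuncSet"
    "HOL-Library.Landau_Symbols"
    "HOL-Probability.Product_PMF"
begin

section \<open>Random graphs\<close>

text \<open>
  A simple graph on the vertex set \<open>V\<close> is given by its edge set, a subset of \<open>vertex_pairs V\<close>.
\<close>

definition vertex_pairs :: "'v set \<Rightarrow> 'v set set" where
  "vertex_pairs V = {{x, y} | x y. x \<in> V \<and> y \<in> V \<and> x \<noteq> y}"

definition random_graph :: "nat \<Rightarrow> real \<Rightarrow> nat set set pmf" where
  "random_graph n p =
     map_pmf (\<lambda>present. {e \<in> vertex_pairs {..<n}. present e})
       (Pi_pmf (vertex_pairs {..<n}) False (\<lambda>_. bernoulli_pmf p))"

section \<open>Ring CSPs\<close>

text \<open>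
  The entries \<open>nullary\<close>, \<open>unary v i\<close> and \<open>binary x y i j\<close> are the ring elements
  $r_\emptyset$, $r_v(i)$ and $r_{xy}(i,j)$.  Only the entries with \<open>v\<close> a vertex, \<open>{x, y}\<close> an edge
  and \<open>i\<close>, \<open>j\<close> in the domain $\{0,\dots,k-1\}$ belong to the instance; all others are junk.
\<close>

record 'r rcsp =
  nullary :: 'r
  unary :: "nat \<Rightarrow> nat \<Rightarrow> 'r"
  binary :: "nat \<Rightarrow> nat \<Rightarrow> nat \<Rightarrow> nat \<Rightarrow> 'r"

definition rcsp_instance ::
    "('r, 'm) ring_scheme \<Rightarrow> nat \<Rightarrow> nat set \<Rightarrow> nat set set \<Rightarrow> 'r rcsp \<Rightarrow> bool" where
  "rcsp_instance R k V E I \<longleftrightarrow>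
     nullary I \<in> carrier R \<and>
     (\<forall>v\<in>V. \<forall>i<k. unary I v i \<in> carrier R) \<and>
     (\<forall>x y. {x, y} \<in> E \<longrightarrow>
        (\<forall>i<k. \<forall>j<k. binary I x y i j \<in> carrier R \<and> binary I x y i j = binary I y x j i))"

text \<open>
  Every edge contributes one factor to the score.  By the symmetry of \<open>binary\<close> it does not matter
  in which orientation the edge is read, and we use the increasing one.
\<close>

definition score ::
    "('r, 'm) ring_scheme \<Rightarrow> nat set \<Rightarrow> nat set set \<Rightarrow> 'r rcsp \<Rightarrow> (nat \<Rightarrow> nat) \<Rightarrow> 'r" where
  "score R V E I \<sigma> =
     nullary I \<otimes>\<^bsub>R\<^esub> (\<Otimes>\<^bsub>R\<^esub>v\<in>V. unary I v (\<sigma> v)) \<otimes>\<^bsub>R\<^esub>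
     (\<Otimes>\<^bsub>R\<^esub>e\<in>E. binary I (Min e) (Max e) (\<sigma> (Min e)) (\<sigma> (Max e)))"

definition partition_function ::
    "('r, 'm) ring_scheme \<Rightarrow> nat \<Rightarrow> nat set \<Rightarrow> nat set set \<Rightarrow> 'r rcsp \<Rightarrow> 'r" where
  "partition_function R k V E I = (\<Oplus>\<^bsub>R\<^esub>\<sigma>\<in>(V \<rightarrow>\<^sub>E {..<k}). score R V E I \<sigma>)"

section \<open>Algorithms over a ring\<close>

text \<open>
  Algorithms are programs of a random access machine with two memories, one holding natural numbers
  and one holding ring elements, both organised as arrays: a memory cell is addressed by a list of
  natural numbers.  All control decisions depend on the natural number memory only, and the ring is
  a black box: ring elements can be copied, added and multiplied, and the constants zero and one can
  be stored, but ring elements cannot be inspected or compared.  A program mentions neither the ring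
  nor the size of its input.
\<close>

datatype exp =
    Const nat
  | Cell "exp list"
  | Plus exp exp
  | Minus exp exp
  | Times exp exp
  | Divide exp exp
  | Modulo exp exp

datatype com =
    Skip
  | Assign "exp list" exp
  | RZero "exp list"
  | ROne "exp list"
  | RCopy "exp list" "exp list"
  | RAdd "exp list" "exp list" "exp list"
  | RMult "exp list" "exp list" "exp list"
  | Seq com com
  | Cond exp com com
  | While exp com

fun val :: "(nat list \<Rightarrow> nat) \<Rightarrow> exp \<Rightarrow> nat" where
  "val m (Const c) = c"
| "val m (Cell as) = m (map (val m) as)"
| "val m (Plus a b) = val m a + val m b"
| "val m (Minus a b) = val m a - val m b"
| "val m (Times a b) = val m a * val m b"
| "val m (Divide a b) = val m a div val m b"
| "val m (Modulo a b) = val m a mod val m b"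

abbreviation addr :: "(nat list \<Rightarrow> nat) \<Rightarrow> exp list \<Rightarrow> nat list" where
  "addr m as \<equiv> map (val m) as"

type_synonym 'r state = "(nat list \<Rightarrow> nat) \<times> (nat list \<Rightarrow> 'r)"

text \<open>
  \<open>exec R p s t s'\<close>: started in state \<open>s\<close>, the program \<open>p\<close> terminates in state \<open>s'\<close> after performing
  exactly \<open>t\<close> ring operations (additions and multiplications in \<open>R\<close>).
\<close>

inductive exec ::
    "('r, 'm) ring_scheme \<Rightarrow> com \<Rightarrow> 'r state \<Rightarrow> nat \<Rightarrow> 'r state \<Rightarrow> bool"
  for R :: "('r, 'm) ring_scheme" where
  exec_Skip: "exec R Skip s 0 s"
| exec_Assign: "exec R (Assign a e) (m, h) 0 (m(addr m a := val m e), h)"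
| exec_RZero: "exec R (RZero a) (m, h) 0 (m, h(addr m a := \<zero>\<^bsub>R\<^esub>))"
| exec_ROne: "exec R (ROne a) (m, h) 0 (m, h(addr m a := \<one>\<^bsub>R\<^esub>))"
| exec_RCopy: "exec R (RCopy a b) (m, h) 0 (m, h(addr m a := h (addr m b)))"
| exec_RAdd:
    "exec R (RAdd a b c) (m, h) 1 (m, h(addr m a := h (addr m b) \<oplus>\<^bsub>R\<^esub> h (addr m c)))"
| exec_RMult:
    "exec R (RMult a b c) (m, h) 1 (m, h(addr m a := h (addr m b) \<otimes>\<^bsub>R\<^esub> h (addr m c)))"
| exec_Seq: "exec R p s t s' \<Longrightarrow> exec R q s' t' s'' \<Longrightarrow> exec R (Seq p q) s (t + t') s''"
| exec_Cond_True: "val (fst s) e \<noteq> 0 \<Longrightarrow> exec R p s t s' \<Longrightarrow> exec R (Cond e p q) s t s'"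
| exec_Cond_False: "val (fst s) e = 0 \<Longrightarrow> exec R q s t s' \<Longrightarrow> exec R (Cond e p q) s t s'"
| exec_While_False: "val (fst s) e = 0 \<Longrightarrow> exec R (While e p) s 0 s"
| exec_While_True:
    "val (fst s) e \<noteq> 0 \<Longrightarrow> exec R p s t s' \<Longrightarrow> exec R (While e p) s' t' s'' \<Longrightarrow>
     exec R (While e p) s (t + t') s''"

lemma exec_deterministic:
  "exec R p s t s' \<Longrightarrow> exec R p s u s'' \<Longrightarrow> u = t \<and> s'' = s'"
proof (induction arbitrary: u s'' rule: exec.induct)
  case (exec_Skip s)
  then show ?case by cases simp
next
  case (exec_Assign a e m h)
  then show ?case by cases simp
next
  case (exec_RZero a m h)
  then show ?case by cases simp
next
  case (exec_ROne a m h)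
  then show ?case by cases simp
next
  case (exec_RCopy a b m h)
  then show ?case by cases simp
next
  case (exec_RAdd a b c m h)
  then show ?case by cases simp
next
  case (exec_RMult a b c m h)
  then show ?case by cases simp
next
  case (exec_Seq p s t s' q t' s2)
  note SeqIH = exec_Seq.IH
  from exec_Seq.prems show ?case
  proof cases
    case (exec_Seq t1 s1 t2)
    then show ?thesis using SeqIH by blast
  qed
next
  case (exec_Cond_True s e p t s' q)
  from exec_Cond_True.prems exec_Cond_True.hyps have "exec R p s u s''"
    by cases simp_all
  then show ?case by (rule exec_Cond_True.IH)
next
  case (exec_Cond_False s e q t s' p)
  from exec_Cond_False.prems exec_Cond_False.hyps have "exec R q s u s''"
    by cases simp_all
  then show ?case by (rule exec_Cond_False.IH)
next
  case (exec_While_False s e p)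
  from exec_While_False.prems exec_While_False.hyps show ?case
    by cases simp_all
next
  case (exec_While_True s e p t s' t' s2)
  note WhileIH = exec_While_True.IH and nonzero = exec_While_True.hyps(1)
  from exec_While_True.prems show ?case
  proof cases
    case exec_While_False
    then show ?thesis using nonzero by simp
  next
    case (exec_While_True t1 s1 t2)
    then show ?thesis using WhileIH by blast
  qed
qed

text \<open>
  The input for a graph on \<open>{..<n}\<close> consists of \<open>n\<close>, the adjacency matrix, and the entries of the
  instance.  Cells that do not carry input are zero, so that no junk entry is accessible.
\<close>

definition input_graph :: "nat \<Rightarrow> nat set set \<Rightarrow> nat list \<Rightarrow> nat" where
  "input_graph n E a = (case a of
       [] \<Rightarrow> n
     | [x, y] \<Rightarrow> (if {x, y} \<in> E then 1 else 0)
     | _ \<Rightarrow> 0)"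

definition input_entries ::
    "('r, 'm) ring_scheme \<Rightarrow> nat \<Rightarrow> nat \<Rightarrow> nat set set \<Rightarrow> 'r rcsp \<Rightarrow> nat list \<Rightarrow> 'r" where
  "input_entries R k n E I a = (case a of
       [] \<Rightarrow> nullary I
     | [v, i] \<Rightarrow> (if v < n \<and> i < k then unary I v i else \<zero>\<^bsub>R\<^esub>)
     | [x, y, i, j] \<Rightarrow> (if {x, y} \<in> E \<and> i < k \<and> j < k then binary I x y i j else \<zero>\<^bsub>R\<^esub>)
     | _ \<Rightarrow> \<zero>\<^bsub>R\<^esub>)"

text \<open>The output is the content of the ring memory cell with the empty address.\<close>

definition computes_in ::
    "('r, 'm) ring_scheme \<Rightarrow> com \<Rightarrow> nat \<Rightarrow> nat \<Rightarrow> nat set set \<Rightarrow> 'r rcsp \<Rightarrow> 'r \<Rightarrow> nat \<Rightarrow> bool" where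
  "computes_in R p k n E I z t \<longleftrightarrow>
     (\<exists>m h. exec R p (input_graph n E, input_entries R k n E I) t (m, h) \<and> h [] = z)"

end

theory Submission
  imports Defs "HOL-Library.Nat_Bijection"
begin

text \<open>
  Only ring operations are charged, so the algorithm may do unlimited work on natural numbers.  It
  searches for a shortest straight-line program that computes the partition function as a polynomial
  with coefficients in \<open>nat\<close>, deciding polynomial identity by evaluation at the Kronecker points
  $x_r = B^{B^r}$, and runs this program once over the ring.  It remains to bound the length of a
  shortest program.

  Vertices of degree at most two can be eliminated with $O(1)$ operations each.  If all degrees are at
  least three, branching on a vertex lowers $\sum_v (\deg v - 2)^+$ by at least four in both branches.
  This potential is twice the excess $\kappa = |E| - |V|$ of a connected graph without vertices of
  degree at most two, so a component costs $O(|V|)$ plus $O(2^{\kappa/2})$.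

  For the expectation of $\sum_A z^{|E(A)| - |A|}$ over all components $A$, where $z = \sqrt 2$, a factor
  $z$ per edge tilts the edge probability $p$ to $p' = zp/(1 + (z-1)p)$, and
  $G(k, p')$ is connected with probability at most $(1 - (1 - p')^{k-1})^{k-1}$.  The resulting sum over
  the component sizes $k$ has terms $O(n k^{-5/4}) \exp(n R(k/n))$ whose rate $R$ is at most
  $((c - 1)^+)^3$, and $n ((c - 1)^+)^3 \le \lambda^3$.
\<close>

section \<open>Components of random graphs\<close>

text \<open>The elimination procedure is never programmed. Its analysis only has to show that a
  short sequence of additions and multiplications exists; exhaustive search then finds one that is
  at least as short. Since the test compares natural numbers, the length found depends on n and E
  alone, not on R or I. Elimination never subtracts, so polynomials over nat suffice, and an
  identity between them holds in every commutative ring at once.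

  The obstacle is the constant 1 in front of \<lambda>^3. For components of size y n, the tilt
  contributes (z - 1) c y^2 / 2 to the rate and connectedness -z c y^2 / 2, so that z cancels to
  second order. It survives as z^2 c^2 y^3 / 24 against -y^3 / 6 from the binomial coefficient.
  Hence all estimates have to be sharp to third order in y and c - 1, and it matters that branching
  lowers the excess by two: with a gain of only one, z would be 2 and the cubic coefficient would
  vanish at c = 1.\<close>

definition bsum :: "real \<Rightarrow> 'a set \<Rightarrow> ('a set \<Rightarrow> real) \<Rightarrow> real" where
  "bsum p P f = (\<Sum>F\<in>Pow P. p ^ card F * (1 - p) ^ card (P - F) * f F)"

lemma sum_Pow_binomial:
  fixes x y :: "'b::comm_semiring_1"
  assumes "finite P"
  shows "(\<Sum>F\<in>Pow P. x ^ card F * y ^ card (P - F)) = (x + y) ^ card P"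
  using prod_add[OF assms, of "\<lambda>_. x" "\<lambda>_. y"] by simp

lemma sum_Pow_Un:
  assumes "P \<inter> Q = {}"
  shows "sum f (Pow (P \<union> Q)) = (\<Sum>F\<in>Pow P. \<Sum>G\<in>Pow Q. f (F \<union> G))"
proof -
  have "sum f (Pow (P \<union> Q)) = (\<Sum>(F, G)\<in>Pow P \<times> Pow Q. f (F \<union> G))"
    by (rule sum.reindex_bij_witness[where i = "\<lambda>(F, G). F \<union> G" and j = "\<lambda>H. (H \<inter> P, H \<inter> Q)"])
       (use assms in \<open>auto simp: Int_Un_distrib[symmetric] Int_absorb2\<close>)
  then show ?thesis by (simp add: sum.cartesian_product)
qed

lemma bsum_const: "finite P \<Longrightarrow> bsum p P (\<lambda>_. a) = a"
  by (simp add: bsum_def sum_Pow_binomial flip: sum_distrib_right)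

lemma bsum_mono:
  assumes "0 \<le> p" "p \<le> 1" "\<And>F. F \<subseteq> P \<Longrightarrow> f F \<le> g F"
  shows "bsum p P f \<le> bsum p P g"
  unfolding bsum_def by (intro sum_mono mult_left_mono) (use assms in auto)

lemma bsum_cong: "(\<And>F. F \<subseteq> P \<Longrightarrow> f F = g F) \<Longrightarrow> bsum p P f = bsum p P g"
  unfolding bsum_def by (intro sum.cong) auto

lemma bsum_add: "bsum p P (\<lambda>F. f F + g F) = bsum p P f + bsum p P g"
  by (simp add: bsum_def sum.distrib algebra_simps)

lemma bsum_cmult: "bsum p P (\<lambda>F. a * f F) = a * bsum p P f"
  by (simp add: bsum_def sum_distrib_left algebra_simps)

lemma bsum_sum: "bsum p P (\<lambda>F. \<Sum>i\<in>A. f i F) = (\<Sum>i\<in>A. bsum p P (f i))"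
  unfolding bsum_def by (subst sum.swap) (simp add: sum_distrib_left)

text \<open>\<open>bsum\<close> is an expectation over independent choices with probability p, so
  disjoint ground sets can be averaged one after the other.\<close>

lemma bsum_Un:
  assumes "finite P" "finite Q" "P \<inter> Q = {}"
  shows "bsum p (P \<union> Q) f = bsum p P (\<lambda>F. bsum p Q (\<lambda>G. f (F \<union> G)))"
  unfolding bsum_def
proof (subst sum_Pow_Un[OF assms(3)], intro sum.cong refl, subst sum_distrib_left, intro sum.cong refl)
  fix F G assume FG: "F \<in> Pow P" "G \<in> Pow Q"
  have "card (F \<union> G) = card F + card G"
    using assms FG by (intro card_Un_disjoint) (auto intro: finite_subset)
  moreover have "P \<union> Q - (F \<union> G) = (P - F) \<union> (Q - G)"
    using assms FG by auto
  moreover have "card ((P - F) \<union> (Q - G)) = card (P - F) + card (Q - G)"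
    using assms FG by (intro card_Un_disjoint) auto
  ultimately show "p ^ card (F \<union> G) * (1 - p) ^ card (P \<union> Q - (F \<union> G)) * f (F \<union> G) =
      p ^ card F * (1 - p) ^ card (P - F) * (p ^ card G * (1 - p) ^ card (Q - G) * f (F \<union> G))"
    by (simp add: power_add)
qed

text \<open>A factor z per chosen element turns the weights p and 1 - p into z * p and 1 - p;
  dividing by their sum 1 + (z - 1) * p makes them probabilities again.\<close>

lemma bsum_tilt:
  assumes P: "finite P" and p: "0 \<le> p" "p \<le> 1" "0 < 1 + (z - 1) * p"
  shows "bsum p P (\<lambda>F. z ^ card F * f F) =
    (1 + (z - 1) * p) ^ card P * bsum (z * p / (1 + (z - 1) * p)) P f"
  unfolding bsum_def
proof (subst sum_distrib_left, intro sum.cong refl)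
  fix F assume F: "F \<in> Pow P"
  define s where "s = 1 + (z - 1) * p"
  have s: "s > 0" using p by (simp add: s_def)
  have c: "card P = card F + card (P - F)"
    using F P by (metis PowD add_diff_inverse_nat card_Diff_subset card_mono finite_subset not_less)
  have e: "1 - z * p / s = (1 - p) / s" using s by (simp add: field_simps s_def)
  show "p ^ card F * (1 - p) ^ card (P - F) * (z ^ card F * f F) =
      (1 + (z - 1) * p) ^ card P * ((z * p / (1 + (z - 1) * p)) ^ card F *
        (1 - z * p / (1 + (z - 1) * p)) ^ card (P - F) * f F)"
    unfolding s_def[symmetric] e c using s
    by (simp add: power_add power_divide power_mult_distrib)
qed

lemma finite_vertex_pairs: "finite V \<Longrightarrow> finite (vertex_pairs V)"
  by (rule finite_subset[of _ "Pow V"]) (auto simp: vertex_pairs_def)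

lemma doubleton_in_vertex_pairs: "{x, y} \<in> vertex_pairs V \<longleftrightarrow> x \<in> V \<and> y \<in> V \<and> x \<noteq> y"
  by (auto simp: vertex_pairs_def doubleton_eq_iff)

lemma card_vertex_pairs: "finite V \<Longrightarrow> card (vertex_pairs V) = card V choose 2"
proof -
  assume "finite V"
  have "vertex_pairs V = {e. e \<subseteq> V \<and> card e = 2}"
    by (auto simp: vertex_pairs_def card_2_iff)
  then show ?thesis using n_subsets[OF \<open>finite V\<close>] by simp
qed

lemma expectation_random_graph:
  fixes f :: "nat set set \<Rightarrow> real"
  assumes p: "0 \<le> p" "p \<le> 1"
  shows "measure_pmf.expectation (random_graph n p) f = bsum p (vertex_pairs {..<n}) f"
proof -
  define P where "P = vertex_pairs {..<n}"
  have fin: "finite P" by (simp add: P_def finite_vertex_pairs)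
  have set: "set_pmf (random_graph n p) \<subseteq> Pow P"
    by (auto simp: random_graph_def P_def)
  have pmf: "pmf (random_graph n p) F = p ^ card F * (1 - p) ^ card (P - F)" if F: "F \<subseteq> P" for F
  proof -
    let ?M = "Pi_pmf P False (\<lambda>_. bernoulli_pmf p)"
    have "pmf (random_graph n p) F = measure ?M ((\<lambda>h. {e \<in> P. h e}) -` {F})"
      by (simp add: random_graph_def P_def pmf_map)
    also have "\<dots> = measure ?M ((\<lambda>h. {e \<in> P. h e}) -` {F} \<inter> set_pmf ?M)"
      by (simp add: measure_Int_set_pmf)
    \<comment> \<open>On the support every function is False off P, so the edge set determines the
      function.\<close>
    also have "\<dots> = measure ?M ({\<lambda>e. e \<in> F} \<inter> set_pmf ?M)"
    proof (intro arg_cong[where f = "measure ?M"] Set.set_eqI)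
      fix h
      have "h \<in> set_pmf ?M \<Longrightarrow> {e \<in> P. h e} = F \<longleftrightarrow> h = (\<lambda>e. e \<in> F)"
        using set_Pi_pmf_subset[OF fin, of False "\<lambda>_. bernoulli_pmf p"] F by fastforce
      then show "h \<in> (\<lambda>h. {e \<in> P. h e}) -` {F} \<inter> set_pmf ?M \<longleftrightarrow> h \<in> {\<lambda>e. e \<in> F} \<inter> set_pmf ?M"
        by auto
    qed
    also have "\<dots> = pmf ?M (\<lambda>e. e \<in> F)"
      by (simp add: measure_Int_set_pmf measure_pmf_single)
    also have "\<dots> = (\<Prod>e\<in>P. pmf (bernoulli_pmf p) (e \<in> F))"
      using F by (intro pmf_Pi') (auto simp: fin)
    also have "\<dots> = (\<Prod>e\<in>F. p) * (\<Prod>e\<in>P - F. 1 - p)"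
      using p F by (subst prod.subset_diff[OF F fin]) (simp add: mult.commute)
    finally show ?thesis by simp
  qed
  have "measure_pmf.expectation (random_graph n p) f = (\<Sum>F\<in>Pow P. f F * pmf (random_graph n p) F)"
    by (rule integral_measure_pmf_real) (use fin set in auto)
  also have "\<dots> = bsum p P f"
    unfolding bsum_def by (intro sum.cong) (auto simp: pmf)
  finally show ?thesis by (simp add: P_def)
qed

section \<open>Reachability and connectedness through cuts\<close>

definition reach_pairs :: "'v set \<Rightarrow> 'v set \<Rightarrow> 'v set set" where
  "reach_pairs S U = {{x, y} | x y. x \<in> S \<union> U \<and> y \<in> U \<and> x \<noteq> y}"

text \<open>
  Every vertex of \<open>U\<close> can be reached from \<open>S\<close>, expressed by cuts: this form survives the removal of
  a vertex of \<open>S\<close> whose neighbours are added to \<open>S\<close>.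
\<close>

definition reach :: "'v set \<Rightarrow> 'v set \<Rightarrow> 'v set set \<Rightarrow> bool" where
  "reach S U F \<longleftrightarrow> (\<forall>B\<subseteq>U. B \<noteq> {} \<longrightarrow> (\<exists>x\<in>B. \<exists>y\<in>(S \<union> U) - B. {x, y} \<in> F))"

lemma finite_reach_pairs: "finite S \<Longrightarrow> finite U \<Longrightarrow> finite (reach_pairs S U)"
  by (rule finite_subset[of _ "Pow (S \<union> U)"]) (auto simp: reach_pairs_def)

text \<open>An edge that leaves B cannot end in a, because J consists of the neighbours of a in U
  and B avoids J. So it survives when a is removed and J joins the sources.\<close>

lemma reach_step:
  assumes "reach (insert a S) U (F \<union> G)" "J = {x \<in> U. {a, x} \<in> F}" "a \<notin> U"
    "F \<subseteq> (\<lambda>x. {a, x}) ` U" "\<And>x. {a, x} \<notin> G"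
  shows "reach (S \<union> J) (U - J) (G \<inter> reach_pairs (S \<union> J) (U - J))"
  unfolding reach_def
proof (intro allI impI)
  fix B assume B: "B \<subseteq> U - J" "B \<noteq> {}"
  then obtain x y where xy: "x \<in> B" "y \<in> (insert a S \<union> U) - B" "{x, y} \<in> F \<union> G"
    using assms(1) unfolding reach_def by (meson Diff_subset subset_trans)
  have xa: "x \<noteq> a" using xy B assms(3) by auto
  have ya: "y \<noteq> a"
  proof
    assume "y = a"
    then have "{a, x} \<in> F" using xy(3) assms(5) by (simp add: insert_commute)
    then show False using xy(1) B assms(2) by auto
  qed
  have "{x, y} \<notin> F" using assms(4) xa ya by (auto simp: doubleton_eq_iff)
  then have "{x, y} \<in> G \<inter> reach_pairs (S \<union> J) (U - J)"
    using xy B ya by (auto simp: reach_pairs_def insert_commute)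
  moreover have "y \<in> (S \<union> J \<union> (U - J)) - B" using xy ya by auto
  ultimately show "\<exists>x\<in>B. \<exists>y\<in>(S \<union> J \<union> (U - J)) - B. {x, y} \<in> G \<inter> reach_pairs (S \<union> J) (U - J)"
    using xy(1) by blast
qed

text \<open>
  The neighbours \<open>J\<close> of one vertex of \<open>S\<close> are exposed first.  Given \<open>J\<close>, the vertices of \<open>U - J\<close>
  have to be reached from \<open>S' \<union> J\<close>, and \<open>card (S' \<union> J) + card (U - J)\<close> does not depend on \<open>J\<close>, so
  that the bounds for the different \<open>J\<close> add up by the binomial theorem.
\<close>

lemma bsum_reach_le:
  assumes "finite S" "finite U" "S \<inter> U = {}" "0 \<le> p" "p \<le> 1"
  shows "bsum p (reach_pairs S U) (\<lambda>F. of_bool (reach S U F))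
    \<le> (1 - (1 - p) ^ (card S + card U - 1)) ^ card U"
  using assms(1-3)
proof (induction "card S + card U" arbitrary: S U rule: less_induct)
  case less
  have q1: "(1 - p) ^ k \<le> 1" for k :: nat using assms(4,5) by (simp add: power_le_one)
  consider "U = {}" | "U \<noteq> {}" "S = {}" | a where "U \<noteq> {}" "a \<in> S" by blast
  then show ?case
  proof cases
    case 1
    have "bsum p (reach_pairs S U) (\<lambda>F. of_bool (reach S U F)) \<le> bsum p (reach_pairs S U) (\<lambda>F. 1)"
      by (rule bsum_mono) (use assms in auto)
    then show ?thesis using 1 less.prems by (simp add: bsum_const finite_reach_pairs)
  next
    case 2
    then have "\<not> reach S U F" for F by (auto simp: reach_def)
    then have "bsum p (reach_pairs S U) (\<lambda>F. of_bool (reach S U F)) = 0"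
      by (simp add: bsum_def)
    then show ?thesis using q1 by simp
  next
    case 3
    define S' where "S' = S - {a}"
    define st where "st = (\<lambda>x. {a, x}) ` U"
    define m where "m = card S' + card U - 1"
    have S: "S = insert a S'" "a \<notin> S'" "a \<notin> U" "finite S'" using 3 less.prems by (auto simp: S'_def)
    have cm: "card S + card U - 1 = Suc m" using S 3(1) less.prems by (simp add: m_def card_gt_0_iff Suc_le_eq)
    have fU: "finite U" by fact
    have inj: "inj_on (\<lambda>x. {a, x}) U" by (auto simp: inj_on_def doubleton_eq_iff)
    have rp: "reach_pairs S U = st \<union> reach_pairs S' U"
      using S by (auto simp: reach_pairs_def st_def)
    have dis: "st \<inter> reach_pairs S' U = {}"
      using S by (auto simp: reach_pairs_def st_def doubleton_eq_iff)
    have inner: "bsum p (reach_pairs S' U) (\<lambda>G. of_bool (reach S U (F \<union> G))) \<le>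
        (1 - (1 - p) ^ m) ^ card (st - F)" if F: "F \<subseteq> st" for F
    proof -
      define J where "J = {x \<in> U. {a, x} \<in> F}"
      define Q where "Q = reach_pairs (S' \<union> J) (U - J)"
      have JU: "J \<subseteq> U" by (auto simp: J_def)
      have QQ: "Q \<subseteq> reach_pairs S' U" using JU by (auto simp: Q_def reach_pairs_def)
      have finQ: "finite (reach_pairs S' U)" using S fU by (simp add: finite_reach_pairs)
      have na: "{a, x} \<notin> G" if "G \<subseteq> reach_pairs S' U" for x G
        using that S by (auto simp: reach_pairs_def doubleton_eq_iff)
      have c: "card (S' \<union> J) + card (U - J) = card S' + card U"
      proof -
        have "card (S' \<union> J) = card S' + card J"
          using S JU less.prems fU by (intro card_Un_disjoint) (auto intro: finite_subset)
        moreover have "card (U - J) = card U - card J" "card J \<le> card U"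
          using JU fU by (auto simp: card_Diff_subset finite_subset card_mono)
        ultimately show ?thesis by simp
      qed
      have "bsum p (reach_pairs S' U) (\<lambda>G. of_bool (reach S U (F \<union> G)))
          \<le> bsum p (reach_pairs S' U) (\<lambda>G. of_bool (reach (S' \<union> J) (U - J) (G \<inter> Q)))"
      proof (rule bsum_mono)
        fix G assume "G \<subseteq> reach_pairs S' U"
        then show "of_bool (reach S U (F \<union> G)) \<le> (of_bool (reach (S' \<union> J) (U - J) (G \<inter> Q)) :: real)"
          using reach_step[of a S' U F G J] F S(3) na[of G] unfolding S(1) J_def Q_def st_def by auto
      qed (use assms in auto)
      also have "\<dots> = bsum p (Q \<union> (reach_pairs S' U - Q)) (\<lambda>G. of_bool (reach (S' \<union> J) (U - J) (G \<inter> Q)))"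
        using QQ by (simp add: Un_absorb1)
      \<comment> \<open>Reachability from \<open>S' \<union> J\<close> only looks at the pairs in Q;
        the other pairs are summed out, and the induction hypothesis becomes applicable.\<close>
      also have "bsum p (Q \<union> (reach_pairs S' U - Q)) (\<lambda>G. of_bool (reach (S' \<union> J) (U - J) (G \<inter> Q)))
         = bsum p Q (\<lambda>G. bsum p (reach_pairs S' U - Q) (\<lambda>H. of_bool (reach (S' \<union> J) (U - J) ((G \<union> H) \<inter> Q))))"
        by (rule bsum_Un) (use finQ QQ in \<open>auto intro: finite_subset\<close>)
      also have "\<dots> = bsum p Q (\<lambda>G. of_bool (reach (S' \<union> J) (U - J) G))"
      proof (rule bsum_cong)
        fix G assume G: "G \<subseteq> Q"
        have "bsum p (reach_pairs S' U - Q) (\<lambda>H. of_bool (reach (S' \<union> J) (U - J) ((G \<union> H) \<inter> Q)))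
          = bsum p (reach_pairs S' U - Q) (\<lambda>H. of_bool (reach (S' \<union> J) (U - J) G))"
        proof (rule bsum_cong)
          fix H assume "H \<subseteq> reach_pairs S' U - Q"
          then have "(G \<union> H) \<inter> Q = G" using G by auto
          then show "of_bool (reach (S' \<union> J) (U - J) ((G \<union> H) \<inter> Q)) = (of_bool (reach (S' \<union> J) (U - J) G) :: real)"
            by simp
        qed
        then show "bsum p (reach_pairs S' U - Q) (\<lambda>H. of_bool (reach (S' \<union> J) (U - J) ((G \<union> H) \<inter> Q)))
          = of_bool (reach (S' \<union> J) (U - J) G)"
          using finQ by (simp add: bsum_const)
      qed
      also have "\<dots> \<le> (1 - (1 - p) ^ (card (S' \<union> J) + card (U - J) - 1)) ^ card (U - J)"
        unfolding Q_def
        by (rule less.hyps) (use S JU less.prems fU c in \<open>auto intro: finite_subset\<close>)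
      also have "card (S' \<union> J) + card (U - J) - 1 = m"
        using c by (simp add: m_def)
      also have "card (U - J) = card (st - F)"
      proof -
        have "st - F = (\<lambda>x. {a, x}) ` (U - J)" by (auto simp: st_def J_def)
        then show ?thesis using inj by (metis Diff_subset card_image inj_on_subset)
      qed
      finally show ?thesis .
    qed
    have "bsum p (reach_pairs S U) (\<lambda>F. of_bool (reach S U F)) =
        bsum p st (\<lambda>F. bsum p (reach_pairs S' U) (\<lambda>G. of_bool (reach S U (F \<union> G))))"
      unfolding rp by (rule bsum_Un) (use S fU dis in \<open>auto simp: st_def finite_reach_pairs\<close>)
    also have "\<dots> \<le> bsum p st (\<lambda>F. (1 - (1 - p) ^ m) ^ card (st - F))"
      by (rule bsum_mono) (use assms inner in auto)
    also have "\<dots> = (\<Sum>F\<in>Pow st. p ^ card F * ((1 - p) * (1 - (1 - p) ^ m)) ^ card (st - F))"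
      by (simp add: bsum_def power_mult_distrib mult.assoc)
    also have "\<dots> = (p + (1 - p) * (1 - (1 - p) ^ m)) ^ card st"
      by (rule sum_Pow_binomial) (simp add: st_def fU)
    also have "card st = card U" using inj by (simp add: st_def card_image)
    also have "p + (1 - p) * (1 - (1 - p) ^ m) = 1 - (1 - p) ^ Suc m"
      by (simp add: algebra_simps)
    finally show ?thesis by (simp only: cm)
  qed
qed

definition conn :: "'v set \<Rightarrow> 'v set set \<Rightarrow> bool" where
  "conn A F \<longleftrightarrow> (\<forall>B\<subset>A. B \<noteq> {} \<longrightarrow> (\<exists>x\<in>B. \<exists>y\<in>A - B. {x, y} \<in> F))"

definition isolated :: "'v set \<Rightarrow> 'v set \<Rightarrow> 'v set set \<Rightarrow> bool" where
  "isolated V A F \<longleftrightarrow> (\<forall>x\<in>A. \<forall>y\<in>V - A. {x, y} \<notin> F)"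

definition is_component :: "'v set \<Rightarrow> 'v set set \<Rightarrow> 'v set \<Rightarrow> bool" where
  "is_component V F A \<longleftrightarrow> A \<subseteq> V \<and> A \<noteq> {} \<and> isolated V A F \<and> conn A F"

text \<open>In a connected graph everything is reached from any one vertex, so
  \<open>bsum_reach_le\<close> applies with a single source and card A - 1 further vertices.\<close>

lemma bsum_conn_le:
  assumes A: "finite A" "A \<noteq> {}" and p: "0 \<le> p" "p \<le> 1"
  shows "bsum p (vertex_pairs A) (\<lambda>F. of_bool (conn A F)) \<le> (1 - (1 - p) ^ (card A - 1)) ^ (card A - 1)"
proof -
  obtain a where a: "a \<in> A" using A by auto
  have rp: "reach_pairs {a} (A - {a}) = vertex_pairs A"
    unfolding reach_pairs_def vertex_pairs_def using a by (auto simp: insert_commute)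
  have "bsum p (vertex_pairs A) (\<lambda>F. of_bool (conn A F)) \<le>
      bsum p (vertex_pairs A) (\<lambda>F. of_bool (reach {a} (A - {a}) F))"
  proof (rule bsum_mono)
    fix F
    have "reach {a} (A - {a}) F" if "conn A F"
      unfolding reach_def
    proof (intro allI impI)
      fix B assume "B \<subseteq> A - {a}" "B \<noteq> {}"
      then have "B \<subset> A" using a by auto
      moreover have "{a} \<union> (A - {a}) - B = A - B" using a by auto
      ultimately show "\<exists>x\<in>B. \<exists>y\<in>{a} \<union> (A - {a}) - B. {x, y} \<in> F"
        using that \<open>B \<noteq> {}\<close> unfolding conn_def by metis
    qed
    then show "of_bool (conn A F) \<le> (of_bool (reach {a} (A - {a}) F) :: real)" by auto
  qed (use p in auto)
  also have "\<dots> \<le> (1 - (1 - p) ^ (card {a} + card (A - {a}) - 1)) ^ card (A - {a})"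
    unfolding rp[symmetric] by (rule bsum_reach_le) (use A p in auto)
  finally show ?thesis using A a by (simp add: card_Diff_singleton)
qed

text \<open>The weight is z to the excess of A, written as a quotient because the excess of a tree
  is -1.\<close>

definition component_sum :: "real \<Rightarrow> 'v set \<Rightarrow> 'v set set \<Rightarrow> real" where
  "component_sum z V F =
    (\<Sum>A\<in>Pow V. of_bool (is_component V F A) * (z ^ card (F \<inter> vertex_pairs A) / z ^ card A))"

text \<open>The pairs of V fall into three independent groups: those between A and V - A must all be
  absent, those inside A form the tilted connected graph, and those inside V - A are free.\<close>

lemma bsum_component_le:
  assumes V: "finite V" and A: "A \<subseteq> V" "A \<noteq> {}" and p: "0 \<le> p" "p \<le> 1" and z: "1 \<le> z"
  defines "k \<equiv> card A"
  shows "bsum p (vertex_pairs V)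
      (\<lambda>F. of_bool (is_component V F A) * (z ^ card (F \<inter> vertex_pairs A) / z ^ card A))
    \<le> (1 - p) ^ (k * (card V - k)) * (1 + (z - 1) * p) ^ (k choose 2) / z ^ k *
      (1 - ((1 - p) / (1 + (z - 1) * p)) ^ (k - 1)) ^ (k - 1)"
proof -
  define X where "X = (\<lambda>(x, y). {x, y}) ` (A \<times> (V - A))"
  define W where "W = vertex_pairs (V - A)"
  define s where "s = 1 + (z - 1) * p"
  have s: "s > 0" using p z unfolding s_def by (metis add_pos_nonneg diff_ge_0_iff_ge mult_nonneg_nonneg zero_less_one)
  have finA: "finite A" using A V finite_subset by auto
  have split: "vertex_pairs V = X \<union> (vertex_pairs A \<union> W)"
  proof (rule Set.set_eqI, rule iffI)
    fix e assume "e \<in> vertex_pairs V"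
    then obtain x y where e: "e = {x, y}" "x \<in> V" "y \<in> V" "x \<noteq> y" by (auto simp: vertex_pairs_def)
    have "e \<in> X" if "x \<in> A" "y \<notin> A" using that e by (auto simp: X_def)
    moreover have "e \<in> X" if "y \<in> A" "x \<notin> A"
      using that e unfolding X_def by (intro image_eqI[of _ _ "(y, x)"]) auto
    ultimately show "e \<in> X \<union> (vertex_pairs A \<union> W)"
      using e by (auto simp: W_def vertex_pairs_def)
  next
    fix e assume "e \<in> X \<union> (vertex_pairs A \<union> W)"
    then show "e \<in> vertex_pairs V" using A by (auto simp: X_def W_def vertex_pairs_def)
  qed
  have d1: "X \<inter> (vertex_pairs A \<union> W) = {}"
    by (auto simp: X_def W_def vertex_pairs_def doubleton_eq_iff)
  have d2: "vertex_pairs A \<inter> W = {}"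
    by (auto simp: W_def vertex_pairs_def doubleton_eq_iff)
  have fin: "finite X" "finite (vertex_pairs A)" "finite W"
    using V finA by (auto simp: X_def W_def finite_vertex_pairs)
  have cX: "card X = k * (card V - k)"
  proof -
    have "inj_on (\<lambda>(x, y). {x, y}) (A \<times> (V - A))" by (auto simp: inj_on_def doubleton_eq_iff)
    then show ?thesis using finA A by (simp add: X_def card_image card_cartesian_product k_def card_Diff_subset)
  qed
  have comp: "is_component V (F \<union> (G \<union> H)) A \<longleftrightarrow> F = {} \<and> conn A G"
    "(F \<union> (G \<union> H)) \<inter> vertex_pairs A = G"
    if "F \<subseteq> X" "G \<subseteq> vertex_pairs A" "H \<subseteq> W" for F G H
  proof -
    show "(F \<union> (G \<union> H)) \<inter> vertex_pairs A = G" using that d1 d2 by blast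
    have "isolated V A (F \<union> (G \<union> H)) \<longleftrightarrow> F = {}"
    proof
      assume "isolated V A (F \<union> (G \<union> H))"
      then show "F = {}" using that(1) by (auto simp: isolated_def X_def)
    next
      assume "F = {}"
      have "{x, y} \<notin> G \<union> H" if xy: "x \<in> A" "y \<in> V - A" for x y
      proof -
        have "{x, y} \<in> X" using xy unfolding X_def by (intro image_eqI[of _ _ "(x, y)"]) auto
        then show ?thesis using d1 that \<open>G \<subseteq> _\<close> \<open>H \<subseteq> _\<close> by blast
      qed
      then show "isolated V A (F \<union> (G \<union> H))" using \<open>F = {}\<close> by (simp add: isolated_def)
    qed
    moreover have "conn A (G \<union> H) \<longleftrightarrow> conn A G"
    proof -
      have "{x, y} \<notin> H" if "x \<in> B" "y \<in> A - B" "B \<subset> A" for x y B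
        using that \<open>H \<subseteq> W\<close> by (auto simp: W_def doubleton_in_vertex_pairs dest!: subsetD)
      then show ?thesis unfolding conn_def by (metis Un_iff)
    qed
    ultimately show "is_component V (F \<union> (G \<union> H)) A \<longleftrightarrow> F = {} \<and> conn A G"
      using A by (auto simp: is_component_def)
  qed
  have "bsum p (vertex_pairs V)
      (\<lambda>F. of_bool (is_component V F A) * (z ^ card (F \<inter> vertex_pairs A) / z ^ card A)) =
    bsum p X (\<lambda>F. bsum p (vertex_pairs A) (\<lambda>G. bsum p W (\<lambda>H.
      of_bool (is_component V (F \<union> (G \<union> H)) A) *
        (z ^ card ((F \<union> (G \<union> H)) \<inter> vertex_pairs A) / z ^ card A))))"
    unfolding split using fin d1 d2 by (simp add: bsum_Un)
  also have "\<dots> = bsum p X (\<lambda>F. bsum p (vertex_pairs A) (\<lambda>G. bsum p W (\<lambda>H.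
      of_bool (F = {}) * (1 / z ^ k * (z ^ card G * of_bool (conn A G))))))"
    by (intro bsum_cong) (simp add: comp k_def)
  also have "\<dots> = bsum p X (\<lambda>F. (1 / z ^ k * bsum p (vertex_pairs A) (\<lambda>G. z ^ card G * of_bool (conn A G))) * of_bool (F = {}))"
    by (rule bsum_cong) (simp only: bsum_const[OF fin(3)] bsum_cmult mult.commute)
  also have "\<dots> = (1 / z ^ k * bsum p (vertex_pairs A) (\<lambda>G. z ^ card G * of_bool (conn A G))) *
      bsum p X (\<lambda>F. of_bool (F = {}))"
    by (rule bsum_cmult)
  also have "bsum p X (\<lambda>F. of_bool (F = {})) = (1 - p) ^ card X"
  proof -
    have "bsum p X (\<lambda>F. of_bool (F = {})) = (\<Sum>F\<in>Pow X. if F = {} then (1 - p) ^ card X else 0)"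
      unfolding bsum_def by (intro sum.cong) auto
    also have "\<dots> = (1 - p) ^ card X" using fin by (simp add: sum.delta)
    finally show ?thesis .
  qed
  also have "bsum p (vertex_pairs A) (\<lambda>G. z ^ card G * of_bool (conn A G)) =
      s ^ (k choose 2) * bsum (z * p / s) (vertex_pairs A) (\<lambda>F. of_bool (conn A F))"
    using bsum_tilt[OF fin(2), of p z "\<lambda>F. of_bool (conn A F)"] p s finA
    by (simp add: s_def k_def card_vertex_pairs)
  finally have eq: "bsum p (vertex_pairs V)
      (\<lambda>F. of_bool (is_component V F A) * (z ^ card (F \<inter> vertex_pairs A) / z ^ card A)) =
    (1 - p) ^ card X * s ^ (k choose 2) / z ^ k *
      bsum (z * p / s) (vertex_pairs A) (\<lambda>F. of_bool (conn A F))"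
    by simp
  have "bsum (z * p / s) (vertex_pairs A) (\<lambda>F. of_bool (conn A F)) \<le>
      (1 - (1 - z * p / s) ^ (card A - 1)) ^ (card A - 1)"
    using finA A p z s by (intro bsum_conn_le) (auto simp: field_simps s_def)
  also have "1 - z * p / s = (1 - p) / s" using s by (simp add: field_simps s_def)
  finally show ?thesis
    unfolding eq s_def[symmetric] cX k_def using z s p by (intro mult_left_mono) auto
qed

lemma bsum_component_sum_le:
  assumes V: "finite V" and p: "0 \<le> p" "p \<le> 1" and z: "1 \<le> z"
  shows "bsum p (vertex_pairs V) (component_sum z V) \<le>
    (\<Sum>k=1..card V. real (card V choose k) *
      ((1 - p) ^ (k * (card V - k)) * (1 + (z - 1) * p) ^ (k choose 2) / z ^ k *
      (1 - ((1 - p) / (1 + (z - 1) * p)) ^ (k - 1)) ^ (k - 1)))"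
proof -
  define g where "g k = (1 - p) ^ (k * (card V - k)) * (1 + (z - 1) * p) ^ (k choose 2) / z ^ k *
      (1 - ((1 - p) / (1 + (z - 1) * p)) ^ (k - 1)) ^ (k - 1)" for k
  have "bsum p (vertex_pairs V) (component_sum z V) = (\<Sum>A\<in>Pow V. bsum p (vertex_pairs V)
      (\<lambda>F. of_bool (is_component V F A) * (z ^ card (F \<inter> vertex_pairs A) / z ^ card A)))"
    unfolding component_sum_def by (rule bsum_sum)
  also have "\<dots> = (\<Sum>A\<in>Pow V - {{}}. bsum p (vertex_pairs V)
      (\<lambda>F. of_bool (is_component V F A) * (z ^ card (F \<inter> vertex_pairs A) / z ^ card A)))"
    using V by (intro sum.mono_neutral_right) (auto simp: is_component_def bsum_def)
  also have "\<dots> \<le> (\<Sum>A\<in>Pow V - {{}}. g (card A))"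
    unfolding g_def by (intro sum_mono bsum_component_le) (use assms in auto)
  also have "\<dots> = (\<Sum>k=1..card V. \<Sum>A\<in>{A \<in> Pow V - {{}}. card A = k}. g (card A))"
    using V by (intro sum.group[symmetric])
      (auto simp: card_mono card_gt_0_iff Suc_le_eq dest: finite_subset)
  also have "\<dots> = (\<Sum>k=1..card V. real (card V choose k) * g k)"
  proof (rule sum.cong[OF refl])
    fix k assume "k \<in> {1..card V}"
    then have "{A \<in> Pow V - {{}}. card A = k} = {A. A \<subseteq> V \<and> card A = k}" by auto
    then show "(\<Sum>A\<in>{A \<in> Pow V - {{}}. card A = k}. g (card A)) = real (card V choose k) * g k"
      using n_subsets[OF V, of k] by simp
  qed
  finally show ?thesis by (simp add: g_def)
qed

section \<open>The sum over component sizes\<close>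

lemma pow6_fact_le: "(6::real) ^ m * fact m \<le> fact (2 * m + 1)"
proof (induction m)
  case (Suc m)
  have "(6::real) ^ Suc m * fact (Suc m) = (6 * (real m + 1)) * (6 ^ m * fact m)"
    by (simp add: algebra_simps)
  also have "\<dots> \<le> (6 * (real m + 1)) * fact (2 * m + 1)"
    using Suc by (intro mult_left_mono) auto
  also have "\<dots> \<le> ((2 * real m + 3) * (2 * real m + 2)) * fact (2 * m + 1)"
    by (intro mult_right_mono) (auto simp: algebra_simps)
  also have "\<dots> = fact (2 * Suc m + 1)"
    by (simp add: algebra_simps)
  finally show ?case .
qed simp

text \<open>Termwise comparison of power series: the coefficients are 1 / (2 m + 1)! and 1 / (6^m
  m!).\<close>

lemma sinh_le:
  fixes x :: real
  assumes "0 \<le> x"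
  shows "sinh x \<le> x * exp (x\<^sup>2 / 6)"
proof (rule sums_le)
  show "(\<lambda>n. if even n then 0 else x ^ n /\<^sub>R fact n) sums sinh x"
    by (rule sinh_converges)
  have "(\<lambda>m. x * ((x\<^sup>2 / 6) ^ m /\<^sub>R fact m)) sums (x * exp (x\<^sup>2 / 6))"
    by (intro sums_mult exp_converges)
  then show "(\<lambda>n. if even n then 0 else x * ((x\<^sup>2 / 6) ^ ((n - 1) div 2) /\<^sub>R fact ((n - 1) div 2)))
      sums (x * exp (x\<^sup>2 / 6))"
    by (rule sums_if')
  fix n :: nat
  show "(if even n then 0 else x ^ n /\<^sub>R fact n) \<le>
    (if even n then 0 else x * ((x\<^sup>2 / 6) ^ ((n - 1) div 2) /\<^sub>R fact ((n - 1) div 2)))"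
  proof (cases "even n")
    case False
    then obtain m where n: "n = 2 * m + 1" by (auto elim: oddE)
    have "x ^ n / fact n \<le> x ^ n / (6 ^ m * fact m)"
      unfolding n by (intro divide_left_mono pow6_fact_le) (use assms in auto)
    also have "\<dots> = x * ((x\<^sup>2 / 6) ^ m / fact m)"
      by (simp add: n power_divide power_mult)
    finally have "x ^ n /\<^sub>R fact n \<le> x * ((x\<^sup>2 / 6) ^ m /\<^sub>R fact m)"
      by (simp only: real_scaleR_def divide_inverse_commute)
    moreover have "(n - 1) div 2 = m" by (simp add: n)
    ultimately show ?thesis using False by (simp only: if_False)
  qed auto
qed

text \<open>From 1 - exp (-a) = 2 exp (-a/2) sinh (a/2). The exponent agrees with the logarithm of
  (1 - exp (-a)) / a to second order; this precision is required, since a^2 / 24 produces a cubic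
  term of the rate.\<close>

lemma one_minus_exp_le:
  fixes a :: real
  assumes "0 \<le> a"
  shows "1 - exp (- a) \<le> a * exp (- a / 2 + a\<^sup>2 / 24)"
proof -
  have "1 - exp (- a) = 2 * exp (- a / 2) * sinh (a / 2)"
    by (simp add: sinh_def algebra_simps flip: exp_add)
  also have "\<dots> \<le> 2 * exp (- a / 2) * (a / 2 * exp ((a / 2)\<^sup>2 / 6))"
    by (intro mult_left_mono sinh_le) (use assms in auto)
  also have "\<dots> = a * exp (- a / 2 + a\<^sup>2 / 24)"
    by (simp add: power_divide mult_exp_exp algebra_simps)
  finally show ?thesis .
qed

lemma ln_one_plus_le:
  fixes x :: real
  assumes "0 \<le> x"
  shows "ln (1 + x) \<le> x - x\<^sup>2 / 2 + x ^ 3 / 3"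
proof -
  let ?f = "\<lambda>x::real. x - x\<^sup>2 / 2 + x ^ 3 / 3 - ln (1 + x)"
  have "?f 0 \<le> ?f x"
  proof (rule DERIV_nonneg_imp_nondecreasing[OF assms])
    fix t :: real assume t: "0 \<le> t" "t \<le> x"
    have "(?f has_real_derivative (1 - t + t\<^sup>2 - 1 / (1 + t))) (at t)"
      using t by (auto intro!: derivative_eq_intros simp: power2_eq_square)
    moreover have "1 - t + t\<^sup>2 - 1 / (1 + t) = t ^ 3 / (1 + t)"
      using t by (simp add: field_simps power2_eq_square power3_eq_cube)
    ultimately show "\<exists>y. (?f has_real_derivative y) (at t) \<and> 0 \<le> y"
      using t by (intro exI[of _ "t ^ 3 / (1 + t)"]) auto
  qed
  then show ?thesis by simp
qed

lemma one_minus_le_exp: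
  fixes x :: real
  assumes "0 \<le> x" "x < 1"
  shows "1 - x \<le> exp (- (x + x\<^sup>2 / 2 + x ^ 3 / 3))"
proof -
  let ?f = "\<lambda>x::real. - (x + x\<^sup>2 / 2 + x ^ 3 / 3) - ln (1 - x)"
  have "?f 0 \<le> ?f x"
  proof (rule DERIV_nonneg_imp_nondecreasing[OF assms(1)])
    fix t :: real assume t: "0 \<le> t" "t \<le> x"
    have "(?f has_real_derivative (- (1 + t + t\<^sup>2) + 1 / (1 - t))) (at t)"
      using t assms by (auto intro!: derivative_eq_intros simp: power2_eq_square)
    moreover have "- (1 + t + t\<^sup>2) + 1 / (1 - t) = t ^ 3 / (1 - t)"
      using t assms by (simp add: field_simps power2_eq_square power3_eq_cube)
    ultimately show "\<exists>y. (?f has_real_derivative y) (at t) \<and> 0 \<le> y"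
      using t assms by (intro exI[of _ "t ^ 3 / (1 - t)"]) auto
  qed
  then have "ln (1 - x) \<le> - (x + x\<^sup>2 / 2 + x ^ 3 / 3)" by simp
  then have "exp (ln (1 - x)) \<le> exp (- (x + x\<^sup>2 / 2 + x ^ 3 / 3))" by (simp only: exp_le_cancel_iff)
  then show ?thesis using assms by simp
qed

text \<open>
  A weak form of Stirling's formula: the factor \<open>k powr (1 / 4)\<close> is what makes the sum over the
  component sizes converge.
\<close>

lemma fact_lower_bound:
  assumes "1 \<le> k"
  shows "real k ^ k * real k powr (1 / 4) \<le> fact k * exp (real k - 1)"
  using assms
proof (induction k rule: dec_induct)
  case (step k)
  define x where "x = 1 / real k"
  have k: "real k \<ge> 1" using step by simp
  \<comment> \<open>The induction step reduces to (1 + 1/k)^(k + 1/4) \<le> e. The cubic bound on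
    the logarithm is too weak at k = 1.\<close>
  have l: "(real k + 1 / 4) * ln (1 + x) \<le> 1"
  proof (cases "k = 1")
    case True
    then show ?thesis using ln2_le_25_over_36 by (simp add: x_def)
  next
    case False
    then have x: "0 < x" "x \<le> 1 / 2" using step by (auto simp: x_def field_simps)
    have "ln (1 + x) \<le> x - x\<^sup>2 / 2 + x ^ 3 / 3" using x by (intro ln_one_plus_le) auto
    then have "(1 / x + 1 / 4) * ln (1 + x) \<le> (1 / x + 1 / 4) * (x - x\<^sup>2 / 2 + x ^ 3 / 3)"
      using x by (intro mult_left_mono) auto
    also have "\<dots> = 1 - x / 4 * (1 - 5 / 6 * x - x\<^sup>2 / 3)"
      using x by (simp add: field_simps power2_eq_square power3_eq_cube)
    also have "\<dots> \<le> 1"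
    proof -
      have "x * x \<le> x * 1" using x by (intro mult_left_mono) auto
      then have "x\<^sup>2 \<le> x" by (simp add: power2_eq_square)
      then have "0 \<le> 1 - 5 / 6 * x - x\<^sup>2 / 3" using x by linarith
      then show ?thesis using x by simp
    qed
    finally show ?thesis by (simp add: x_def)
  qed
  have a: "(1 + x) powr (real k + 1 / 4) \<le> exp 1"
  proof -
    have "x > 0" using k by (simp add: x_def)
    then have "(1 + x) powr (real k + 1 / 4) = exp ((real k + 1 / 4) * ln (1 + x))" by (simp add: powr_def)
    then show ?thesis using l by simp
  qed
  have e: "real (Suc k) = real k * (1 + x)" using k by (simp add: x_def field_simps)
  have x0: "x > 0" using k by (simp add: x_def)
  have "real (Suc k) ^ Suc k * real (Suc k) powr (1 / 4) =
      real (Suc k) * (real k * (1 + x)) ^ k * (real k * (1 + x)) powr (1 / 4)"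
    by (simp only: power_Suc e)
  also have "\<dots> = real (Suc k) * (real k ^ k * real k powr (1 / 4)) * ((1 + x) powr real k * (1 + x) powr (1 / 4))"
    using k x0 by (simp add: power_mult_distrib powr_mult powr_realpow)
  also have "\<dots> = real (Suc k) * (real k ^ k * real k powr (1 / 4)) * (1 + x) powr (real k + 1 / 4)"
    by (simp add: powr_add)
  also have "\<dots> \<le> real (Suc k) * (fact k * exp (real k - 1)) * exp 1"
    by (intro mult_mono[OF mult_left_mono[OF step.IH] a]) auto
  also have "\<dots> = fact (Suc k) * exp (real (Suc k) - 1)"
    by (simp flip: exp_add)
  finally show ?case .
qed simp

lemma binomial_times_fact: "(n choose k) * fact k = (\<Prod>i<k. n - i)"
proof (induction k)
  case (Suc k)
  have "(n choose Suc k) * fact (Suc k) = (Suc k * (n choose Suc k)) * fact k"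
    by (simp add: algebra_simps)
  also have "Suc k * (n choose Suc k) = (n - k) * (n choose k)"
    by (metis binomial_absorb_comp binomial_absorption mult.commute)
  finally show ?case using Suc by (simp add: algebra_simps)
qed simp

lemma sum_powers_ge:
  fixes k :: nat
  shows "real k ^ 2 / 2 - real k / 2 \<le> (\<Sum>i<k. real i)"
    "real k ^ 3 / 3 - real k ^ 2 / 2 \<le> (\<Sum>i<k. real i ^ 2)"
    "real k ^ 4 / 4 - real k ^ 3 / 2 \<le> (\<Sum>i<k. real i ^ 3)"
proof -
  show "real k ^ 2 / 2 - real k / 2 \<le> (\<Sum>i<k. real i)"
    by (induction k) (simp_all add: power2_eq_square field_simps)
  show "real k ^ 3 / 3 - real k ^ 2 / 2 \<le> (\<Sum>i<k. real i ^ 2)"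
    by (induction k) (simp_all add: power2_eq_square power3_eq_cube field_simps)
  show "real k ^ 4 / 4 - real k ^ 3 / 2 \<le> (\<Sum>i<k. real i ^ 3)"
    by (induction k) (simp_all add: power3_eq_cube power4_eq_xxxx field_simps)
qed

text \<open>Each factor 1 - i/n of the falling factorial is bounded by three terms of its logarithm.
  The power sums are replaced by their leading terms; the errors are at most 1/2 + 1/4 + 1/6, which
  the summand 1 in the exponent covers.\<close>

lemma binomial_upper_bound:
  assumes "k \<le> n" "n \<ge> 1"
  shows "real (n choose k) \<le> real n ^ k / fact k *
    exp (1 - (real k ^ 2 / (2 * real n) + real k ^ 3 / (6 * real n ^ 2) + real k ^ 4 / (12 * real n ^ 3)))"
proof -
  define N where "N = real n"
  define K where "K = real k"
  have N: "N \<ge> 1" and K: "0 \<le> K" "K \<le> N" using assms by (auto simp: N_def K_def)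
  have "real (n choose k) * fact k = (\<Prod>i<k. real (n - i))"
    using binomial_times_fact[of n k] by (metis of_nat_fact of_nat_mult of_nat_prod)
  also have "\<dots> \<le> (\<Prod>i<k. N * exp (- (real i / N + real i ^ 2 / (2 * N ^ 2) + real i ^ 3 / (3 * N ^ 3))))"
  proof (rule prod_mono, safe)
    fix i assume i: "i < k"
    have x: "0 \<le> real i / N" "real i / N < 1" using i assms by (auto simp: N_def)
    have "real (n - i) = N * (1 - real i / N)" using i assms by (simp add: N_def field_simps of_nat_diff)
    also have "\<dots> \<le> N * exp (- (real i / N + (real i / N)\<^sup>2 / 2 + (real i / N) ^ 3 / 3))"
      using N x by (intro mult_left_mono one_minus_le_exp) auto
    finally show "real (n - i) \<le> N * exp (- (real i / N + real i ^ 2 / (2 * N ^ 2) + real i ^ 3 / (3 * N ^ 3)))"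
      by (simp add: power_divide mult.commute)
  qed auto
  also have "\<dots> = N ^ k * exp (- ((\<Sum>i<k. real i) / N + (\<Sum>i<k. real i ^ 2) / (2 * N ^ 2) + (\<Sum>i<k. real i ^ 3) / (3 * N ^ 3)))"
  proof -
    have "(\<Sum>i<k. - (real i / N + real i ^ 2 / (2 * N ^ 2) + real i ^ 3 / (3 * N ^ 3))) =
        - ((\<Sum>i<k. real i) / N + (\<Sum>i<k. real i ^ 2) / (2 * N ^ 2) + (\<Sum>i<k. real i ^ 3) / (3 * N ^ 3))"
      by (simp only: sum_negf sum.distrib sum_divide_distrib)
    then show ?thesis unfolding prod.distrib exp_sum[OF finite_lessThan, symmetric] by simp
  qed
  also have "\<dots> \<le> N ^ k * exp (1 - (K ^ 2 / (2 * N) + K ^ 3 / (6 * N ^ 2) + K ^ 4 / (12 * N ^ 3)))"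
  proof -
    have a: "(K ^ 2 / 2 - K / 2) / N \<le> (\<Sum>i<k. real i) / N"
      using N sum_powers_ge(1)[of k] unfolding K_def by (intro divide_right_mono) auto
    have b: "(K ^ 3 / 3 - K ^ 2 / 2) / (2 * N ^ 2) \<le> (\<Sum>i<k. real i ^ 2) / (2 * N ^ 2)"
      using N sum_powers_ge(2)[of k] unfolding K_def by (intro divide_right_mono) auto
    have c: "(K ^ 4 / 4 - K ^ 3 / 2) / (3 * N ^ 3) \<le> (\<Sum>i<k. real i ^ 3) / (3 * N ^ 3)"
      using N sum_powers_ge(3)[of k] unfolding K_def by (intro divide_right_mono) auto
    have r: "K ^ j / N ^ j \<le> 1" for j
      using K N by (simp add: power_mono flip: power_divide) (simp add: power_le_one)
    have E: "(K ^ 2 / 2 - K / 2) / N = K ^ 2 / (2 * N) - 1 / 2 * (K ^ 1 / N ^ 1)"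
      "(K ^ 3 / 3 - K ^ 2 / 2) / (2 * N ^ 2) = K ^ 3 / (6 * N ^ 2) - 1 / 4 * (K ^ 2 / N ^ 2)"
      "(K ^ 4 / 4 - K ^ 3 / 2) / (3 * N ^ 3) = K ^ 4 / (12 * N ^ 3) - 1 / 6 * (K ^ 3 / N ^ 3)"
      using N by (simp_all add: field_simps)
    have "- ((\<Sum>i<k. real i) / N + (\<Sum>i<k. real i ^ 2) / (2 * N ^ 2) + (\<Sum>i<k. real i ^ 3) / (3 * N ^ 3))
        \<le> 1 - (K ^ 2 / (2 * N) + K ^ 3 / (6 * N ^ 2) + K ^ 4 / (12 * N ^ 3))"
      using a[unfolded E] b[unfolded E] c[unfolded E] r[of 1] r[of 2] r[of 3] by linarith
    then show ?thesis using N by (intro mult_left_mono) auto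
  qed
  finally show ?thesis by (simp add: N_def K_def field_simps)
qed

text \<open>
  For \<open>y = s * e\<close> the difference of the two sides is at least \<open>e ^ 3 * (h + y * b)\<close>, where \<open>h\<close> and
  \<open>b\<close> depend only on \<open>s\<close>.  This is affine in \<open>y\<close>, so that it suffices to check \<open>h \<ge> 0\<close> and
  \<open>h + b \<ge> 0\<close> for all \<open>s \<ge> 0\<close>.
\<close>

lemma rate_le:
  fixes y e :: real
  assumes "0 \<le> y" "y \<le> 1" "0 \<le> e"
  shows "y * (- (e\<^sup>2) / 2 + e ^ 3 / 3) + y\<^sup>2 * e / 2 - y ^ 3 / 6 + (1 + e)\<^sup>2 * y ^ 3 / 12 - y ^ 4 / 12 \<le> e ^ 3"
proof (cases "e = 0")
  case True
  have "0 \<le> y ^ 3" "0 \<le> y ^ 4" using assms by auto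
  then have "- (y ^ 3) \<le> y ^ 4" by linarith
  with True show ?thesis by simp
next
  case False
  define s where "s = y / e"
  have e: "e > 0" and s: "s \<ge> 0" and y: "y = s * e" using False assms by (auto simp: s_def)
  define h where "h = (s ^ 3 - 6 * s\<^sup>2 + 6 * s + 12) / 12"
  define b where "b = (s ^ 3 - 2 * s\<^sup>2 - 4 - s) / 12"
  \<comment> \<open>This polynomial is 12 h. Its minimum over s \<ge> 0 lies at 2 + sqrt 2, which
    171/50 approximates; splitting off the square leaves a positive remainder.\<close>
  have "s ^ 3 - 6 * s\<^sup>2 + 6 * s + 12 = (s - 171 / 50)\<^sup>2 * (s + 21 / 25) + 123 / 2500 * s + 135939 / 62500"
    by (simp add: power2_eq_square power3_eq_cube field_simps)
  then have h: "h \<ge> 0" using s by (simp add: h_def)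
  \<comment> \<open>This polynomial is 12 (h + b), with its minimum near 231/100.\<close>
  have "2 * s ^ 3 - 8 * s\<^sup>2 + 5 * s + 8 = 2 * ((s - 231 / 100)\<^sup>2 * (s + 31 / 50)) + 283 / 5000 * s + 345809 / 250000"
    by (simp add: power2_eq_square power3_eq_cube field_simps)
  moreover have "2 * ((s - 231 / 100)\<^sup>2 * (s + 31 / 50)) \<ge> 0" using s by simp
  ultimately have "2 * s ^ 3 - 8 * s\<^sup>2 + 5 * s + 8 \<ge> 0" using s by linarith
  then have g: "h + b \<ge> 0" by (simp add: h_def b_def field_simps)
  have yb: "0 \<le> h + y * b"
  proof (cases "b \<ge> 0")
    case False
    then have "1 * b \<le> y * b" using assms by (intro mult_right_mono_neg) auto
    then show ?thesis using g by simp
  qed (use h assms in simp)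
  have "y * s \<le> 1 * s" using assms s by (intro mult_right_mono) auto
  then have "b \<le> (s ^ 3 - 2 * s\<^sup>2 - 4 - y * s) / 12" by (simp add: b_def)
  then have "0 \<le> h + y * ((s ^ 3 - 2 * s\<^sup>2 - 4 - y * s) / 12)"
    using yb mult_left_mono[of b _ y] assms by fastforce
  then have "0 \<le> e ^ 3 * (h + y * ((s ^ 3 - 2 * s\<^sup>2 - 4 - y * s) / 12))"
    using e by (intro mult_nonneg_nonneg) auto
  also have "\<dots> = e ^ 3 - (y * (- (e\<^sup>2) / 2 + e ^ 3 / 3) + y\<^sup>2 * e / 2 - y ^ 3 / 6 + (1 + e)\<^sup>2 * y ^ 3 / 12 - y ^ 4 / 12)"
    unfolding y h_def by (simp add: field_simps power2_eq_square power3_eq_cube power4_eq_xxxx)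
  finally show ?thesis by simp
qed

text \<open>The power (c exp (1 - c))^(k - 1) is the part of a summand that is exponential in k. For
  c \<le> 1 the trivial bound 1 is enough, so only the positive part of c - 1 enters.\<close>

lemma times_exp_le:
  fixes c :: real
  assumes "0 \<le> c"
  defines "e \<equiv> max 0 (c - 1)"
  shows "c * exp (1 - c) \<le> exp (- (e\<^sup>2) / 2 + e ^ 3 / 3)"
proof (cases "c \<le> 1")
  case True
  have "c \<le> exp (c - 1)" using exp_ge_add_one_self[of "c - 1"] by simp
  then have "c * exp (1 - c) \<le> exp (c - 1) * exp (1 - c)" by (intro mult_right_mono) auto
  also have "\<dots> = 1" by (simp flip: exp_add)
  finally show ?thesis using True by (simp add: e_def)
next
  case False
  then have c: "c = 1 + e" "e \<ge> 0" by (auto simp: e_def)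
  have "1 + e = exp (ln (1 + e))" using c by simp
  also have "\<dots> \<le> exp (e - e\<^sup>2 / 2 + e ^ 3 / 3)" using ln_one_plus_le[OF c(2)] by simp
  finally have "c * exp (1 - c) \<le> exp (e - e\<^sup>2 / 2 + e ^ 3 / 3) * exp (1 - c)"
    using c by (intro mult_right_mono) auto
  also have "\<dots> = exp (- (e\<^sup>2) / 2 + e ^ 3 / 3)" using c by (simp flip: exp_add)
  finally show ?thesis .
qed

section \<open>The weight of the components of a given size\<close>

lemma conn_factor_le:
  fixes p :: real
  assumes p: "0 \<le> p" "p \<le> 1 / 2" and k: "1 \<le> k" "real k * p \<le> 2"
  shows "(1 - ((1 - p) / (1 + (sqrt 2 - 1) * p)) ^ (k - 1)) ^ (k - 1) \<le>
    (sqrt 2 * p * real k) ^ (k - 1) * exp (- (sqrt 2 * p * (real k)\<^sup>2) / 2 + p\<^sup>2 * real k ^ 3 / 12 + 11)"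
proof -
  define z where "z = sqrt (2 :: real)"
  have z: "1 \<le> z" "z\<^sup>2 = 2" unfolding z_def by auto
  have z32: "z \<le> 3 / 2" unfolding z_def by (rule real_le_lsqrt) (auto simp: power2_eq_square)
  note z = z z32
  define K where "K = real k"
  have K: "1 \<le> K" "K * p \<le> 2" using k by (auto simp: K_def)
  \<comment> \<open>With the tilted probability p', -ln (1 - p') is at most z p + 2 p^2, and this is
    at most b because z \<ge> 1.\<close>
  define b where "b = z * p * (1 + 2 * p)"
  have b: "b \<ge> 0" using z p by (simp add: b_def)
  define a where "a = (K - 1) * b"
  have a: "0 \<le> a" using K b by (simp add: a_def)
  have k1: "real (k - 1) = K - 1" using k by (simp add: K_def of_nat_diff)
  have s: "1 + (z - 1) * p > 0" using z p by (meson add_pos_nonneg diff_ge_0_iff_ge mult_nonneg_nonneg zero_less_one)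
  have "exp (- b) \<le> (1 - p) / (1 + (z - 1) * p)"
  proof -
    have l: "exp (- p - 2 * p\<^sup>2) \<le> 1 - p"
      using ln_one_minus_pos_lower_bound[of p] p by (simp add: ln_ge_iff)
    have "exp (- b) * (1 + (z - 1) * p) \<le> exp (- b) * exp ((z - 1) * p)"
      by (intro mult_left_mono) auto
    also have "\<dots> = exp (- b + (z - 1) * p)" by (simp flip: exp_add)
    also have "\<dots> \<le> exp (- p - 2 * p\<^sup>2)"
    proof -
      have "1 * p\<^sup>2 \<le> z * p\<^sup>2" using z by (intro mult_right_mono) auto
      then show ?thesis by (simp add: b_def algebra_simps power2_eq_square)
    qed
    finally show ?thesis using l s by (simp add: field_simps)
  qed
  then have "exp (- b) ^ (k - 1) \<le> ((1 - p) / (1 + (z - 1) * p)) ^ (k - 1)"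
    by (intro power_mono) auto
  then have "1 - ((1 - p) / (1 + (z - 1) * p)) ^ (k - 1) \<le> 1 - exp (- a)"
    by (simp add: a_def k1[symmetric] flip: exp_of_nat_mult)
  moreover have "0 \<le> 1 - ((1 - p) / (1 + (z - 1) * p)) ^ (k - 1)"
  proof -
    have "0 \<le> (z - 1) * p" using z p by simp
    then have "(1 - p) / (1 + (z - 1) * p) \<le> 1" "0 \<le> (1 - p) / (1 + (z - 1) * p)" using s p by auto
    then show ?thesis by (simp add: power_le_one)
  qed
  ultimately have "(1 - ((1 - p) / (1 + (z - 1) * p)) ^ (k - 1)) ^ (k - 1) \<le> (a * exp (- a / 2 + a\<^sup>2 / 24)) ^ (k - 1)"
    using one_minus_exp_le[OF a] by (intro power_mono) auto
  also have "\<dots> = a ^ (k - 1) * exp ((K - 1) * (- a / 2 + a\<^sup>2 / 24))"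
    by (simp add: power_mult_distrib k1[symmetric] flip: exp_of_nat_mult)
  \<comment> \<open>The constants 4 and 7 = 3 + 4 collect the errors of replacing k - 1 by k and b
    by z * p. They stay bounded because k * p \<le> 2.\<close>
  also have "\<dots> \<le> ((z * p * K) ^ (k - 1) * exp 4) * exp (- (z * p * K\<^sup>2) / 2 + p\<^sup>2 * K ^ 3 / 12 + 7)"
  proof (rule mult_mono)
    have "a ^ (k - 1) \<le> ((z * p * K) * (1 + 2 * p)) ^ (k - 1)"
      using a K b z p by (intro power_mono) (auto simp: a_def b_def algebra_simps)
    also have "\<dots> \<le> (z * p * K) ^ (k - 1) * exp (2 * p) ^ (k - 1)"
      unfolding power_mult_distrib using z p K by (intro mult_left_mono power_mono) auto
    also have "exp (2 * p) ^ (k - 1) = exp ((K - 1) * (2 * p))"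
      by (simp add: k1[symmetric] flip: exp_of_nat_mult)
    also have "\<dots> \<le> exp 4" using K p by (simp add: algebra_simps)
    finally show "a ^ (k - 1) \<le> (z * p * K) ^ (k - 1) * exp 4"
      using z p K by (simp add: mult_left_mono)
    have "(K - 1) * a / 2 \<ge> z * p * K\<^sup>2 / 2 - 3"
    proof -
      have "(K - 1) * a \<ge> (K - 1)\<^sup>2 * (z * p)"
      proof -
        have "z * p * 1 \<le> b" unfolding b_def using z p by (intro mult_left_mono) auto
        then have "(K - 1)\<^sup>2 * (z * p) \<le> (K - 1)\<^sup>2 * b" by (intro mult_left_mono) auto
        then show ?thesis by (simp add: a_def power2_eq_square mult.assoc)
      qed
      moreover have "(K - 1)\<^sup>2 * (z * p) = z * p * K\<^sup>2 - 2 * (z * (K * p)) + z * p"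
        by (simp add: power2_eq_square algebra_simps)
      moreover have "z * (K * p) \<le> 3 / 2 * 2" using z K p by (intro mult_mono) auto
      moreover have "0 \<le> z * p" using z p by simp
      ultimately show ?thesis by simp
    qed
    moreover have "(K - 1) * a\<^sup>2 / 24 \<le> p\<^sup>2 * K ^ 3 / 12 + 4"
    proof -
      have "(K - 1) * a\<^sup>2 = (K - 1) ^ 3 * b\<^sup>2"
        by (simp add: a_def power_mult_distrib power2_eq_square power3_eq_cube)
      also have "\<dots> \<le> K ^ 3 * b\<^sup>2"
        using K by (intro mult_right_mono power_mono) auto
      \<comment> \<open>Here z^2 = 2 determines the coefficient 1/12.\<close>
      also have "b\<^sup>2 = z\<^sup>2 * (p\<^sup>2 * (1 + 2 * p)\<^sup>2)" by (simp add: b_def power_mult_distrib)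
      also have "\<dots> = 2 * p\<^sup>2 + 2 * p\<^sup>2 * (4 * p + 4 * p\<^sup>2)"
        by (simp only: z(2)) (simp add: power2_eq_square algebra_simps)
      also have "K ^ 3 * \<dots> = 2 * (p\<^sup>2 * K ^ 3) + 8 * ((K * p) ^ 3 * (1 + p))"
        by (simp add: power2_eq_square power3_eq_cube algebra_simps)
      also have "(K * p) ^ 3 * (1 + p) \<le> 2 ^ 3 * (3 / 2)"
        using K p by (intro mult_mono power_mono) auto
      finally show ?thesis by (simp add: mult.commute)
    qed
    moreover have "(K - 1) * (- a / 2 + a\<^sup>2 / 24) = - ((K - 1) * a / 2) + (K - 1) * a\<^sup>2 / 24"
      by (simp add: right_diff_distrib)
    ultimately have "(K - 1) * (- a / 2 + a\<^sup>2 / 24) \<le> - (z * p * K\<^sup>2) / 2 + p\<^sup>2 * K ^ 3 / 12 + 7"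
      by linarith
    then show "exp ((K - 1) * (- a / 2 + a\<^sup>2 / 24)) \<le> exp (- (z * p * K\<^sup>2) / 2 + p\<^sup>2 * K ^ 3 / 12 + 7)"
      by simp
  qed (use z p K in auto)
  also have "\<dots> = (z * p * K) ^ (k - 1) * exp (- (z * p * K\<^sup>2) / 2 + p\<^sup>2 * K ^ 3 / 12 + 11)"
    by (simp add: mult.assoc flip: exp_add)
  finally show ?thesis by (simp add: z_def K_def)
qed

text \<open>The bound of \<open>bsum_component_sum_le\<close> on the expected total weight of the
  components of size k, for z = sqrt 2.\<close>

definition component_weight :: "nat \<Rightarrow> real \<Rightarrow> nat \<Rightarrow> real" where
  "component_weight n p k = real (n choose k) *
      ((1 - p) ^ (k * (n - k)) * (1 + (sqrt 2 - 1) * p) ^ (k choose 2) / sqrt 2 ^ k *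
      (1 - ((1 - p) / (1 + (sqrt 2 - 1) * p)) ^ (k - 1)) ^ (k - 1))"

lemma choose_two_le: "real (k choose 2) \<le> (real k)\<^sup>2 / 2"
proof -
  have "2 * (k choose 2) \<le> k * k" unfolding choose_two by (simp add: algebra_simps)
  then have "real (2 * (k choose 2)) \<le> real (k * k)" by (rule of_nat_mono)
  then show ?thesis by (simp add: power2_eq_square)
qed

lemma tilt_factor_le:
  fixes p :: real
  assumes "0 \<le> p"
  shows "(1 + (sqrt 2 - 1) * p) ^ (k choose 2) \<le> exp ((sqrt 2 - 1) * p * (real k)\<^sup>2 / 2)"
proof -
  have z: "0 \<le> (sqrt 2 - 1) * p" using assms by simp
  have "(1 + (sqrt 2 - 1) * p) ^ (k choose 2) \<le> exp ((sqrt 2 - 1) * p) ^ (k choose 2)"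
    using z by (intro power_mono) auto
  also have "\<dots> = exp (real (k choose 2) * ((sqrt 2 - 1) * p))" by (simp add: exp_of_nat_mult)
  also have "\<dots> \<le> exp ((real k)\<^sup>2 / 2 * ((sqrt 2 - 1) * p))"
    using mult_right_mono[OF choose_two_le z, of k] by simp
  finally show ?thesis by (simp add: mult_ac)
qed

lemma component_weight_le:
  fixes c :: real
  assumes n: "4 \<le> n" and c: "0 \<le> c" "c \<le> 2" and k: "1 \<le> k" "k \<le> n"
  shows "component_weight n (c / real n) k \<le>
    exp 13 * real n * real k powr (- 5 / 4) * exp (real n * max 0 (c - 1) ^ 3)"
proof -
  define N where "N = real n"
  define K where "K = real k"
  define p where "p = c / N"
  define e where "e = max 0 (c - 1)"
  define z where "z = sqrt (2::real)"
  have N: "N \<ge> 4" and K: "1 \<le> K" "K \<le> N" using n k by (auto simp: N_def K_def)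
  have p: "0 \<le> p" "p \<le> 1 / 2" using c N by (auto simp: p_def field_simps)
  have z: "1 \<le> z" by (simp add: z_def)
  have Np: "N * p = c" using N by (simp add: p_def)
  have Kp: "K * p \<le> 2"
  proof -
    have "K * p \<le> N * p" using K p by (intro mult_right_mono) auto
    then show ?thesis using Np c by simp
  qed
  have e: "0 \<le> e" "e \<le> 1" "c \<le> 1 + e" using c by (auto simp: e_def)
  have F1: "real (n choose k) \<le> N ^ k / fact k * exp (1 - (K ^ 2 / (2 * N) + K ^ 3 / (6 * N ^ 2) + K ^ 4 / (12 * N ^ 3)))"
    using binomial_upper_bound[of k n] n k by (simp add: N_def K_def)
  have F2: "(1 - p) ^ (k * (n - k)) \<le> exp (- c * K + c * K\<^sup>2 / N)"
  proof -
    have "(1 - p) ^ (k * (n - k)) \<le> exp (- p) ^ (k * (n - k))"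
      using p exp_ge_add_one_self[of "- p"] by (intro power_mono) auto
    also have "\<dots> = exp (real (k * (n - k)) * (- p))" by (simp only: exp_of_nat_mult)
    also have "real (k * (n - k)) * (- p) = - c * K + c * K\<^sup>2 / N"
      using k N by (simp add: p_def K_def N_def of_nat_diff field_simps power2_eq_square)
    finally show ?thesis .
  qed
  have F3: "(1 + (z - 1) * p) ^ (k choose 2) \<le> exp ((z - 1) * p * K\<^sup>2 / 2)"
    using tilt_factor_le[OF p(1), of k] by (simp add: z_def K_def)
  have F4: "(1 - ((1 - p) / (1 + (z - 1) * p)) ^ (k - 1)) ^ (k - 1) \<le>
    (z * p * K) ^ (k - 1) * exp (- (z * p * K\<^sup>2) / 2 + p\<^sup>2 * K ^ 3 / 12 + 11)"
    using conn_factor_le[OF p k(1)] Kp by (simp add: z_def K_def)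
  have F4pos: "0 \<le> (1 - ((1 - p) / (1 + (z - 1) * p)) ^ (k - 1)) ^ (k - 1)"
  proof -
    have "0 \<le> (z - 1) * p" using z p by simp
    then have "(1 - p) / (1 + (z - 1) * p) \<le> 1" "0 \<le> (1 - p) / (1 + (z - 1) * p)" using p by auto
    then show ?thesis by (simp add: power_le_one)
  qed
  have s: "0 \<le> 1 + (z - 1) * p" using z p by simp
  define X1 where "X1 = 1 - (K ^ 2 / (2 * N) + K ^ 3 / (6 * N ^ 2) + K ^ 4 / (12 * N ^ 3))"
  define X2 where "X2 = - c * K + c * K\<^sup>2 / N"
  define X3 where "X3 = (z - 1) * p * K\<^sup>2 / 2"
  define X4 where "X4 = - (z * p * K\<^sup>2) / 2 + p\<^sup>2 * K ^ 3 / 12 + 11"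
  have "component_weight n p k \<le> (N ^ k / fact k * exp X1) * (exp X2 * exp X3 / z ^ k * ((z * p * K) ^ (k - 1) * exp X4))"
    unfolding component_weight_def z_def[symmetric]
    by (intro mult_mono divide_right_mono F1[folded X1_def] F2[folded X2_def] F3[folded X3_def] F4[folded X4_def] F4pos
          divide_nonneg_nonneg mult_nonneg_nonneg zero_le_power)
      (use z p s N K in auto)
  also have "\<dots> = (N * (K ^ (k - 1) / fact k) * (c ^ (k - 1) / z)) * exp (X1 + X2 + X3 + X4)"
  proof -
    obtain j where j: "k = Suc j" using k by (cases k) auto
    have "N ^ k * (z * p * K) ^ (k - 1) / z ^ k = N * K ^ (k - 1) * (c ^ (k - 1) / z)"
      using z N by (simp add: j p_def power_mult_distrib power_divide)
    then have "N ^ k * (z * p * K) ^ (k - 1) / z ^ k / fact k * (exp X1 * exp X2 * exp X3 * exp X4) =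
        N * K ^ (k - 1) * (c ^ (k - 1) / z) / fact k * (exp X1 * exp X2 * exp X3 * exp X4)"
      by (simp only:)
    moreover have "A / f * e1 * (e2 * e3 / Z * (B * e4)) = A * B / Z / f * (e1 * e2 * e3 * e4)"
      for A B f Z e1 e2 e3 e4 :: real by (simp add: mult_ac)
    ultimately show ?thesis by (simp only: exp_add) (simp add: mult_ac)
  qed
  \<comment> \<open>The weak Stirling bound contributes k^(-1/4), and the power k^(k - 1) in place
    of k^k another 1/k; together they give the summable k^(-5/4).\<close>
  also have "\<dots> \<le> (N * (exp (K - 1) * K powr (- 5 / 4)) * c ^ (k - 1)) * exp (X1 + X2 + X3 + X4)"
  proof (intro mult_right_mono mult_mono mult_left_mono)
    have "K ^ (k - 1) = K ^ k / K" using K k by (simp add: power_diff)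
    moreover have "K ^ k * K powr (1 / 4) \<le> fact k * exp (K - 1)"
      using fact_lower_bound[OF k(1)] by (simp add: K_def)
    then have "K ^ k / fact k \<le> exp (K - 1) / K powr (1 / 4)"
      using K by (simp add: field_simps)
    then have "K ^ k / fact k / K \<le> exp (K - 1) / K powr (1 / 4) / K"
      using K by (intro divide_right_mono) auto
    moreover have "exp (K - 1) / K powr (1 / 4) / K = exp (K - 1) * K powr (- 5 / 4)"
    proof -
      have "K powr (- 5 / 4) = K powr (- (1 / 4)) / K"
        using powr_add[of K "- (1 / 4)" "- 1"] K by (simp add: powr_minus_divide)
      then show ?thesis by (simp add: powr_minus_divide)
    qed
    ultimately show "K ^ (k - 1) / fact k \<le> exp (K - 1) * K powr (- 5 / 4)" by (simp add: mult.commute)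
    show "c ^ (k - 1) / z \<le> c ^ (k - 1)" using z c by (simp add: divide_le_eq mult_right_mono mult_le_cancel_left1)
  qed (use N c K z in auto)
  also have "\<dots> = N * K powr (- 5 / 4) * (c ^ (k - 1) * exp (K - 1 + X1 + X2 + X3 + X4))"
    by (simp add: exp_add)
  also have "\<dots> \<le> N * K powr (- 5 / 4) * (exp 13 * exp (N * e ^ 3))"
  proof (rule mult_left_mono)
    define r where "r = - (e\<^sup>2) / 2 + e ^ 3 / 3"
    have k1: "real (k - 1) = K - 1" using k by (simp add: K_def of_nat_diff)
    have "(c * exp (1 - c)) ^ (k - 1) \<le> exp r ^ (k - 1)"
      using times_exp_le[OF c(1)] c unfolding r_def e_def by (intro power_mono) auto
    then have ce: "c ^ (k - 1) * exp ((K - 1) * (1 - c)) \<le> exp ((K - 1) * r)"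
      by (simp add: power_mult_distrib k1[symmetric] flip: exp_of_nat_mult)
    have r: "- r \<le> 1 / 2"
    proof -
      have "e\<^sup>2 \<le> 1" "0 \<le> e ^ 3" using e by (auto simp: power_le_one)
      then show ?thesis unfolding r_def by linarith
    qed
    define Y where "Y = (c - 1) * K\<^sup>2 / (2 * N) - K ^ 3 / (6 * N\<^sup>2) + c\<^sup>2 * K ^ 3 / (12 * N\<^sup>2) - K ^ 4 / (12 * N ^ 3)"
    \<comment> \<open>The terms with z in X3 and X4 cancel and leave -c K^2 / (2 N); the constant is
      12 = 1 + 11.\<close>
    have X: "K - 1 + X1 + X2 + X3 + X4 = (K - 1) * (1 - c) - c + 12 + Y"
    proof -
      define u v w where "u = K\<^sup>2 / N" and "v = K ^ 3 / N\<^sup>2" and "w = K ^ 4 / N ^ 3"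
      have "X1 = 1 - (u / 2 + v / 6 + w / 12)" "X2 = - c * K + c * u" "X3 = (z - 1) * c * u / 2"
        "X4 = - (z * c * u) / 2 + c\<^sup>2 * v / 12 + 11" "Y = (c - 1) * u / 2 - v / 6 + c\<^sup>2 * v / 12 - w / 12"
        unfolding X1_def X2_def X3_def X4_def Y_def p_def u_def v_def w_def by (simp_all add: power_divide)
      then show ?thesis by (simp add: field_simps)
    qed
    have "c ^ (k - 1) * exp (K - 1 + X1 + X2 + X3 + X4) = c ^ (k - 1) * exp ((K - 1) * (1 - c)) * exp (- c + 12 + Y)"
      unfolding X mult.assoc exp_add[symmetric] by (simp add: algebra_simps)
    also have "\<dots> \<le> exp ((K - 1) * r) * exp (- c + 12 + Y)"
      using ce by (intro mult_right_mono) auto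
    also have "\<dots> = exp ((K - 1) * r - c + 12 + Y)" by (simp flip: exp_add)
    \<comment> \<open>With y = k/n the exponent becomes n times the left side of
      \<open>rate_le\<close>. Passing from (K - 1) * r to K * r costs at most 1/2, which the step
      from 12 to 13 absorbs.\<close>
    also have "\<dots> \<le> exp (13 + N * e ^ 3)"
    proof -
      define y where "y = K / N"
      have y: "0 \<le> y" "y \<le> 1" using K N by (auto simp: y_def)
      have NN: "K = N * y" using N by (simp add: y_def)
      have "K\<^sup>2 / N = N * y\<^sup>2" "K ^ 3 / N\<^sup>2 = N * y ^ 3" "K ^ 4 / N ^ 3 = N * y ^ 4"
        unfolding y_def power_divide using N by (simp_all add: eval_nat_numeral)
      moreover have "Y = (c - 1) * (K\<^sup>2 / N) / 2 - (K ^ 3 / N\<^sup>2) / 6 + c\<^sup>2 * (K ^ 3 / N\<^sup>2) / 12 - (K ^ 4 / N ^ 3) / 12"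
        by (simp add: Y_def)
      ultimately have "Y = N * (y\<^sup>2 * (c - 1) / 2 - y ^ 3 / 6 + c\<^sup>2 * y ^ 3 / 12 - y ^ 4 / 12)"
        by (simp only:) (simp add: algebra_simps)
      moreover have "y\<^sup>2 * (c - 1) \<le> y\<^sup>2 * e" "c\<^sup>2 * y ^ 3 \<le> (1 + e)\<^sup>2 * y ^ 3"
        using e c y by (auto intro!: mult_left_mono mult_right_mono power_mono)
      ultimately have "Y \<le> N * (y\<^sup>2 * e / 2 - y ^ 3 / 6 + (1 + e)\<^sup>2 * y ^ 3 / 12 - y ^ 4 / 12)"
        using N by (simp add: mult_left_mono)
      then have "K * r + Y \<le> N * (y * r + y\<^sup>2 * e / 2 - y ^ 3 / 6 + (1 + e)\<^sup>2 * y ^ 3 / 12 - y ^ 4 / 12)"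
        by (simp add: NN algebra_simps)
      also have "\<dots> \<le> N * e ^ 3"
        using rate_le[OF y e(1)] N unfolding r_def by (intro mult_left_mono) auto
      finally show ?thesis using r c by (simp add: algebra_simps)
    qed
    finally show "c ^ (k - 1) * exp (K - 1 + X1 + X2 + X3 + X4) \<le> exp 13 * exp (N * e ^ 3)"
      by (simp add: exp_add)
  qed (use N in auto)
  finally show ?thesis by (simp add: N_def K_def p_def e_def mult_ac)
qed

text \<open>For c \<ge> 2 the target exponent n (c - 1)^3 is so large that only the tilt factor
  needs care, with sqrt 2 - 1 \<le> 21/50; the probabilities are bounded by 1. The last factor is
  kept because it sums to (1 + 1 / sqrt 2)^n.\<close>

lemma component_weight_le_crude:
  fixes c :: real
  assumes n: "1 \<le> n" and c: "2 \<le> c" "c \<le> real n" and k: "k \<le> n"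
  shows "component_weight n (c / real n) k \<le>
    exp (real n * (41 / 100 / 2 * c + 1 / 200 * c)) * (real (n choose k) * (1 / sqrt 2) ^ k)"
proof -
  define p where "p = c / real n"
  define z where "z = sqrt (2::real)"
  have p: "0 \<le> p" "p \<le> 1" using c n by (auto simp: p_def)
  have z: "1 \<le> z" by (simp add: z_def)
  have z2: "z \<le> 71 / 50" unfolding z_def by (rule real_le_lsqrt) (auto simp: power2_eq_square)
  have q: "(1 - p) / (1 + (z - 1) * p) \<le> 1" "0 \<le> (1 - p) / (1 + (z - 1) * p)"
  proof -
    have "0 \<le> (z - 1) * p" using z p by simp
    then show "(1 - p) / (1 + (z - 1) * p) \<le> 1" "0 \<le> (1 - p) / (1 + (z - 1) * p)" using p by auto
  qed
  have "(1 + (z - 1) * p) ^ (k choose 2) \<le> exp ((z - 1) * p * (real k)\<^sup>2 / 2)"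
    using tilt_factor_le[OF p(1), of k] by (simp add: z_def)
  also have "\<dots> \<le> exp ((21 / 50) * p * (real n)\<^sup>2 / 2)"
  proof -
    have "(z - 1) * (p * (real k)\<^sup>2) \<le> (21 / 50) * (p * (real n)\<^sup>2)"
      using p z z2 k by (intro mult_mono mult_left_mono power_mono) auto
    then show ?thesis by (simp add: mult_ac)
  qed
  also have "(21 / 50) * p * (real n)\<^sup>2 / 2 = real n * (41 / 100 / 2 * c + 1 / 200 * c)"
    using n by (simp add: p_def field_simps power2_eq_square)
  finally have A: "(1 + (z - 1) * p) ^ (k choose 2) \<le> exp (real n * (41 / 100 / 2 * c + 1 / 200 * c))" .
  define Q where "Q = (1 - ((1 - p) / (1 + (z - 1) * p)) ^ (k - 1)) ^ (k - 1)"
  have Q: "0 \<le> Q" "Q \<le> 1" using q by (auto simp: Q_def power_le_one)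
  have s: "0 \<le> 1 + (z - 1) * p" using z p by simp
  have "(1 - p) ^ (k * (n - k)) * (1 + (z - 1) * p) ^ (k choose 2) / z ^ k * Q \<le>
    1 * exp (real n * (41 / 100 / 2 * c + 1 / 200 * c)) / z ^ k * 1"
    using A Q z p s by (intro mult_mono divide_right_mono) (auto simp: power_le_one)
  then have "real (n choose k) * ((1 - p) ^ (k * (n - k)) * (1 + (z - 1) * p) ^ (k choose 2) / z ^ k * Q) \<le>
    real (n choose k) * (1 * exp (real n * (41 / 100 / 2 * c + 1 / 200 * c)) / z ^ k * 1)"
    by (rule mult_left_mono) auto
  then show ?thesis unfolding component_weight_def Q_def z_def p_def by (simp add: power_divide mult_ac)
qed

lemma sum_component_weight_le:
  obtains C :: real where "C > 0"
    "\<And>n c. 4 \<le> n \<Longrightarrow> 0 \<le> c \<Longrightarrow> c \<le> real n \<Longrightarrow>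
      (\<Sum>k=1..n. component_weight n (c / real n) k) \<le> C * real n * exp (real n * max 0 (c - 1) ^ 3)"
proof -
  define S where "S = (\<Sum>k. real k powr (- 5 / 4))"
  have sm: "summable (\<lambda>k. real k powr (- 5 / 4))" by (subst summable_real_powr_iff) simp
  have S: "S \<ge> 0" unfolding S_def by (rule suminf_nonneg[OF sm]) simp
  define C where "C = exp 13 * S + 1"
  have C: "C > 0" using S by (simp add: C_def add_nonneg_pos)
  have "(\<Sum>k=1..n. component_weight n (c / real n) k) \<le> C * real n * exp (real n * max 0 (c - 1) ^ 3)"
    if n: "4 \<le> n" and c: "0 \<le> c" "c \<le> real n" for n c
  proof (cases "c \<le> 2")
    case True
    have "(\<Sum>k=1..n. component_weight n (c / real n) k) \<le>
        (\<Sum>k=1..n. exp 13 * real n * real k powr (- 5 / 4) * exp (real n * max 0 (c - 1) ^ 3))"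
      using n c True by (intro sum_mono component_weight_le) auto
    also have "\<dots> = exp 13 * real n * exp (real n * max 0 (c - 1) ^ 3) * (\<Sum>k=1..n. real k powr (- 5 / 4))"
      by (simp add: sum_distrib_left mult_ac)
    also have "\<dots> \<le> exp 13 * real n * exp (real n * max 0 (c - 1) ^ 3) * S"
      unfolding S_def by (intro mult_left_mono sum_le_suminf[OF sm]) auto
    also have "\<dots> = (exp 13 * S) * (real n * exp (real n * max 0 (c - 1) ^ 3))" by simp
    also have "\<dots> \<le> C * (real n * exp (real n * max 0 (c - 1) ^ 3))"
      unfolding C_def by (intro mult_right_mono) auto
    finally show ?thesis by (simp add: mult.assoc)
  next
    case False
    define a where "a = real n * (41 / 100 / 2 * c + 1 / 200 * c)"
    have "(\<Sum>k=1..n. component_weight n (c / real n) k) \<le> (\<Sum>k=1..n. exp a * (real (n choose k) * (1 / sqrt 2) ^ k))"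
      unfolding a_def using n c False by (intro sum_mono component_weight_le_crude) auto
    also have "\<dots> \<le> (\<Sum>k\<le>n. exp a * (real (n choose k) * (1 / sqrt 2) ^ k))"
      by (rule sum_mono2) auto
    also have "\<dots> = exp a * (1 / sqrt 2 + 1) ^ n"
      by (subst binomial_ring) (simp add: sum_distrib_left)
    also have "\<dots> \<le> exp a * exp (14 / 25) ^ n"
    proof (intro mult_left_mono power_mono)
      have "1 / sqrt 2 \<le> (71 :: real) / 100"
        using real_le_rsqrt[of "100/71" 2] by (simp add: field_simps power2_eq_square)
      then have "1 / sqrt 2 + 1 \<le> (71 :: real) / 100 + 1" by (rule add_right_mono)
      also have "(71 :: real) / 100 + 1 \<le> exp (14 / 25)"
        using exp_lower_Taylor_quadratic[of "14 / 25"] by (simp add: power2_eq_square)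
      finally show "1 / sqrt 2 + 1 \<le> exp (14 / 25 :: real)" .
    qed auto
    also have "\<dots> = exp (a + real n * (14 / 25))" by (simp only: exp_add exp_of_nat_mult)
    also have "\<dots> \<le> exp (real n * max 0 (c - 1) ^ 3)"
    proof -
      have c1: "1 \<le> c - 1" using False by simp
      then have "c - 1 \<le> (c - 1) ^ 3" using power_increasing[of 1 3 "c - 1"] by simp
      \<comment> \<open>At c = 2 the left side is 98/100 and the right side 1; the decimal bounds on
        sqrt 2 leave just enough room.\<close>
      then have "21 / 100 * c + 14 / 25 \<le> (c - 1) ^ 3" using c1 by simp
      then have "real n * (21 / 100 * c + 14 / 25) \<le> real n * (c - 1) ^ 3" by (intro mult_left_mono) auto
      then show ?thesis using c1 by (simp add: a_def algebra_simps max_def)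
    qed
    also have "\<dots> \<le> C * real n * exp (real n * max 0 (c - 1) ^ 3)"
    proof -
      have "1 * 1 \<le> C * real n" using S n by (intro mult_mono) (auto simp: C_def)
      then show ?thesis by simp
    qed
    finally show ?thesis .
  qed
  then show ?thesis using C that by blast
qed

section \<open>Straight-line programs and elimination of vertices\<close>

inductive chain :: "'a::{plus,times} set \<Rightarrow> nat \<Rightarrow> 'a set \<Rightarrow> bool" for A where
  chain_refl: "chain A 0 A"
| chain_plus: "chain A t B \<Longrightarrow> x \<in> B \<Longrightarrow> y \<in> B \<Longrightarrow> chain A (Suc t) (insert (x + y) B)"
| chain_times: "chain A t B \<Longrightarrow> x \<in> B \<Longrightarrow> y \<in> B \<Longrightarrow> chain A (Suc t) (insert (x * y) B)"

text \<open>
  \<open>chain A t B\<close>: starting from the values in \<open>A\<close>, exactly \<open>t\<close> additions and multiplications produce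
  the values in \<open>B\<close>, which include \<open>A\<close>.
\<close>

definition cost :: "'a::{plus,times} set \<Rightarrow> nat \<Rightarrow> 'a set \<Rightarrow> bool" where
  "cost A t S \<longleftrightarrow> (\<exists>u B. u \<le> t \<and> chain A u B \<and> S \<subseteq> B)"

lemma chain_subset: "chain A t B \<Longrightarrow> A \<subseteq> B"
  by (induction rule: chain.induct) auto

lemma chain_trans: "chain B u C \<Longrightarrow> chain A t B \<Longrightarrow> chain A (t + u) C"
proof (induction rule: chain.induct)
  case (chain_plus u C x y)
  then show ?case using chain.chain_plus[of A "t + u" C x y] by simp
next
  case (chain_times u C x y)
  then show ?case using chain.chain_times[of A "t + u" C x y] by simp
qed simp

lemma chain_weaken: "chain A t B \<Longrightarrow> A \<subseteq> A' \<Longrightarrow> chain A' t (A' \<union> B)"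
proof (induction rule: chain.induct)
  case chain_refl
  then show ?case using chain.chain_refl[of A'] by (simp add: Un_absorb2)
next
  case (chain_plus t B x y)
  then show ?case using chain.chain_plus[of A' t "A' \<union> B" x y] by simp
next
  case (chain_times t B x y)
  then show ?case using chain.chain_times[of A' t "A' \<union> B" x y] by simp
qed

lemma cost_refl: "S \<subseteq> A \<Longrightarrow> cost A t S"
  unfolding cost_def using chain_refl by blast

lemma cost_mono: "cost A t S \<Longrightarrow> A \<subseteq> A' \<Longrightarrow> t \<le> t' \<Longrightarrow> S' \<subseteq> S \<Longrightarrow> cost A' t' S'"
  unfolding cost_def using chain_weaken by (meson le_supI2 order_trans)

lemma cost_keep: "cost A t S \<Longrightarrow> cost A t (A \<union> S)"
  unfolding cost_def using chain_subset by (meson le_supI)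

lemma cost_trans:
  assumes "cost A t S" "cost S u T"
  shows "cost A (t + u) T"
proof -
  obtain t' B where 1: "t' \<le> t" "chain A t' B" "S \<subseteq> B" using assms(1) by (auto simp: cost_def)
  obtain u' C where 2: "u' \<le> u" "chain S u' C" "T \<subseteq> C" using assms(2) by (auto simp: cost_def)
  have "chain A (t' + u') (B \<union> C)"
    using chain_trans[OF chain_weaken[OF 2(2) 1(3)] 1(2)] .
  then show ?thesis unfolding cost_def using 1 2 by (meson add_mono le_supI2)
qed

lemma cost_Un:
  assumes "cost A t S" "cost A u T"
  shows "cost A (t + u) (S \<union> T)"
proof -
  have "cost (A \<union> S) u (A \<union> S \<union> T)"
    using cost_keep[OF cost_mono[OF assms(2), of "A \<union> S" u T]] by simp
  from cost_trans[OF cost_keep[OF assms(1)] this] show ?thesis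
    by (rule cost_mono) auto
qed

lemma cost_UN:
  assumes "finite I" "\<And>i. i \<in> I \<Longrightarrow> cost A (t i) (S i)"
  shows "cost A (\<Sum>i\<in>I. t i) (\<Union>i\<in>I. S i)"
  using assms
proof (induction I rule: finite_induct)
  case (insert i I)
  then show ?case using cost_Un[of A "t i" "S i" "\<Sum>i\<in>I. t i" "\<Union>i\<in>I. S i"] by simp
qed (simp add: cost_refl)

lemma cost_plus:
  assumes "cost A t {x}" "cost A u {y}" "t + u + 1 \<le> w"
  shows "cost A w {x + y}"
proof -
  obtain s B where "s \<le> t + u" "chain A s B" "{x} \<union> {y} \<subseteq> B"
    using cost_Un[OF assms(1,2)] by (auto simp: cost_def)
  then have "chain A (Suc s) (insert (x + y) B)" by (intro chain_plus) auto
  then show ?thesis unfolding cost_def using assms(3) \<open>s \<le> t + u\<close>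
    by (intro exI[of _ "Suc s"] exI[of _ "insert (x + y) B"]) auto
qed

lemma cost_times:
  assumes "cost A t {x}" "cost A u {y}" "t + u + 1 \<le> w"
  shows "cost A w {x * y}"
proof -
  obtain s B where "s \<le> t + u" "chain A s B" "{x} \<union> {y} \<subseteq> B"
    using cost_Un[OF assms(1,2)] by (auto simp: cost_def)
  then have "chain A (Suc s) (insert (x * y) B)" by (intro chain_times) auto
  then show ?thesis unfolding cost_def using assms(3) \<open>s \<le> t + u\<close>
    by (intro exI[of _ "Suc s"] exI[of _ "insert (x * y) B"]) auto
qed

section \<open>Boolean partition functions and the rules for removing vertices\<close>

definition edge_factor :: "(nat \<Rightarrow> nat \<Rightarrow> nat \<Rightarrow> nat \<Rightarrow> 'a) \<Rightarrow> nat set \<Rightarrow> nat set \<Rightarrow> 'a" where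
  "edge_factor b S e = b (Min e) (Max e) (of_bool (Min e \<in> S)) (of_bool (Max e \<in> S))"

text \<open>An assignment is represented by the set S of the vertices with value 1. The type is only
  a commutative semiring, so that the elimination rules apply to natural numbers.\<close>

definition pf :: "nat set \<Rightarrow> nat set set \<Rightarrow> 'a \<Rightarrow> (nat \<Rightarrow> nat \<Rightarrow> 'a) \<Rightarrow>
    (nat \<Rightarrow> nat \<Rightarrow> nat \<Rightarrow> nat \<Rightarrow> 'a) \<Rightarrow> 'a::comm_semiring_1" where
  "pf V E c u b =
    (\<Sum>S\<in>Pow V. c * (\<Prod>v\<in>V. u v (of_bool (v \<in> S))) * (\<Prod>e\<in>E. edge_factor b S e))"

definition entries :: "nat set \<Rightarrow> nat set set \<Rightarrow> 'a \<Rightarrow> (nat \<Rightarrow> nat \<Rightarrow> 'a) \<Rightarrow>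
    (nat \<Rightarrow> nat \<Rightarrow> nat \<Rightarrow> nat \<Rightarrow> 'a) \<Rightarrow> 'a set" where
  "entries V E c u b = {c} \<union> {u v i | v i. v \<in> V \<and> i < 2} \<union>
    {b x y i j | x y i j. {x, y} \<in> E \<and> i < 2 \<and> j < 2}"

definition edge_sym :: "nat set set \<Rightarrow> (nat \<Rightarrow> nat \<Rightarrow> nat \<Rightarrow> nat \<Rightarrow> 'a) \<Rightarrow> bool" where
  "edge_sym E b \<longleftrightarrow> (\<forall>x y i j. {x, y} \<in> E \<longrightarrow> b x y i j = b y x j i)"

definition nbh :: "'v set set \<Rightarrow> 'v \<Rightarrow> 'v set" where
  "nbh E v = {x. {v, x} \<in> E}"

definition del :: "'v set set \<Rightarrow> 'v \<Rightarrow> 'v set set" where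
  "del E v = {e \<in> E. v \<notin> e}"

lemma edge_factor_eq:
  assumes "edge_sym E b" "{x, y} \<in> E"
  shows "edge_factor b S {x, y} = b x y (of_bool (x \<in> S)) (of_bool (y \<in> S))"
proof (cases "x \<le> y")
  case True
  then show ?thesis by (simp add: edge_factor_def)
next
  case False
  then have "Min {x, y} = y" "Max {x, y} = x" by auto
  moreover have "b x y i j = b y x j i" for i j using assms by (auto simp: edge_sym_def)
  ultimately show ?thesis by (simp add: edge_factor_def)
qed

lemma edge_factor_cong:
  assumes "x \<in> S \<longleftrightarrow> x \<in> T" "y \<in> S \<longleftrightarrow> y \<in> T"
  shows "edge_factor b S {x, y} = edge_factor b T {x, y}"
proof -
  have "Min {x, y} \<in> S \<longleftrightarrow> Min {x, y} \<in> T" "Max {x, y} \<in> S \<longleftrightarrow> Max {x, y} \<in> T"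
    using assms by (simp_all add: min_def max_def)
  then show ?thesis by (simp add: edge_factor_def)
qed

lemma edges_split:
  assumes "E \<subseteq> vertex_pairs V"
  shows "E = del E v \<union> (\<lambda>x. {v, x}) ` nbh E v" "del E v \<inter> (\<lambda>x. {v, x}) ` nbh E v = {}"
    "inj_on (\<lambda>x. {v, x}) (nbh E v)" "nbh E v \<subseteq> V - {v}"
    "del E v \<subseteq> vertex_pairs (V - {v})"
proof -
  show "E = del E v \<union> (\<lambda>x. {v, x}) ` nbh E v"
  proof (rule Set.set_eqI, rule iffI)
    fix e assume e: "e \<in> E"
    then obtain x y where "e = {x, y}" "x \<noteq> y" using assms by (auto simp: vertex_pairs_def)
    then show "e \<in> del E v \<union> (\<lambda>x. {v, x}) ` nbh E v"
      using e by (auto simp: del_def nbh_def insert_commute image_iff)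
  qed (auto simp: del_def nbh_def)
  show "del E v \<inter> (\<lambda>x. {v, x}) ` nbh E v = {}" by (auto simp: del_def)
  show "inj_on (\<lambda>x. {v, x}) (nbh E v)" by (auto simp: inj_on_def doubleton_eq_iff)
  show "nbh E v \<subseteq> V - {v}"
    using assms doubleton_in_vertex_pairs[of v _ V] by (auto simp: nbh_def)
  show "del E v \<subseteq> vertex_pairs (V - {v})"
    using assms unfolding del_def vertex_pairs_def by blast
qed

lemma sum_Pow_insert:
  assumes "finite V" "v \<notin> V"
  shows "sum f (Pow (insert v V)) = (\<Sum>S\<in>Pow V. f S + f (insert v S))"
proof -
  have "inj_on (insert v) (Pow V)" using assms by (auto simp: inj_on_def)
  moreover have "Pow V \<inter> insert v ` Pow V = {}" using assms by auto
  ultimately show ?thesis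
    using assms by (simp add: Pow_insert sum.union_disjoint sum.reindex sum.distrib)
qed

text \<open>The sets S and \<open>insert v S\<close> are paired: their summands differ only in the
  unary factor of v and the factors of the edges at v. The rules for degree 0, 1 and 2 and for
  branching rewrite the last bracket.\<close>

lemma pf_eliminate:
  assumes V: "finite V" "v \<in> V" and E: "E \<subseteq> vertex_pairs V" "edge_sym E b"
  shows "pf V E c u b = (\<Sum>S\<in>Pow (V - {v}).
    c * (\<Prod>w\<in>V - {v}. u w (of_bool (w \<in> S))) * (\<Prod>e\<in>del E v. edge_factor b S e) *
    (u v 0 * (\<Prod>x\<in>nbh E v. b v x 0 (of_bool (x \<in> S))) +
     u v 1 * (\<Prod>x\<in>nbh E v. b v x 1 (of_bool (x \<in> S)))))"
proof -
  define V' where "V' = V - {v}"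
  have V': "V = insert v V'" "v \<notin> V'" "finite V'" using V by (auto simp: V'_def)
  have finE: "finite E" using E V finite_vertex_pairs finite_subset by blast
  have fin: "finite (del E v)" "finite (nbh E v)"
    using finE V edges_split(4)[OF E(1), of v] by (auto simp: del_def intro: finite_subset)
  define f where "f S = c * (\<Prod>v\<in>V. u v (of_bool (v \<in> S))) * (\<Prod>e\<in>E. edge_factor b S e)" for S
  have f: "f T = c * (\<Prod>w\<in>V'. u w (of_bool (w \<in> S))) * (\<Prod>e\<in>del E v. edge_factor b S e) *
      (u v (of_bool (v \<in> T)) * (\<Prod>x\<in>nbh E v. b v x (of_bool (v \<in> T)) (of_bool (x \<in> S))))"
    if "\<And>w. w \<noteq> v \<Longrightarrow> w \<in> T \<longleftrightarrow> w \<in> S" for S T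
  proof -
    have "(\<Prod>w\<in>V. u w (of_bool (w \<in> T))) = u v (of_bool (v \<in> T)) * (\<Prod>w\<in>V'. u w (of_bool (w \<in> T)))"
      using V' by simp
    moreover have "(\<Prod>w\<in>V'. u w (of_bool (w \<in> T))) = (\<Prod>w\<in>V'. u w (of_bool (w \<in> S)))"
    proof (rule prod.cong[OF refl])
      fix w assume "w \<in> V'"
      then have "w \<noteq> v" using V' by auto
      then show "u w (of_bool (w \<in> T)) = u w (of_bool (w \<in> S))" using that by simp
    qed
    moreover have "(\<Prod>e\<in>E. edge_factor b T e) =
        (\<Prod>e\<in>del E v. edge_factor b T e) * (\<Prod>e\<in>(\<lambda>x. {v, x}) ` nbh E v. edge_factor b T e)"
      using edges_split(1,2)[OF E(1), of v] fin by (metis finite_imageI prod.union_disjoint)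
    moreover have "(\<Prod>e\<in>del E v. edge_factor b T e) = (\<Prod>e\<in>del E v. edge_factor b S e)"
    proof (rule prod.cong[OF refl])
      fix e assume e: "e \<in> del E v"
      then have "e \<in> vertex_pairs V" using E by (auto simp: del_def)
      then obtain x y where "e = {x, y}" by (auto simp: vertex_pairs_def)
      moreover have "v \<notin> e" using e by (simp add: del_def)
      ultimately show "edge_factor b T e = edge_factor b S e"
        using that by (auto intro!: edge_factor_cong)
    qed
    moreover have "(\<Prod>e\<in>(\<lambda>x. {v, x}) ` nbh E v. edge_factor b T e) =
        (\<Prod>x\<in>nbh E v. b v x (of_bool (v \<in> T)) (of_bool (x \<in> S)))"
    proof -
      have "edge_factor b T {v, x} = b v x (of_bool (v \<in> T)) (of_bool (x \<in> S))" if x: "x \<in> nbh E v" for x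
      proof -
        have "x \<noteq> v" using x edges_split(4)[OF E(1), of v] by auto
        then have "x \<in> T \<longleftrightarrow> x \<in> S" using \<open>\<And>w. w \<noteq> v \<Longrightarrow> w \<in> T \<longleftrightarrow> w \<in> S\<close> by blast
        then show ?thesis using edge_factor_eq[OF E(2), of v x T] x by (simp add: nbh_def)
      qed
      then show ?thesis using edges_split(3)[OF E(1), of v] by (simp add: prod.reindex)
    qed
    ultimately show ?thesis unfolding f_def by (simp add: mult_ac)
  qed
  have "pf V E c u b = sum f (Pow V)" by (simp add: pf_def f_def)
  also have "\<dots> = (\<Sum>S\<in>Pow V'. f S + f (insert v S))"
    using sum_Pow_insert[OF V'(3,2), of f] V'(1) by simp
  also have "\<dots> = (\<Sum>S\<in>Pow V'. c * (\<Prod>w\<in>V'. u w (of_bool (w \<in> S))) * (\<Prod>e\<in>del E v. edge_factor b S e) *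
    (u v 0 * (\<Prod>x\<in>nbh E v. b v x 0 (of_bool (x \<in> S))) +
     u v 1 * (\<Prod>x\<in>nbh E v. b v x 1 (of_bool (x \<in> S)))))"
  proof (rule sum.cong[OF refl])
    fix S assume "S \<in> Pow V'"
    then have "v \<notin> S" using V' by auto
    then show "f S + f (insert v S) = c * (\<Prod>w\<in>V'. u w (of_bool (w \<in> S))) * (\<Prod>e\<in>del E v. edge_factor b S e) *
      (u v 0 * (\<Prod>x\<in>nbh E v. b v x 0 (of_bool (x \<in> S))) +
       u v 1 * (\<Prod>x\<in>nbh E v. b v x 1 (of_bool (x \<in> S))))"
      using f[of S S] f[of "insert v S" S] by (simp add: distrib_left)
  qed
  finally show ?thesis by (simp add: V'_def)
qed

lemma pf_empty: "pf {} {} c u b = c"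
  by (simp add: pf_def)

lemma pf_isolated_vertex:
  assumes "finite V" "v \<in> V" "E \<subseteq> vertex_pairs V" "edge_sym E b" "nbh E v = {}"
  shows "pf V E c u b = pf (V - {v}) (del E v) (c * (u v 0 + u v 1)) u b"
  by (subst pf_eliminate[OF assms(1-4)]) (simp add: pf_def assms(5) mult_ac)

lemma pf_leaf:
  assumes "finite V" "v \<in> V" "E \<subseteq> vertex_pairs V" "edge_sym E b" "nbh E v = {x}"
  shows "pf V E c u b = pf (V - {v}) (del E v) c
    (u(x := \<lambda>j. u x j * (u v 0 * b v x 0 j + u v 1 * b v x 1 j))) b"
proof -
  have x: "x \<in> V - {v}" using edges_split(4)[OF assms(3), of v] assms(5) by auto
  have eq: "(\<Prod>w\<in>V - {v}. (u(x := g)) w (s w)) = g (s x) * (\<Prod>w\<in>V - {v} - {x}. u w (s w))" for g and s :: "nat \<Rightarrow> nat"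
    using assms(1) x by (subst prod.remove[of _ x]) auto
  have eq': "(\<Prod>w\<in>V - {v}. u w (s w)) = u x (s x) * (\<Prod>w\<in>V - {v} - {x}. u w (s w))" for s :: "nat \<Rightarrow> nat"
    using assms(1) x by (subst prod.remove[of _ x]) auto
  show ?thesis
    by (subst pf_eliminate[OF assms(1-4)]) (simp add: pf_def assms(5) eq eq' mult_ac del: fun_upd_apply)
qed

text \<open>
  If \<open>v\<close> has the two neighbours \<open>x\<close> and \<open>y\<close>, then summing over the value of \<open>v\<close> leaves a factor
  \<open>g i j\<close> that depends on the values of \<open>x\<close> and \<open>y\<close>; it is put on the edge \<open>{x, y}\<close>.
\<close>

definition contract_pairs where
  "contract_pairs E b x y g p q i j =
    (if p = x \<and> q = y then if {x, y} \<in> E then b x y i j * g i j else g i j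
     else if p = y \<and> q = x then if {x, y} \<in> E then b y x i j * g j i else g j i
     else b p q i j)"

lemma contract_pairs_sym:
  assumes "edge_sym E b" "x \<noteq> y"
  shows "edge_sym (insert {x, y} (del E v)) (contract_pairs E b x y g)"
  using assms unfolding edge_sym_def contract_pairs_def del_def
  by (auto simp: doubleton_eq_iff insert_commute)

lemma pf_path_vertex:
  assumes "finite V" "v \<in> V" "E \<subseteq> vertex_pairs V" "edge_sym E b" "nbh E v = {x, y}" "x \<noteq> y"
  shows "pf V E c u b = pf (V - {v}) (insert {x, y} (del E v)) c u
    (contract_pairs E b x y (\<lambda>i j. u v 0 * (b v x 0 i * b v y 0 j) + u v 1 * (b v x 1 i * b v y 1 j)))"
proof -
  define g where "g i j = u v 0 * (b v x 0 i * b v y 0 j) + u v 1 * (b v x 1 i * b v y 1 j)" for i j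
  define b' where "b' = contract_pairs E b x y g"
  have xv: "x \<noteq> v" "y \<noteq> v" using edges_split(4)[OF assms(3), of v] assms(5) by auto
  have finE: "finite (del E v)"
    using assms(1,3) finite_vertex_pairs finite_subset by (fastforce simp: del_def)
  define D where "D = del E v - {{x, y}}"
  have sym': "edge_sym (insert {x, y} (del E v)) b'"
    unfolding b'_def by (rule contract_pairs_sym) fact+
  have rest: "(\<Prod>e\<in>D. edge_factor b' S e) = (\<Prod>e\<in>D. edge_factor b S e)" for S
  proof (rule prod.cong[OF refl])
    fix e assume e: "e \<in> D"
    then have "e \<in> vertex_pairs V" using assms(3) by (auto simp: D_def del_def)
    then obtain p q where pq: "e = {p, q}" "p \<noteq> q" by (auto simp: vertex_pairs_def)
    have "(Min e = x \<and> Max e = y) = False" "(Min e = y \<and> Max e = x) = False"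
    proof -
      have "{p, q} \<noteq> {x, y}" "{p, q} \<noteq> {y, x}" using e pq by (simp_all add: D_def insert_commute)
      then show "(Min e = x \<and> Max e = y) = False" "(Min e = y \<and> Max e = x) = False"
        unfolding pq(1) by (cases "p \<le> q"; auto)+
    qed
    then show "edge_factor b' S e = edge_factor b S e"
      by (simp only: edge_factor_def b'_def contract_pairs_def if_False)
  qed
  have main: "(\<Prod>e\<in>insert {x, y} (del E v). edge_factor b' S e) =
      (\<Prod>e\<in>del E v. edge_factor b S e) * g (of_bool (x \<in> S)) (of_bool (y \<in> S))" for S
  proof -
    have "(\<Prod>e\<in>insert {x, y} (del E v). edge_factor b' S e) = edge_factor b' S {x, y} * (\<Prod>e\<in>D. edge_factor b' S e)"
      using finE by (simp add: D_def prod.insert_remove)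
    also have "edge_factor b' S {x, y} = b' x y (of_bool (x \<in> S)) (of_bool (y \<in> S))"
      by (rule edge_factor_eq[OF sym']) simp
    finally have 1: "(\<Prod>e\<in>insert {x, y} (del E v). edge_factor b' S e) =
      b' x y (of_bool (x \<in> S)) (of_bool (y \<in> S)) * (\<Prod>e\<in>D. edge_factor b S e)" by (simp only: rest)
    show ?thesis
    proof (cases "{x, y} \<in> E")
      case True
      then have "{x, y} \<in> del E v" using xv by (simp add: del_def)
      then have "(\<Prod>e\<in>del E v. edge_factor b S e) = edge_factor b S {x, y} * (\<Prod>e\<in>D. edge_factor b S e)"
        using finE by (simp add: D_def prod.remove)
      then show ?thesis unfolding 1
        using True edge_factor_eq[OF assms(4) True] by (simp add: b'_def contract_pairs_def mult_ac)
    next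
      case False
      then have "D = del E v" by (auto simp: D_def del_def)
      then show ?thesis unfolding 1 using False by (simp add: b'_def contract_pairs_def mult_ac)
    qed
  qed
  show ?thesis unfolding g_def[symmetric] b'_def[symmetric]
    by (subst pf_eliminate[OF assms(1-4)])
      (simp add: pf_def main assms(5,6) g_def mult_ac)
qed

text \<open>Once v has the value i, the factor of an edge at v depends on the other end only and can
  be merged into its unary entry.\<close>

definition absorb where
  "absorb E u b v i w j = (if w \<in> nbh E v then u w j * b v w i j else u w j)"

lemma pf_branch:
  assumes "finite V" "v \<in> V" "E \<subseteq> vertex_pairs V" "edge_sym E b"
  shows "pf V E c u b =
    pf (V - {v}) (del E v) (c * u v 0) (absorb E u b v 0) b +
    pf (V - {v}) (del E v) (c * u v 1) (absorb E u b v 1) b"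
proof -
  have nb: "nbh E v \<subseteq> V - {v}" by (rule edges_split(4)[OF assms(3)])
  have eq: "(\<Prod>w\<in>V - {v}. absorb E u b v i w (s w)) =
      (\<Prod>w\<in>V - {v}. u w (s w)) * (\<Prod>x\<in>nbh E v. b v x i (s x))" for i and s :: "nat \<Rightarrow> nat"
  proof -
    have "(\<Prod>w\<in>V - {v}. absorb E u b v i w (s w)) =
        (\<Prod>w\<in>V - {v}. u w (s w) * (if w \<in> nbh E v then b v w i (s w) else 1))"
      by (rule prod.cong) (auto simp: absorb_def)
    also have "\<dots> = (\<Prod>w\<in>V - {v}. u w (s w)) * (\<Prod>w\<in>V - {v}. if w \<in> nbh E v then b v w i (s w) else 1)"
      by (rule prod.distrib)
    also have "(\<Prod>w\<in>V - {v}. if w \<in> nbh E v then b v w i (s w) else 1) = (\<Prod>x\<in>nbh E v. b v x i (s x))"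
      using assms(1) nb by (simp add: prod.If_cases Int_absorb1)
    finally show ?thesis .
  qed
  show ?thesis
    by (subst pf_eliminate[OF assms]) (simp add: pf_def eq distrib_left sum.distrib mult_ac)
qed

text \<open>
  The value of one part becomes the nullary entry of the other one, so that no multiplication is
  needed to combine them.
\<close>

lemma pf_split:
  assumes V: "finite V" and C: "C \<subseteq> V" "isolated V C E" and E: "E \<subseteq> vertex_pairs V"
  shows "pf V E c u b = pf (V - C) (E \<inter> vertex_pairs (V - C)) (pf C (E \<inter> vertex_pairs C) c u b) u b"
proof -
  define E1 E2 where "E1 = E \<inter> vertex_pairs C" and "E2 = E \<inter> vertex_pairs (V - C)"
  have fin: "finite E1" "finite E2" "finite C" using V C by (auto simp: E1_def E2_def finite_vertex_pairs finite_subset)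
  have EE: "E = E1 \<union> E2"
  proof (rule Set.set_eqI, rule iffI)
    fix e assume e: "e \<in> E"
    then obtain x y where xy: "e = {x, y}" "x \<in> V" "y \<in> V" "x \<noteq> y" using E by (auto simp: vertex_pairs_def)
    then have "x \<in> C \<longleftrightarrow> y \<in> C" using C(2) e insert_commute[of x y "{}"] unfolding isolated_def by (metis DiffI)
    then show "e \<in> E1 \<union> E2" using xy e by (auto simp: E1_def E2_def doubleton_in_vertex_pairs)
  qed (auto simp: E1_def E2_def)
  have dj: "E1 \<inter> E2 = {}" by (auto simp: E1_def E2_def vertex_pairs_def doubleton_eq_iff)
  have VV: "V = C \<union> (V - C)" using C by auto
  have loc: "(\<Prod>e\<in>E1. edge_factor b (F \<union> G) e) = (\<Prod>e\<in>E1. edge_factor b F e)"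
    "(\<Prod>e\<in>E2. edge_factor b (F \<union> G) e) = (\<Prod>e\<in>E2. edge_factor b G e)"
    "(\<Prod>v\<in>C. u v (of_bool (v \<in> F \<union> G))) = (\<Prod>v\<in>C. u v (of_bool (v \<in> F)))"
    "(\<Prod>v\<in>V - C. u v (of_bool (v \<in> F \<union> G))) = (\<Prod>v\<in>V - C. u v (of_bool (v \<in> G)))"
    if "F \<subseteq> C" "G \<subseteq> V - C" for F G
    using that by (auto simp: E1_def E2_def vertex_pairs_def intro!: prod.cong edge_factor_cong)
  have "pf V E c u b = (\<Sum>F\<in>Pow C. \<Sum>G\<in>Pow (V - C). c *
      (\<Prod>v\<in>V. u v (of_bool (v \<in> F \<union> G))) * (\<Prod>e\<in>E. edge_factor b (F \<union> G) e))"
    unfolding pf_def by (subst VV, subst sum_Pow_Un) auto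
  also have "\<dots> = (\<Sum>F\<in>Pow C. \<Sum>G\<in>Pow (V - C).
      (c * (\<Prod>v\<in>C. u v (of_bool (v \<in> F))) * (\<Prod>e\<in>E1. edge_factor b F e)) *
      ((\<Prod>v\<in>V - C. u v (of_bool (v \<in> G))) * (\<Prod>e\<in>E2. edge_factor b G e)))"
  proof (intro sum.cong refl)
    fix F G assume "F \<in> Pow C" "G \<in> Pow (V - C)"
    then have FG: "F \<subseteq> C" "G \<subseteq> V - C" by auto
    have "(\<Prod>v\<in>V. u v (of_bool (v \<in> F \<union> G))) = (\<Prod>v\<in>C. u v (of_bool (v \<in> F))) * (\<Prod>v\<in>V - C. u v (of_bool (v \<in> G)))"
      using V C by (subst prod.subset_diff[OF C(1) V]) (simp only: loc[OF FG] mult.commute)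
    moreover have "(\<Prod>e\<in>E. edge_factor b (F \<union> G) e) = (\<Prod>e\<in>E1. edge_factor b F e) * (\<Prod>e\<in>E2. edge_factor b G e)"
      unfolding EE using fin dj by (simp add: prod.union_disjoint loc[OF FG])
    ultimately show "c * (\<Prod>v\<in>V. u v (of_bool (v \<in> F \<union> G))) * (\<Prod>e\<in>E. edge_factor b (F \<union> G) e) =
      (c * (\<Prod>v\<in>C. u v (of_bool (v \<in> F))) * (\<Prod>e\<in>E1. edge_factor b F e)) *
      ((\<Prod>v\<in>V - C. u v (of_bool (v \<in> G))) * (\<Prod>e\<in>E2. edge_factor b G e))"
      by (simp only: mult_ac)
  qed
  also have "\<dots> = pf (V - C) E2 (pf C E1 c u b) u b"
    unfolding pf_def by (subst sum.swap) (simp add: sum_distrib_right mult.assoc)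
  finally show ?thesis by (simp add: E1_def E2_def)
qed

section \<open>The cost of the partition function\<close>

text \<open>Truncated subtraction is intended: vertices of degree below two count 0 rather than
  negatively, so that removing a vertex or lowering degrees never raises the potential.\<close>

definition phi :: "'v set \<Rightarrow> 'v set set \<Rightarrow> nat" where
  "phi V E = (\<Sum>v\<in>V. card (nbh E v) - 2)"

text \<open>
  Apart from the branch costs of the two subproblems, a branching needs at most \<open>28 * card V - 45\<close>
  operations more than the \<open>24 * card V\<close> that are charged for eliminating all vertices, and \<open>card V \<le> 4 * (d + 1) + 3\<close> if
  \<open>phi V E div 4 = d + 1\<close>; this gives the summand \<open>112 * d + 151\<close>.
\<close>

fun branch_cost :: "nat \<Rightarrow> nat" where
  "branch_cost 0 = 0"
| "branch_cost (Suc d) = 2 * branch_cost d + 112 * d + 151"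

lemma branch_cost_mono: "d \<le> d' \<Longrightarrow> branch_cost d \<le> branch_cost d'"
  by (rule lift_Suc_mono_le[of branch_cost]) auto

text \<open>The recurrence exactly doubles the quantity branch_cost d + 112 * d + 263.\<close>

lemma branch_cost_le: "branch_cost d \<le> 263 * 2 ^ d"
proof -
  have "branch_cost d + 112 * d + 263 = 263 * 2 ^ d" by (induction d) auto
  then show ?thesis by simp
qed

lemma nbh_subset: "E \<subseteq> vertex_pairs V \<Longrightarrow> nbh E v \<subseteq> V - {v}"
  by (rule edges_split(4))

lemma finite_nbh: "finite V \<Longrightarrow> E \<subseteq> vertex_pairs V \<Longrightarrow> finite (nbh E v)"
  by (rule finite_subset[OF nbh_subset]) auto

lemma nbh_sym: "w \<in> nbh E v \<longleftrightarrow> v \<in> nbh E w"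
  by (simp add: nbh_def insert_commute)

lemma nbh_del: "w \<noteq> v \<Longrightarrow> nbh (del E v) w = nbh E w - {v}"
  by (auto simp: nbh_def del_def)

lemma card_nbh_del:
  assumes "finite V" "E \<subseteq> vertex_pairs V" "w \<noteq> v"
  shows "card (nbh E w) = card (nbh (del E v) w) + of_bool (w \<in> nbh E v)"
  using assms finite_nbh[OF assms(1,2), of w] nbh_sym[of w E v]
    card_Suc_Diff1[of "nbh E w" v]
  by (auto simp: nbh_del)

lemma card_edges_del:
  assumes "finite V" "E \<subseteq> vertex_pairs V"
  shows "card E = card (del E v) + card (nbh E v)"
proof -
  have "finite E" using assms finite_vertex_pairs finite_subset by blast
  then have "finite (del E v)" by (simp add: del_def)
  then have "card (del E v \<union> (\<lambda>x. {v, x}) ` nbh E v) = card (del E v) + card (nbh E v)"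
    using edges_split(2,3)[OF assms(2), of v] finite_nbh[OF assms]
    by (simp add: card_Un_disjoint card_image)
  then show ?thesis using edges_split(1)[OF assms(2), of v] by simp
qed

lemma sum_card_nbh_del:
  assumes "finite V" "E \<subseteq> vertex_pairs V" "v \<in> V"
  shows "(\<Sum>w\<in>V - {v}. of_bool (w \<in> nbh E v)) = card (nbh E v)"
  using nbh_subset[OF assms(2), of v] assms by (simp add: of_bool_def sum.If_cases Int_absorb1)

lemma handshake: "finite V \<Longrightarrow> E \<subseteq> vertex_pairs V \<Longrightarrow> (\<Sum>v\<in>V. card (nbh E v)) = 2 * card E"
proof (induction "card V" arbitrary: V E)
  case 0
  then show ?case by (simp add: vertex_pairs_def)
next
  case (Suc n)
  then obtain v where v: "v \<in> V" by fastforce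
  have "(\<Sum>w\<in>V. card (nbh E w)) = card (nbh E v) + (\<Sum>w\<in>V - {v}. card (nbh E w))"
    using Suc.prems v by (simp add: sum.remove)
  also have "(\<Sum>w\<in>V - {v}. card (nbh E w)) =
      (\<Sum>w\<in>V - {v}. card (nbh (del E v) w) + of_bool (w \<in> nbh E v))"
    using Suc.prems by (intro sum.cong refl card_nbh_del) auto
  also have "\<dots> = 2 * card (del E v) + card (nbh E v)"
    using Suc.hyps(1)[of "V - {v}" "del E v"] Suc.hyps(2) Suc.prems v edges_split(5)[OF Suc.prems(2), of v]
    by (simp only: sum.distrib sum_card_nbh_del) simp
  finally show ?case using card_edges_del[OF Suc.prems, of v] by simp
qed

lemma phi_mono:
  assumes "finite V" "V' \<subseteq> V" "\<And>v. v \<in> V' \<Longrightarrow> card (nbh E' v) \<le> card (nbh E v)"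
  shows "phi V' E' \<le> phi V E"
proof -
  have "phi V' E' \<le> phi V' E" unfolding phi_def by (intro sum_mono diff_le_mono assms)
  also have "\<dots> \<le> phi V E" unfolding phi_def by (rule sum_mono2) (use assms in auto)
  finally show ?thesis .
qed

text \<open>Removing v loses deg v - 2 for v itself and 1 for each neighbour, as no truncation
  occurs at degree three or more. The total 2 deg v - 2 is at least 4.\<close>

lemma phi_branch:
  assumes "finite V" "E \<subseteq> vertex_pairs V" "v \<in> V" and deg: "\<And>w. w \<in> V \<Longrightarrow> 3 \<le> card (nbh E w)"
  shows "phi (V - {v}) (del E v) + 4 \<le> phi V E"
proof -
  have "phi V E = (card (nbh E v) - 2) + (\<Sum>w\<in>V - {v}. card (nbh E w) - 2)"
    using assms by (simp add: phi_def sum.remove)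
  also have "(\<Sum>w\<in>V - {v}. card (nbh E w) - 2) =
      (\<Sum>w\<in>V - {v}. (card (nbh (del E v) w) - 2) + of_bool (w \<in> nbh E v))"
  proof (rule sum.cong[OF refl])
    fix w assume "w \<in> V - {v}"
    then show "card (nbh E w) - 2 = (card (nbh (del E v) w) - 2) + of_bool (w \<in> nbh E v)"
      using card_nbh_del[OF assms(1,2), of w v] deg[of w] by (cases "w \<in> nbh E v") auto
  qed
  also have "\<dots> = phi (V - {v}) (del E v) + card (nbh E v)"
    using assms by (simp only: sum.distrib sum_card_nbh_del phi_def)
  finally show ?thesis using deg[OF assms(3)] by simp
qed

text \<open>Each of the two neighbours trades v for the other one, which may have been its neighbour
  already; so contraction raises no degree.\<close>

lemma nbh_contract:
  assumes "finite V" "E \<subseteq> vertex_pairs V" "nbh E v = {x, y}" "w \<noteq> v"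
  shows "card (nbh (insert {x, y} (del E v)) w) \<le> card (nbh E w)"
proof -
  have fin: "finite (nbh E w)" by (rule finite_nbh[OF assms(1,2)])
  have nb: "nbh (insert {x, y} (del E v)) w =
      (nbh E w - {v}) \<union> {z. {w, z} = {x, y}}"
    using assms(4) by (auto simp: nbh_def del_def)
  consider "w \<in> {x, y}" | "w \<notin> {x, y}" by blast
  then show ?thesis
  proof cases
    case 1
    then obtain z where "{z'. {w, z'} = {x, y}} \<subseteq> {z}" by (auto simp: doubleton_eq_iff)
    then have "card (nbh (insert {x, y} (del E v)) w) \<le> card (insert z (nbh E w - {v}))"
      unfolding nb using fin by (intro card_mono) auto
    also have "\<dots> \<le> Suc (card (nbh E w - {v}))" by (rule card_insert_le_m1) auto
    also have "\<dots> = card (nbh E w)"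
    proof -
      have "v \<in> nbh E w" using 1 assms(3) nbh_sym by fastforce
      then show ?thesis using fin by (rule card_Suc_Diff1[rotated])
    qed
    finally show ?thesis .
  next
    case 2
    then have "{z. {w, z} = {x, y}} = {}" by (auto simp: doubleton_eq_iff)
    then show ?thesis unfolding nb using fin by (simp add: card_mono)
  qed
qed

text \<open>If a cut does not separate the neighbours of v, then v can be put on their side, and no
  edge across the cut contains v. A cut that separates two neighbours is left to the edge that
  contraction adds.\<close>

lemma conn_del:
  assumes "conn V E" "v \<in> V" "B \<subset> V - {v}" "B \<noteq> {}" "nbh E v \<subseteq> B \<or> nbh E v \<inter> B = {}"
  shows "\<exists>p\<in>B. \<exists>q\<in>V - {v} - B. {p, q} \<in> del E v"
  using assms(5)
proof
  assume N: "nbh E v \<subseteq> B"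
  have "insert v B \<subset> V" using assms by auto
  then obtain p q where pq: "p \<in> insert v B" "q \<in> V - insert v B" "{p, q} \<in> E"
    using assms(1) unfolding conn_def by (metis insert_not_empty)
  then have "p \<noteq> v" using N by (auto simp: nbh_def)
  then show ?thesis using pq by (intro bexI[of _ p] bexI[of _ q]) (auto simp: del_def)
next
  assume N: "nbh E v \<inter> B = {}"
  have "B \<subset> V" using assms by auto
  then obtain p q where pq: "p \<in> B" "q \<in> V - B" "{p, q} \<in> E"
    using assms(1,4) unfolding conn_def by meson
  moreover have "q \<noteq> v" using N pq by (auto simp: nbh_def insert_commute)
  moreover have "p \<noteq> v" using pq assms(3) by auto
  ultimately show ?thesis by (intro bexI[of _ p] bexI[of _ q]) (auto simp: del_def)
qed

lemma entry_nullary: "entries V E c u b \<subseteq> A \<Longrightarrow> c \<in> A"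
  and entry_unary: "entries V E c u b \<subseteq> A \<Longrightarrow> v \<in> V \<Longrightarrow> i < 2 \<Longrightarrow> u v i \<in> A"
  and entry_binary: "entries V E c u b \<subseteq> A \<Longrightarrow> {x, y} \<in> E \<Longrightarrow> i < 2 \<Longrightarrow> j < 2 \<Longrightarrow> b x y i j \<in> A"
  unfolding entries_def by blast+

lemma entries_subset:
  assumes "entries V E c u b \<subseteq> A" "A \<subseteq> S" "E' \<subseteq> E" "c' \<in> S"
    "\<And>v i. v \<in> V' \<Longrightarrow> i < 2 \<Longrightarrow> u' v i \<in> S"
  shows "entries V' E' c' u' b \<subseteq> S"
proof -
  have "b x y i j \<in> S" if "{x, y} \<in> E'" "i < 2" "j < 2" for x y i j
    using entry_binary[OF assms(1)] assms(2,3) that by blast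
  then show ?thesis using assms(4,5) unfolding entries_def by blast
qed

lemma edge_sym_subset: "edge_sym E b \<Longrightarrow> E' \<subseteq> E \<Longrightarrow> edge_sym E' b"
  unfolding edge_sym_def by blast

lemma del_subset: "del E v \<subseteq> E"
  by (auto simp: del_def)

lemma cost_elem: "x \<in> A \<Longrightarrow> cost A 0 {x}"
  by (rule cost_refl) simp

lemma cost_mult_left: "a \<in> A \<Longrightarrow> cost A t {b} \<Longrightarrow> cost A (Suc t) {a * b}"
  by (rule cost_times[OF cost_elem]) auto

lemma cost_mult_elem: "a \<in> A \<Longrightarrow> b \<in> A \<Longrightarrow> cost A 1 {a * b}"
  using cost_mult_left[OF _ cost_elem] by simp

text \<open>The cost 24 is that of degree two: four pairs of values, five operations for each value
  of g and one more if {x, y} is already an edge. Removing an isolated vertex does not lower the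
  number of edges, hence the proviso in the claim about card E'.\<close>

lemma reduction_step:
  assumes V: "finite V" "v \<in> V" and E: "E \<subseteq> vertex_pairs V" "edge_sym E b"
    and A: "entries V E c u b \<subseteq> A" and deg: "card (nbh E v) \<le> 2"
  obtains E' c' u' b' where "E' \<subseteq> vertex_pairs (V - {v})" "edge_sym E' b'"
    "cost A 24 (entries (V - {v}) E' c' u' b')" "pf V E c u b = pf (V - {v}) E' c' u' b'"
    "\<And>w. w \<in> V - {v} \<Longrightarrow> card (nbh E' w) \<le> card (nbh E w)"
    "nbh E v \<noteq> {} \<Longrightarrow> card E' < card E"
    "nbh E v \<noteq> {} \<Longrightarrow> conn V E \<Longrightarrow> conn (V - {v}) E'"
proof -
  have finN: "finite (nbh E v)" by (rule finite_nbh[OF V(1) E(1)])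
  have delV: "del E v \<subseteq> vertex_pairs (V - {v})" by (rule edges_split(5)[OF E(1)])
  have dsym: "edge_sym (del E v) b" using E(2) by (auto simp: edge_sym_def del_def)
  have ddeg: "card (nbh (del E v) w) \<le> card (nbh E w)" if "w \<in> V - {v}" for w
    using card_nbh_del[OF V(1) E(1), of w v] that by simp
  have nb: "{v, x} \<in> E" if "x \<in> nbh E v" for x using that by (simp add: nbh_def)
  have lt2: "i < 2 \<Longrightarrow> i = 0 \<or> i = 1" for i :: nat by auto
  consider "nbh E v = {}" | x where "nbh E v = {x}" | x y where "nbh E v = {x, y}" "x \<noteq> y"
  proof -
    consider "card (nbh E v) = 0" | "card (nbh E v) = 1" | "card (nbh E v) = 2" using deg by linarith
    then show thesis
      by cases (use that finN in \<open>auto simp: card_1_singleton_iff card_2_iff\<close>)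
  qed
  then show thesis
  proof cases
    case 1
    show thesis
    proof (rule that[OF delV dsym])
      have "cost A 2 {c * (u v 0 + u v 1)}"
        by (rule cost_times[OF cost_elem cost_plus[OF cost_elem cost_elem order_refl]])
          (auto intro: entry_nullary[OF A] entry_unary[OF A V(2)])
      then have "cost A 24 (A \<union> {c * (u v 0 + u v 1)})"
        by (intro cost_keep) (rule cost_mono, auto)
      then show "cost A 24 (entries (V - {v}) (del E v) (c * (u v 0 + u v 1)) u b)"
        by (rule cost_mono[OF _ order_refl order_refl], intro entries_subset[OF A _ del_subset])
          (auto intro: entry_unary[OF A])
      show "pf V E c u b = pf (V - {v}) (del E v) (c * (u v 0 + u v 1)) u b"
        by (rule pf_isolated_vertex) fact+
    qed (use 1 ddeg in auto)
  next
    case (2 x)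
    define n where "n j = u x j * (u v 0 * b v x 0 j + u v 1 * b v x 1 j)" for j
    have x: "x \<in> V - {v}" "{v, x} \<in> E" using nbh_subset[OF E(1), of v] nb 2 by auto
    show thesis
    proof (rule that[OF delV dsym])
      have n: "cost A 4 {n j}" if "j < 2" for j
        unfolding n_def
        by (rule cost_times[OF cost_elem cost_plus[OF cost_mult_elem cost_mult_elem order_refl]])
          (use V x that in \<open>auto intro: entry_unary[OF A] entry_binary[OF A]\<close>)
      have "cost A (4 + 4) ({n 0} \<union> {n 1})" by (rule cost_Un) (auto intro: n)
      then have "cost A 24 (A \<union> ({n 0} \<union> {n 1}))"
        by (intro cost_keep) (rule cost_mono, auto)
      then show "cost A 24 (entries (V - {v}) (del E v) c (u(x := n)) b)"
        by (rule cost_mono[OF _ order_refl order_refl], intro entries_subset[OF A _ del_subset])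
          (auto dest!: lt2 intro: entry_unary[OF A] entry_nullary[OF A])
      show "pf V E c u b = pf (V - {v}) (del E v) c (u(x := n)) b"
        unfolding n_def by (rule pf_leaf) fact+
      show "card (del E v) < card E" using card_edges_del[OF V(1) E(1), of v] 2 by simp
      show "conn (V - {v}) (del E v)" if "conn V E"
        unfolding conn_def using conn_del[OF that V(2)] 2 by auto
    qed (use ddeg in auto)
  next
    case (3 x y)
    define g where "g i j = u v 0 * (b v x 0 i * b v y 0 j) + u v 1 * (b v x 1 i * b v y 1 j)" for i j
    define b' where "b' = contract_pairs E b x y g"
    have xy: "x \<in> V - {v}" "y \<in> V - {v}" "{v, x} \<in> E" "{v, y} \<in> E"
      using nbh_subset[OF E(1), of v] nb 3 by auto
    have xy': "{x, y} \<in> vertex_pairs (V - {v})" using xy 3 by (simp add: doubleton_in_vertex_pairs)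
    have sym': "edge_sym (insert {x, y} (del E v)) b'"
      unfolding b'_def by (rule contract_pairs_sym) fact+
    have finE: "finite (del E v)" using delV V finite_vertex_pairs finite_subset by blast
    show thesis
    proof (rule that[OF _ sym'])
      show "insert {x, y} (del E v) \<subseteq> vertex_pairs (V - {v})" using xy' delV by simp
      have gc: "cost A 5 {g i j}" if "i < 2" "j < 2" for i j
        unfolding g_def
        by (rule cost_plus[OF cost_mult_left[OF _ cost_mult_elem] cost_mult_left[OF _ cost_mult_elem]])
          (use V xy that in \<open>auto intro: entry_unary[OF A] entry_binary[OF A]\<close>)
      have n: "cost A 6 {b' x y i j}" if "i < 2" "j < 2" for i j
      proof (cases "{x, y} \<in> E")
        case True
        have "cost A 6 {b x y i j * g i j}"
          by (rule cost_times[OF cost_elem gc]) (use True that in \<open>auto intro: entry_binary[OF A]\<close>)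
        then show ?thesis using True by (simp add: b'_def contract_pairs_def)
      next
        case False
        then show ?thesis using cost_mono[OF gc[OF that], of A 6] by (simp add: b'_def contract_pairs_def)
      qed
      define M where "M = {0, 1::nat} \<times> {0, 1::nat}"
      have M: "cost A (\<Sum>m\<in>M. 6) (\<Union>m\<in>M. {b' x y (fst m) (snd m)})"
        by (rule cost_UN) (auto simp: M_def intro!: n)
      have "cost A 24 (\<Union>m\<in>M. {b' x y (fst m) (snd m)})" by (rule cost_mono[OF M]) (auto simp: M_def)
      then have "cost A 24 (A \<union> (\<Union>m\<in>M. {b' x y (fst m) (snd m)}))" by (rule cost_keep)
      then show "cost A 24 (entries (V - {v}) (insert {x, y} (del E v)) c u b')"
      proof (rule cost_mono)
        have "b' p q i j \<in> A \<union> (\<Union>m\<in>M. {b' x y (fst m) (snd m)})"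
          if pq: "{p, q} \<in> insert {x, y} (del E v)" and ij: "i < 2" "j < 2" for p q i j
        proof -
          have ijM: "(i, j) \<in> M" "(j, i) \<in> M" using lt2[OF ij(1)] lt2[OF ij(2)] by (auto simp: M_def)
          consider "p = x" "q = y" | "p = y" "q = x" | "{p, q} \<noteq> {x, y}" by (auto simp: doubleton_eq_iff)
          then show ?thesis
          proof cases
            case 1
            then show ?thesis using ijM by force
          next
            case 2
            then have "b' p q i j = b' x y j i" using sym' by (auto simp: edge_sym_def)
            then show ?thesis using ijM by force
          next
            case 3
            then have n: "\<not> (p = x \<and> q = y)" "\<not> (p = y \<and> q = x)"
              using insert_commute[of y x "{}"] by blast+
            have "b' p q i j = b p q i j"
              by (simp only: b'_def contract_pairs_def n if_False)
            moreover have "{p, q} \<in> E" using pq 3 by (auto simp: del_def)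
            ultimately show ?thesis using entry_binary[OF A] ij by simp
          qed
        qed
        then show "entries (V - {v}) (insert {x, y} (del E v)) c u b' \<subseteq> A \<union> (\<Union>m\<in>M. {b' x y (fst m) (snd m)})"
          using entry_nullary[OF A] entry_unary[OF A] unfolding entries_def by blast
      qed auto
      show "pf V E c u b = pf (V - {v}) (insert {x, y} (del E v)) c u b'"
        unfolding b'_def g_def by (rule pf_path_vertex) fact+
      show "card (nbh (insert {x, y} (del E v)) w) \<le> card (nbh E w)" if "w \<in> V - {v}" for w
        using nbh_contract[OF V(1) E(1) 3(1)] that by simp
      show "card (insert {x, y} (del E v)) < card E"
        using card_edges_del[OF V(1) E(1), of v] 3 card_insert_le_m1[of "Suc (card (del E v))" "del E v" "{x, y}"]
        by (simp add: card_insert_if finE split: if_splits)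
      show "conn (V - {v}) (insert {x, y} (del E v))" if "conn V E"
        unfolding conn_def
      proof (intro allI impI)
        fix B assume B: "B \<subset> V - {v}" "B \<noteq> {}"
        consider "x \<in> B" "y \<notin> B" | "y \<in> B" "x \<notin> B" | "nbh E v \<subseteq> B \<or> nbh E v \<inter> B = {}"
          using 3 by auto
        then show "\<exists>p\<in>B. \<exists>q\<in>V - {v} - B. {p, q} \<in> insert {x, y} (del E v)"
        proof cases
          case 1
          then show ?thesis using xy by (intro bexI[of _ x] bexI[of _ y]) auto
        next
          case 2
          then show ?thesis using xy by (intro bexI[of _ y] bexI[of _ x]) (auto simp: insert_commute)
        next
          case 3
          then show ?thesis using conn_del[OF that V(2) B] by blast
        qed
      qed
    qed
  qed
qed

lemma cost_absorb:
  assumes V: "finite V" "v \<in> V" and E: "E \<subseteq> vertex_pairs V"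
    and A: "entries V E c u b \<subseteq> A" and i: "i < 2"
  shows "cost A (1 + 2 * card V) (entries (V - {v}) (del E v) (c * u v i) (absorb E u b v i) b)"
proof -
  define M where "M = nbh E v \<times> {0, 1::nat}"
  have nV: "nbh E v \<subseteq> V" using nbh_subset[OF E] by auto
  have fin: "finite (nbh E v)" using finite_nbh[OF V(1) E] .
  have 1: "cost A 1 {c * u v i}"
    by (rule cost_times[OF cost_elem cost_elem]) (use A V i in \<open>auto intro: entry_nullary entry_unary\<close>)
  have 2: "cost A (\<Sum>m\<in>M. 1) (\<Union>m\<in>M. {absorb E u b v i (fst m) (snd m)})"
  proof (rule cost_UN)
    fix m assume m: "m \<in> M"
    then have "u (fst m) (snd m) \<in> A" "b v (fst m) i (snd m) \<in> A"
      using nV i by (auto simp: M_def nbh_def intro!: entry_unary[OF A] entry_binary[OF A])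
    then have "cost A 1 {u (fst m) (snd m) * b v (fst m) i (snd m)}"
      by (intro cost_times[OF cost_elem cost_elem]) auto
    then show "cost A 1 {absorb E u b v i (fst m) (snd m)}" using m by (simp add: absorb_def M_def mem_Times_iff)
  qed (simp add: M_def fin)
  have "cost A (1 + (\<Sum>m\<in>M. 1)) (A \<union> ({c * u v i} \<union> (\<Union>m\<in>M. {absorb E u b v i (fst m) (snd m)})))"
    by (intro cost_keep cost_Un 1 2)
  then show ?thesis
  proof (rule cost_mono)
    have "card M \<le> 2 * card V"
      using card_mono[OF V(1) nV] by (simp add: M_def card_cartesian_product)
    then show "1 + (\<Sum>m\<in>M. 1) \<le> 1 + 2 * card V" by simp
    have "absorb E u b v i w j \<in> A \<union> (\<Union>m\<in>M. {absorb E u b v i (fst m) (snd m)})"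
      if "w \<in> V" "j < 2" for w j
    proof (cases "w \<in> nbh E v")
      case True
      then have "(w, j) \<in> M" using that by (auto simp: M_def)
      then show ?thesis by force
    next
      case False
      then show ?thesis using that entry_unary[OF A] by (simp add: absorb_def)
    qed
    moreover have "b x y i j \<in> A" if "{x, y} \<in> del E v" "i < 2" "j < 2" for x y i j
      using that by (intro entry_binary[OF A]) (auto simp: del_def)
    ultimately show "entries (V - {v}) (del E v) (c * u v i) (absorb E u b v i) b \<subseteq>
        A \<union> ({c * u v i} \<union> (\<Union>m\<in>M. {absorb E u b v i (fst m) (snd m)}))"
      unfolding entries_def by blast
  qed auto
qed

text \<open>Branching duplicates the linear cost of what remains, which a charge of 24 per vertex
  cannot pay. At minimum degree three each vertex adds at least 1 to the potential, so card V \<le>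
  phi V E, and the linear cost is charged to \<open>branch_cost\<close>.\<close>

lemma cost_pf_phi:
  assumes "finite V" "E \<subseteq> vertex_pairs V" "edge_sym E b" "entries V E c u b \<subseteq> A"
  shows "cost A (24 * card V + branch_cost (phi V E div 4)) {pf V E c u b}"
  using assms
proof (induction "card V" arbitrary: V E c u b A)
  case 0
  then have "V = {}" "E = {}" by (auto simp: vertex_pairs_def)
  then show ?case using 0 by (auto simp: pf_empty entries_def intro: cost_refl)
next
  case (Suc n)
  note fin = Suc.prems(1)
  show ?case
  proof (cases "\<exists>v\<in>V. card (nbh E v) \<le> 2")
    case True
    then obtain v where v: "v \<in> V" "card (nbh E v) \<le> 2" by blast
    obtain E' c' u' b' where R: "E' \<subseteq> vertex_pairs (V - {v})" "edge_sym E' b'"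
      "cost A 24 (entries (V - {v}) E' c' u' b')" "pf V E c u b = pf (V - {v}) E' c' u' b'"
      "\<And>w. w \<in> V - {v} \<Longrightarrow> card (nbh E' w) \<le> card (nbh E w)"
      using reduction_step[OF fin v(1) Suc.prems(2-4) v(2)] by metis
    have n: "card (V - {v}) = n" using Suc.hyps(2) v fin by simp
    have "cost (entries (V - {v}) E' c' u' b') (24 * n + branch_cost (phi (V - {v}) E' div 4)) {pf (V - {v}) E' c' u' b'}"
      using Suc.hyps(1)[of "V - {v}" E' b' c' u'] R fin n by simp
    from cost_trans[OF R(3) this] show ?thesis
    proof (rule cost_mono)
      have "phi (V - {v}) E' \<le> phi V E" by (rule phi_mono) (use fin R in auto)
      then show "24 + (24 * n + branch_cost (phi (V - {v}) E' div 4)) \<le> 24 * card V + branch_cost (phi V E div 4)"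
        using branch_cost_mono[OF div_le_mono] Suc.hyps(2)[symmetric] by simp
    qed (use R in auto)
  next
    case False
    then have deg: "\<And>w. w \<in> V \<Longrightarrow> 3 \<le> card (nbh E w)" by force
    obtain v where v: "v \<in> V" using Suc.hyps(2) by fastforce
    have n: "card (V - {v}) = n" using Suc.hyps(2) v fin by simp
    define d where "d = phi (V - {v}) (del E v) div 4"
    have "phi (V - {v}) (del E v) + 4 \<le> phi V E" by (rule phi_branch) (use fin Suc.prems v deg in auto)
    then have D: "Suc d \<le> phi V E div 4" by (simp add: d_def)
    have "card V \<le> phi V E"
    proof -
      have "(\<Sum>v\<in>V. 1) \<le> phi V E" unfolding phi_def by (rule sum_mono) (use deg in force)
      then show ?thesis by simp
    qed
    then have cV: "card V \<le> 4 * (phi V E div 4) + 3" by linarith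
    have one: "cost A (1 + 2 * card V + (24 * n + branch_cost d)) {pf (V - {v}) (del E v) (c * u v i) (absorb E u b v i) b}"
      if "i < 2" for i
    proof (rule cost_trans[OF cost_absorb[OF fin v Suc.prems(2,4) that]])
      show "cost (entries (V - {v}) (del E v) (c * u v i) (absorb E u b v i) b) (24 * n + branch_cost d)
          {pf (V - {v}) (del E v) (c * u v i) (absorb E u b v i) b}"
        unfolding d_def n[symmetric]
        by (rule Suc.hyps(1)) (use n fin edges_split(5)[OF Suc.prems(2)] edge_sym_subset[OF Suc.prems(3) del_subset] in auto)
    qed
    show ?thesis unfolding pf_branch[OF fin v Suc.prems(2,3)]
    proof (rule cost_plus[OF one one])
      obtain k where k: "phi V E div 4 = Suc k" "d \<le> k" using D by (cases "phi V E div 4") auto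
      then have "branch_cost d \<le> branch_cost k" by (intro branch_cost_mono)
      then show "1 + 2 * card V + (24 * n + branch_cost d) + (1 + 2 * card V + (24 * n + branch_cost d)) + 1
        \<le> 24 * card V + branch_cost (phi V E div 4)"
        using cV k Suc.hyps(2)[symmetric] by simp
    qed auto
  qed
qed

text \<open>Removing a vertex of degree one or two keeps the graph connected and does not raise card
  E - card V. At minimum degree three the handshake lemma gives phi V E = 2 * card E - 2 * card V,
  so a quarter of the potential is half the excess.\<close>

lemma cost_pf_connected:
  assumes "finite V" "E \<subseteq> vertex_pairs V" "edge_sym E b" "entries V E c u b \<subseteq> A" "conn V E" "V \<noteq> {}"
  shows "cost A (24 * card V + branch_cost ((card E - card V) div 2)) {pf V E c u b}"
  using assms
proof (induction "card V" arbitrary: V E c u b A)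
  case 0
  then show ?case by simp
next
  case (Suc n)
  note fin = Suc.prems(1)
  consider v where "v \<in> V" "card (nbh E v) \<le> 2" "nbh E v \<noteq> {}" | v where "v \<in> V" "nbh E v = {}"
    | "\<And>w. w \<in> V \<Longrightarrow> 3 \<le> card (nbh E w)"
    by (metis not_less_eq_eq numeral_2_eq_2 numeral_3_eq_3)
  then show ?case
  proof cases
    case (1 v)
    obtain E' c' u' b' where R: "E' \<subseteq> vertex_pairs (V - {v})" "edge_sym E' b'"
      "cost A 24 (entries (V - {v}) E' c' u' b')" "pf V E c u b = pf (V - {v}) E' c' u' b'"
      "card E' < card E" "conn (V - {v}) E'"
      using reduction_step[OF fin 1(1) Suc.prems(2-4) 1(2)] 1(3) Suc.prems(5) by metis
    have n: "card (V - {v}) = n" using Suc.hyps(2) 1 fin by simp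
    have ne: "V - {v} \<noteq> {}" using nbh_subset[OF Suc.prems(2), of v] 1(3) by blast
    have "cost (entries (V - {v}) E' c' u' b') (24 * n + branch_cost ((card E' - n) div 2)) {pf (V - {v}) E' c' u' b'}"
      using Suc.hyps(1)[of "V - {v}" E' b' c' u'] R fin n ne by simp
    from cost_trans[OF R(3) this] show ?thesis
    proof (rule cost_mono)
      have "(card E' - n) div 2 \<le> (card E - card V) div 2"
        using R(5) Suc.hyps(2)[symmetric] by (intro div_le_mono) auto
      then show "24 + (24 * n + branch_cost ((card E' - n) div 2)) \<le> 24 * card V + branch_cost ((card E - card V) div 2)"
        using branch_cost_mono Suc.hyps(2)[symmetric] by simp
    qed (use R in auto)
  next
    case (2 v)
    have "V = {v}"
    proof (rule ccontr)
      assume "V \<noteq> {v}"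
      then have "{v} \<subset> V" using 2 by auto
      then obtain q where "{v, q} \<in> E" using Suc.prems(5) unfolding conn_def by blast
      then show False using 2 by (auto simp: nbh_def)
    qed
    then have "phi V E = 0" using 2 by (simp add: phi_def)
    then have "cost A (24 * card V) {pf V E c u b}" using cost_pf_phi[OF Suc.prems(1-4)] by simp
    then show ?thesis by (rule cost_mono) auto
  next
    case 3
    have "phi V E = 2 * card E - 2 * card V"
    proof -
      have "phi V E = (\<Sum>v\<in>V. card (nbh E v)) - (\<Sum>v\<in>V. 2)"
        unfolding phi_def by (rule sum_subtractf_nat) (use 3 in force)
      then show ?thesis using handshake[OF Suc.prems(1,2)] by simp
    qed
    then have "phi V E div 4 = (card E - card V) div 2" by linarith
    then show ?thesis using cost_pf_phi[OF Suc.prems(1-4)] by simp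
  qed
qed

lemma conn_mono:
  assumes "conn A F" "F \<subseteq> G"
  shows "conn A G"
  unfolding conn_def
proof (intro allI impI)
  fix B assume "B \<subset> A" "B \<noteq> {}"
  then obtain x y where "x \<in> B" "y \<in> A - B" "{x, y} \<in> F" using assms(1) unfolding conn_def by meson
  then show "\<exists>x\<in>B. \<exists>y\<in>A - B. {x, y} \<in> G" using assms(2) by blast
qed

lemma conn_restrict:
  assumes "conn A F"
  shows "conn A (F \<inter> vertex_pairs A)"
  unfolding conn_def
proof (intro allI impI)
  fix B assume B: "B \<subset> A" "B \<noteq> {}"
  then obtain x y where xy: "x \<in> B" "y \<in> A - B" "{x, y} \<in> F" using assms unfolding conn_def by meson
  have "{x, y} \<in> vertex_pairs A" unfolding doubleton_in_vertex_pairs using xy B by auto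
  then show "\<exists>x\<in>B. \<exists>y\<in>A - B. {x, y} \<in> F \<inter> vertex_pairs A" using xy by blast
qed

text \<open>A minimal nonempty isolated set is connected: a proper part without edges to the rest of
  it would be a smaller isolated set.\<close>

lemma component_exists:
  assumes "finite V" "V \<noteq> {}"
  obtains C where "is_component V E C"
proof -
  have "finite {A. A \<subseteq> V \<and> A \<noteq> {} \<and> isolated V A E}" using assms by auto
  moreover have "V \<in> {A. A \<subseteq> V \<and> A \<noteq> {} \<and> isolated V A E}" using assms by (auto simp: isolated_def)
  ultimately obtain C where C: "C \<in> {A. A \<subseteq> V \<and> A \<noteq> {} \<and> isolated V A E}"
    and min: "\<And>A. A \<in> {A. A \<subseteq> V \<and> A \<noteq> {} \<and> isolated V A E} \<Longrightarrow> A \<le> C \<Longrightarrow> C = A"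
    using finite_has_minimal by (metis (lifting) empty_iff)
  have "conn C E"
    unfolding conn_def
  proof (intro allI impI)
    fix B assume B: "B \<subset> C" "B \<noteq> {}"
    then have "\<not> isolated V B E" using min[of B] C by auto
    then obtain x y where xy: "x \<in> B" "y \<in> V - B" "{x, y} \<in> E" by (auto simp: isolated_def)
    then have "y \<in> C" using C B by (auto simp: isolated_def)
    then show "\<exists>x\<in>B. \<exists>y\<in>C - B. {x, y} \<in> E" using xy by blast
  qed
  then show thesis using C that by (auto simp: is_component_def)
qed

lemma cost_pf_components:
  assumes "finite V" "E \<subseteq> vertex_pairs V" "edge_sym E b" "entries V E c u b \<subseteq> A"
  shows "cost A (24 * card V + (\<Sum>C\<in>{C \<in> Pow V. is_component V E C}.
    branch_cost ((card (E \<inter> vertex_pairs C) - card C) div 2))) {pf V E c u b}"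
  using assms
proof (induction "card V" arbitrary: V E c A rule: less_induct)
  case less
  note fin = less.prems(1)
  define f where "f E C = branch_cost ((card (E \<inter> vertex_pairs C) - card C) div 2)" for E :: "nat set set" and C
  show ?case
  proof (cases "V = {}")
    case True
    then have "E = {}" using less.prems by (auto simp: vertex_pairs_def)
    then show ?thesis using True less.prems by (auto simp: pf_empty entries_def intro: cost_refl)
  next
    case False
    then obtain C where C: "is_component V E C" using component_exists fin by blast
    then have CV: "C \<subseteq> V" "C \<noteq> {}" "isolated V C E" "conn C E" by (auto simp: is_component_def)
    have finC: "finite C" using CV fin finite_subset by blast
    define c' where "c' = pf C (E \<inter> vertex_pairs C) c u b"
    define V' E' where "V' = V - C" and "E' = E \<inter> vertex_pairs (V - C)"
    have cc: "conn C (E \<inter> vertex_pairs C)"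
      by (rule conn_restrict[OF CV(4)])
    have 1: "cost A (24 * card C + f E C) {c'}"
      unfolding c'_def f_def
    proof (rule cost_pf_connected)
      show "entries C (E \<inter> vertex_pairs C) c u b \<subseteq> A"
        by (rule entries_subset[OF less.prems(4) order_refl Int_lower1 entry_nullary[OF less.prems(4)]])
          (use CV entry_unary[OF less.prems(4)] in auto)
      show "edge_sym (E \<inter> vertex_pairs C) b" by (rule edge_sym_subset[OF less.prems(3) Int_lower1])
    qed (use finC CV cc in auto)
    have sub: "entries V' E' c' u b \<subseteq> A \<union> {c'}"
      unfolding V'_def E'_def
      by (rule entries_subset[OF less.prems(4)]) (auto intro: entry_unary[OF less.prems(4)])
    have "cost (A \<union> {c'}) (24 * card V' + (\<Sum>C\<in>{C \<in> Pow V'. is_component V' E' C}. f E' C)) {pf V' E' c' u b}"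
      unfolding f_def
    proof (rule less.hyps)
      show "card V' < card V" using CV fin by (auto simp: V'_def intro: psubset_card_mono)
      show "edge_sym E' b" unfolding E'_def by (rule edge_sym_subset[OF less.prems(3) Int_lower1])
    qed (use sub fin in \<open>auto simp: V'_def E'_def\<close>)
    from cost_trans[OF cost_keep[OF 1] this]
    have "cost A (24 * card C + f E C + (24 * card V' + (\<Sum>C\<in>{C \<in> Pow V'. is_component V' E' C}. f E' C)))
        {pf V E c u b}"
      using pf_split[OF fin CV(1,3) less.prems(2), of c u b] by (simp add: V'_def E'_def c'_def)
    then show ?thesis unfolding f_def[symmetric]
    proof (rule cost_mono)
      \<comment> \<open>Components of the rest are components of the whole graph, with the same
        inner edges and different from C; so the new sum is part of the old one without the term of
        C.\<close>
      have comp: "is_component V E K \<and> f E K = f E' K \<and> K \<noteq> C" if K: "is_component V' E' K" for K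
      proof -
        have KV: "K \<subseteq> V - C" "K \<noteq> {}" "isolated V' K E'" "conn K E'" using K by (auto simp: is_component_def V'_def)
        have "{x, y} \<notin> E" if xy: "x \<in> K" "y \<in> V - K" for x y
        proof (cases "y \<in> C")
          case True
          then have "{y, x} \<notin> E" using CV(3) KV(1) xy by (auto simp: isolated_def)
          then show ?thesis by (simp add: insert_commute)
        next
          case False
          then have "{x, y} \<in> vertex_pairs (V - C)" using xy KV by (auto simp: doubleton_in_vertex_pairs)
          then show ?thesis using KV(3) False xy by (auto simp: isolated_def V'_def E'_def)
        qed
        then have "isolated V K E" by (simp add: isolated_def)
        moreover have "conn K E" using conn_mono[OF KV(4)] by (simp add: E'_def)
        moreover have "E' \<inter> vertex_pairs K = E \<inter> vertex_pairs K"
          using KV(1) unfolding E'_def vertex_pairs_def by blast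
        ultimately show ?thesis using KV by (auto simp: is_component_def f_def)
      qed
      have "card C + card V' = card V"
        unfolding V'_def using CV fin finC by (simp add: card_Diff_subset card_mono)
      moreover have "f E C + (\<Sum>C\<in>{C \<in> Pow V'. is_component V' E' C}. f E' C) \<le>
          (\<Sum>C\<in>{C \<in> Pow V. is_component V E C}. f E C)"
      proof -
        have "(\<Sum>C\<in>{C \<in> Pow V'. is_component V' E' C}. f E' C) = (\<Sum>C\<in>{C \<in> Pow V'. is_component V' E' C}. f E C)"
          by (rule sum.cong) (auto dest: comp)
        then have "f E C + (\<Sum>C\<in>{C \<in> Pow V'. is_component V' E' C}. f E' C) =
            (\<Sum>K\<in>insert C {C \<in> Pow V'. is_component V' E' C}. f E K)"
          using fin comp by (subst sum.insert) (auto simp: V'_def)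
        also have "\<dots> \<le> (\<Sum>C\<in>{C \<in> Pow V. is_component V E C}. f E C)"
          by (rule sum_mono2) (use fin C CV comp in \<open>auto simp: V'_def\<close>)
        finally show ?thesis .
      qed
      ultimately show "24 * card C + f E C + (24 * card V' + (\<Sum>C\<in>{C \<in> Pow V'. is_component V' E' C}. f E' C)) \<le>
          24 * card V + (\<Sum>C\<in>{C \<in> Pow V. is_component V E C}. f E C)" by linarith
    qed auto
  qed
qed

text \<open>Rounding down in the halved excess only helps, and for e < k truncated subtraction leads
  to \<open>branch_cost 0 = 0\<close>.\<close>

lemma branch_cost_excess_le:
  "real (branch_cost ((e - k) div 2)) \<le> 263 * (sqrt 2 ^ e / sqrt 2 ^ k)"
proof (cases "k \<le> e")
  case True
  have "real (branch_cost ((e - k) div 2)) \<le> real (263 * 2 ^ ((e - k) div 2))"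
    by (rule of_nat_mono[OF branch_cost_le])
  also have "\<dots> = 263 * sqrt 2 ^ (2 * ((e - k) div 2))"
    by (simp add: power_mult)
  also have "\<dots> \<le> 263 * sqrt 2 ^ (e - k)"
    by (intro mult_left_mono power_increasing) auto
  also have "sqrt 2 ^ (e - k) = sqrt 2 ^ e / sqrt 2 ^ k" using True by (simp add: power_diff)
  finally show ?thesis .
qed simp

lemma pf_chain:
  assumes V: "finite V" and E: "E \<subseteq> vertex_pairs V" "edge_sym E b" and A: "entries V E c u b \<subseteq> A"
  obtains t B where "chain A t B" "pf V E c u b \<in> B"
    "real t \<le> 24 * real (card V) + 263 * component_sum (sqrt 2) V E"
proof -
  let ?s = "24 * card V + (\<Sum>C\<in>{C \<in> Pow V. is_component V E C}.
    branch_cost ((card (E \<inter> vertex_pairs C) - card C) div 2))"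
  obtain t B where tB: "t \<le> ?s" "chain A t B" "pf V E c u b \<in> B"
    using cost_pf_components[OF assms] by (auto simp: cost_def)
  have "real t \<le> real ?s" using tB(1) by (rule of_nat_mono)
  also have "\<dots> = 24 * real (card V) + (\<Sum>C\<in>{C \<in> Pow V. is_component V E C}.
      real (branch_cost ((card (E \<inter> vertex_pairs C) - card C) div 2)))" by simp
  also have "\<dots> \<le> 24 * real (card V) + (\<Sum>C\<in>{C \<in> Pow V. is_component V E C}.
      263 * (sqrt 2 ^ card (E \<inter> vertex_pairs C) / sqrt 2 ^ card C))"
    by (intro add_left_mono sum_mono branch_cost_excess_le)
  also have "(\<Sum>C\<in>{C \<in> Pow V. is_component V E C}.
      263 * (sqrt 2 ^ card (E \<inter> vertex_pairs C) / sqrt 2 ^ card C)) = 263 * component_sum (sqrt 2) V E"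
    unfolding component_sum_def sum_distrib_left using V
    by (intro sum.mono_neutral_cong_left) auto
  finally show thesis using that tB by blast
qed

section \<open>Formal polynomials and Kronecker substitution\<close>

text \<open>All multiplicities are below B, so the sum is a base B expansion without carries, and
  its digit at position k is the multiplicity of k.\<close>

lemma sum_mset_power_digit:
  fixes M :: "nat multiset"
  assumes "size M < B"
  shows "(\<Sum>m\<in>#M. B ^ m) div B ^ k mod B = count M k"
proof -
  define low where "low = (\<Sum>m\<in>#filter_mset (\<lambda>m. m < k) M. B ^ m)"
  define high where "high = (\<Sum>m\<in>#filter_mset (\<lambda>m. k < m) M. B ^ m)"
  have B: "B > 0" using assms by simp
  have "M = filter_mset (\<lambda>m. m < k) M + replicate_mset (count M k) k + filter_mset (\<lambda>m. k < m) M"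
    by (rule multiset_eqI) auto
  then have "(\<Sum>m\<in>#M. B ^ m) = (\<Sum>m\<in>#filter_mset (\<lambda>m. m < k) M + replicate_mset (count M k) k + filter_mset (\<lambda>m. k < m) M. B ^ m)"
    by (rule arg_cong)
  then have split: "(\<Sum>m\<in>#M. B ^ m) = low + count M k * B ^ k + high"
    by (simp add: low_def high_def)
  have low: "low < B ^ k"
  proof (cases k)
    case (Suc j)
    have "low \<le> (\<Sum>m\<in>#filter_mset (\<lambda>m. m < k) M. B ^ j)"
      unfolding low_def using B Suc by (intro sum_mset_mono) (auto intro: power_increasing)
    also have "\<dots> \<le> size M * B ^ j"
      using size_filter_mset_lesseq[of "\<lambda>m. m < k" M] by simp
    also have "\<dots> < B * B ^ j" using assms B by simp
    finally show ?thesis using Suc by simp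
  qed (simp add: low_def)
  have "B ^ Suc k dvd high"
    unfolding high_def
  proof (induction M)
    case (add x M)
    have "B ^ Suc k dvd B ^ x" if "k < x" using that by (intro le_imp_power_dvd) auto
    then show ?case using add by auto
  qed simp
  then obtain h where h: "high = B ^ Suc k * h" by (auto elim: dvdE)
  have "(\<Sum>m\<in>#M. B ^ m) = low + B ^ k * (count M k + B * h)"
    unfolding split h by (simp add: algebra_simps)
  then have "(\<Sum>m\<in>#M. B ^ m) div B ^ k = count M k + B * h"
    using low B by simp
  moreover have "count M k < B" using count_le_size[of M k] assms by simp
  ultimately show ?thesis by simp
qed

lemma sum_mset_power_inj:
  fixes M N :: "nat multiset"
  assumes "size M < B" "size N < B" "(\<Sum>m\<in>#M. B ^ m) = (\<Sum>m\<in>#N. B ^ m)"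
  shows "M = N"
  by (rule multiset_eqI) (metis assms sum_mset_power_digit)

lemma image_mset_inj_on_eq:
  assumes "image_mset f p = image_mset f q" "inj_on f S" "set_mset p \<subseteq> S" "set_mset q \<subseteq> S"
  shows "p = q"
proof -
  have "image_mset (inv_into S f) (image_mset f r) = r" if "set_mset r \<subseteq> S" for r
    unfolding multiset.map_comp using that assms(2) by (intro multiset.map_ident_strong) auto
  then show ?thesis using assms(1,3,4) by metis
qed

text \<open>A polynomial over nat is a multiset of monomials, and a monomial a multiset of
  variables. Equality of multisets is equality of polynomials, and coefficients need no embedding
  into a ring, being repeated summands.\<close>

type_synonym formal = "nat multiset multiset"

definition fmult :: "formal \<Rightarrow> formal \<Rightarrow> formal" where
  "fmult p q = (\<Sum>a\<in>#p. image_mset ((+) a) q)"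

definition neval :: "(nat \<Rightarrow> nat) \<Rightarrow> formal \<Rightarrow> nat" where
  "neval f p = (\<Sum>m\<in>#p. \<Prod>x\<in>#m. f x)"

lemma neval_plus: "neval f (p + q) = neval f p + neval f q"
  by (simp add: neval_def)

lemma neval_single: "neval f {#{#r#}#} = f r"
  by (simp add: neval_def)

lemma neval_fmult: "neval f (fmult p q) = neval f p * neval f q"
proof (induction p)
  case (add a p)
  have "neval f (image_mset ((+) a) q) = (\<Prod>x\<in>#a. f x) * neval f q"
    by (simp add: neval_def multiset.map_comp o_def sum_mset_distrib_left)
  then show ?case using add by (simp add: fmult_def neval_plus distrib_right) (simp add: neval_def algebra_simps)
qed (simp add: fmult_def neval_def)

lemma size_fmult: "size (fmult p q) = size p * size q"
  unfolding fmult_def by (induction p) auto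

definition degree_le :: "nat \<Rightarrow> formal \<Rightarrow> bool" where
  "degree_le d p \<longleftrightarrow> (\<forall>m\<in>#p. size m \<le> d)"

lemma degree_le_plus: "degree_le d (p + q) \<longleftrightarrow> degree_le d p \<and> degree_le d q"
  by (auto simp: degree_le_def)

lemma degree_le_mono: "degree_le d p \<Longrightarrow> d \<le> d' \<Longrightarrow> degree_le d' p"
  by (auto simp: degree_le_def)

lemma degree_le_fmult: "degree_le d p \<Longrightarrow> degree_le d' q \<Longrightarrow> degree_le (d + d') (fmult p q)"
  by (induction p) (auto simp: fmult_def degree_le_def intro: add_mono)

text \<open>
  The uniqueness of base \<open>B\<close> expansions is used twice: the value of a monomial is a power of \<open>B\<close> whose
  exponent encodes the monomial, and the value of a polynomial encodes the multiset of these exponents.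
\<close>

lemma neval_inj:
  assumes "size p < B" "size q < B" "degree_le d p" "degree_le d q" "d < B"
    "neval (\<lambda>r. B ^ B ^ r) p = neval (\<lambda>r. B ^ B ^ r) q"
  shows "p = q"
proof -
  define code where "code m = (\<Sum>x\<in>#m. B ^ x)" for m :: "nat multiset"
  have mon: "(\<Prod>x\<in>#m. B ^ B ^ x) = B ^ code m" for m
    by (induction m) (auto simp: code_def power_add)
  have ev: "neval (\<lambda>r. B ^ B ^ r) p = (\<Sum>m\<in>#image_mset code p. B ^ m)" for p
    by (simp add: neval_def mon multiset.map_comp o_def)
  have "image_mset code p = image_mset code q"
    by (rule sum_mset_power_inj[of _ B]) (use assms in \<open>auto simp: ev\<close>)
  moreover have "inj_on code {m. size m \<le> d}"
    unfolding inj_on_def code_def using assms(5) by (auto intro: sum_mset_power_inj[of _ B])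
  ultimately show ?thesis
    by (rule image_mset_inj_on_eq) (use assms in \<open>auto simp: degree_le_def\<close>)
qed

section \<open>Evaluation of formal polynomials in a commutative ring\<close>

context cring
begin

text \<open>
  The guards make the folded operations commute on the whole type and not only on the carrier, as
  \<open>fold_mset\<close> requires.
\<close>

definition rmon :: "(nat \<Rightarrow> 'a) \<Rightarrow> nat multiset \<Rightarrow> 'a" where
  "rmon f m = fold_mset (\<lambda>x y. if y \<in> carrier R then f x \<otimes> y else y) \<one> m"

definition reval :: "(nat \<Rightarrow> 'a) \<Rightarrow> formal \<Rightarrow> 'a" where
  "reval f p = fold_mset (\<lambda>m y. if y \<in> carrier R then rmon f m \<oplus> y else y) \<zero> p"

lemma rmon_empty: "rmon f {#} = \<one>"
  by (simp add: rmon_def)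

lemma reval_empty: "reval f {#} = \<zero>"
  by (simp add: reval_def)

context
  fixes f :: "nat \<Rightarrow> 'a"
  assumes f: "\<And>r. f r \<in> carrier R"
begin

lemma rmon_closed_add:
  "rmon f m \<in> carrier R \<and> rmon f (add_mset x m) = f x \<otimes> rmon f m"
proof -
  interpret comp_fun_commute "\<lambda>x y. if y \<in> carrier R then f x \<otimes> y else y"
    by unfold_locales (auto simp: fun_eq_iff m_lcomm f)
  have "rmon f m \<in> carrier R" unfolding rmon_def by (induction m) (auto simp: f)
  then show ?thesis by (simp add: rmon_def)
qed

lemmas rmon_closed = rmon_closed_add[THEN conjunct1]
lemmas rmon_add_mset = rmon_closed_add[THEN conjunct2]

lemma rmon_plus: "rmon f (a + b) = rmon f a \<otimes> rmon f b"
  by (induction a) (auto simp: rmon_empty rmon_add_mset rmon_closed m_assoc f)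

lemma reval_closed_add:
  "reval f p \<in> carrier R \<and> reval f (add_mset m p) = rmon f m \<oplus> reval f p"
proof -
  interpret comp_fun_commute "\<lambda>m y. if y \<in> carrier R then rmon f m \<oplus> y else y"
    by unfold_locales (auto simp: fun_eq_iff a_lcomm rmon_closed)
  have "reval f p \<in> carrier R" unfolding reval_def by (induction p) (auto simp: rmon_closed)
  then show ?thesis by (simp add: reval_def)
qed

lemmas reval_closed = reval_closed_add[THEN conjunct1]
lemmas reval_add_mset = reval_closed_add[THEN conjunct2]

lemma reval_plus: "reval f (p + q) = reval f p \<oplus> reval f q"
  by (induction p) (auto simp: reval_empty reval_add_mset rmon_closed reval_closed a_assoc)

lemma reval_fmult: "reval f (fmult p q) = reval f p \<otimes> reval f q"
proof (induction p)
  case empty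
  show ?case by (simp add: fmult_def reval_empty reval_closed)
next
  case (add a p)
  have "reval f (image_mset ((+) a) q) = rmon f a \<otimes> reval f q"
    by (induction q) (auto simp: reval_empty reval_add_mset rmon_plus rmon_closed reval_closed r_distr)
  then show ?case using add
    by (simp add: fmult_def reval_plus reval_add_mset l_distr rmon_closed reval_closed)
qed

lemma reval_single: "reval f {#{#r#}#} = f r"
  by (simp add: reval_add_mset rmon_add_mset reval_empty rmon_empty f)

lemma rmon_image_mset_set:
  "finite S \<Longrightarrow> rmon f (image_mset g (mset_set S)) = (\<Otimes>x\<in>S. f (g x))"
  by (induction S rule: finite_induct) (auto simp: rmon_empty rmon_add_mset f finprod_insert)

lemma reval_image_mset_set:
  "finite S \<Longrightarrow> reval f (image_mset g (mset_set S)) = (\<Oplus>x\<in>S. rmon f (g x))"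
  by (induction S rule: finite_induct) (auto simp: reval_empty reval_add_mset rmon_closed finsum_insert)

end

end

section \<open>Straight-line programs and their codes\<close>

text \<open>
  Register \<open>N + s\<close> receives the result of step \<open>s\<close>.  The step is encoded by a number below
  \<open>2 * L * L\<close>, where \<open>L\<close> is an upper bound on the number of registers; operands are taken modulo
  \<open>N + s\<close>, so that every number is a valid code.
\<close>

fun slp :: "('x \<Rightarrow> 'x \<Rightarrow> 'x) \<Rightarrow> ('x \<Rightarrow> 'x \<Rightarrow> 'x) \<Rightarrow> nat \<Rightarrow> nat \<Rightarrow> (nat \<Rightarrow> nat) \<Rightarrow>
    nat \<Rightarrow> (nat \<Rightarrow> 'x) \<Rightarrow> nat \<Rightarrow> 'x" where
  "slp pl tm N L ds 0 r = r"
| "slp pl tm N L ds (Suc s) r =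
    (let r' = slp pl tm N L ds s r;
         i = ds s div 2 mod L mod (N + s);
         j = ds s div 2 div L mod (N + s)
     in r'(N + s := (if ds s mod 2 = 0 then pl (r' i) (r' j) else tm (r' i) (r' j))))"

lemma slp_cong: "(\<And>k. k < s \<Longrightarrow> ds k = ds' k) \<Longrightarrow> slp pl tm N L ds s r = slp pl tm N L ds' s r"
  by (induction s) (simp_all add: Let_def)

text \<open>Operands are reduced modulo N + s, so a step reads only registers on which the two runs
  already correspond. One run on formal polynomials thus governs the runs on numbers and on ring
  elements.\<close>

lemma slp_hom:
  assumes "\<And>a b. h (pl a b) = pl' (h a) (h b)" "\<And>a b. h (tm a b) = tm' (h a) (h b)"
    "\<And>i. i < N \<Longrightarrow> h (r i) = r' i" "0 < N"
  shows "i < N + s \<Longrightarrow> h (slp pl tm N L ds s r i) = slp pl' tm' N L ds s r' i"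
  using assms(4) by (induction s arbitrary: i) (simp_all add: assms(1-3) Let_def)

text \<open>A multiplication at most squares the size and doubles the degree. The size bound starts
  at 2 instead of 1, so that squaring also covers the doubling by an addition.\<close>

lemma slp_formal_bounds:
  assumes "0 < N"
  shows "i < N + s \<Longrightarrow> size (slp (+) fmult N L ds s (\<lambda>r. {#{#r#}#}) i) \<le> 2 ^ 2 ^ s \<and>
    degree_le (2 ^ s) (slp (+) fmult N L ds s (\<lambda>r. {#{#r#}#}) i)"
proof (induction s arbitrary: i)
  case 0
  then show ?case by (simp add: degree_le_def)
next
  case (Suc s)
  define r where "r = slp (+) fmult N L ds s (\<lambda>r. {#{#r#}#})"
  have IH: "size (r i) \<le> 2 ^ 2 ^ s" "degree_le (2 ^ s) (r i)" if "i < N + s" for i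
    using Suc.IH[OF that] by (auto simp: r_def)
  have two: "(2::nat) ^ 2 ^ Suc s = 2 ^ 2 ^ s * 2 ^ 2 ^ s" "(2::nat) ^ Suc s = 2 ^ s + 2 ^ s"
    by (simp_all add: power_add[symmetric] mult_2)
  have ge: "(2::nat) \<le> 2 ^ 2 ^ s" using power_increasing[of 1 "2 ^ s" "2::nat"] by simp
  have old: "size (r i) \<le> 2 ^ 2 ^ Suc s \<and> degree_le (2 ^ Suc s) (r i)" if "i < N + s" for i
  proof -
    have "(1::nat) * 2 ^ 2 ^ s \<le> 2 ^ 2 ^ s * 2 ^ 2 ^ s" using ge by (intro mult_le_mono1) linarith
    then have "size (r i) \<le> 2 ^ 2 ^ s * 2 ^ 2 ^ s" using IH(1)[OF that] by linarith
    moreover have "degree_le (2 ^ s + 2 ^ s) (r i)" using IH(2)[OF that] by (rule degree_le_mono) simp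
    ultimately show ?thesis unfolding two(1) unfolding two(2) ..
  qed
  have new: "size (r a + r b) \<le> 2 ^ 2 ^ Suc s \<and> degree_le (2 ^ Suc s) (r a + r b)"
    "size (fmult (r a) (r b)) \<le> 2 ^ 2 ^ Suc s \<and> degree_le (2 ^ Suc s) (fmult (r a) (r b))"
    if "a < N + s" "b < N + s" for a b
  proof -
    have "size (r a + r b) \<le> 2 * 2 ^ 2 ^ s" using IH(1)[OF that(1)] IH(1)[OF that(2)] by simp
    also have "\<dots> \<le> 2 ^ 2 ^ s * 2 ^ 2 ^ s" using ge by (rule mult_le_mono1)
    finally show "size (r a + r b) \<le> 2 ^ 2 ^ Suc s \<and> degree_le (2 ^ Suc s) (r a + r b)"
      using old[OF that(1)] old[OF that(2)] unfolding two(1) by (simp only: degree_le_plus)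
    show "size (fmult (r a) (r b)) \<le> 2 ^ 2 ^ Suc s \<and> degree_le (2 ^ Suc s) (fmult (r a) (r b))"
      unfolding two(1) size_fmult unfolding two(2)
      using IH[OF that(1)] IH[OF that(2)] by (intro conjI mult_le_mono degree_le_fmult)
  qed
  show ?case
    using new old Suc.prems assms by (simp add: Let_def r_def[symmetric])
qed

lemma slp_exists:
  fixes r :: "nat \<Rightarrow> 'a::{plus,times}"
  assumes "chain (r ` {..<N}) t B" "N + t \<le> L" "0 < N"
  shows "\<exists>ds. (\<forall>s<t. ds s < 2 * L * L) \<and> B \<subseteq> slp (+) (*) N L ds t r ` {..<N + t}"
proof -
  have step: "\<exists>ds. (\<forall>s<Suc t. ds s < 2 * L * L) \<and> insert z B \<subseteq> slp (+) (*) N L ds (Suc t) r ` {..<N + Suc t}"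
    if IH: "N + t \<le> L \<Longrightarrow> \<exists>ds. (\<forall>s<t. ds s < 2 * L * L) \<and> B \<subseteq> slp (+) (*) N L ds t r ` {..<N + t}"
      and xy: "x \<in> B" "y \<in> B" and z: "z = (if p = 0 then x + y else x * y)" "p < 2" and L: "N + Suc t \<le> L"
    for t B x y z and p :: nat
  proof -
    obtain ds where ds: "\<forall>s<t. ds s < 2 * L * L" "B \<subseteq> slp (+) (*) N L ds t r ` {..<N + t}"
      using IH L by auto
    obtain i j where ij: "i < N + t" "slp (+) (*) N L ds t r i = x" "j < N + t" "slp (+) (*) N L ds t r j = y"
      using ds(2) xy by blast
    \<comment> \<open>The parity selects the operation; the quotient by 2 holds the operands i and j
      as digits in base L.\<close>
    define d where "d = p + 2 * (i + L * j)"
    define ds' where "ds' = ds(t := d)"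
    have iL: "i < L" "j < L" "L > 0" using ij L by auto
    have "L * j + L \<le> L * L" using iL by (metis Suc_leI add.commute mult_Suc_right mult_le_mono2)
    then have "d < 2 * L * L" using iL z by (simp add: d_def)
    moreover have dec: "d div 2 = i + L * j" "d mod 2 = p"
      unfolding d_def mod_mult_self2 using z(2) by simp_all
    then have dij: "d div 2 mod L = i" "d div 2 div L = j" using iL by auto
    have old: "slp (+) (*) N L ds' t r = slp (+) (*) N L ds t r"
      by (rule slp_cong) (simp add: ds'_def)
    have new: "slp (+) (*) N L ds' (Suc t) r = (slp (+) (*) N L ds t r)(N + t := z)"
      using dec dij ij z by (simp add: Let_def old) (simp add: ds'_def)
    have "insert z B \<subseteq> slp (+) (*) N L ds' (Suc t) r ` {..<N + Suc t}"
    proof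
      fix w assume "w \<in> insert z B"
      then consider "w = z" | k where "k < N + t" "w = slp (+) (*) N L ds t r k" using ds(2) by blast
      then show "w \<in> slp (+) (*) N L ds' (Suc t) r ` {..<N + Suc t}"
        unfolding new
      proof cases
        case 1
        then show "w \<in> ((slp (+) (*) N L ds t r)(N + t := z)) ` {..<N + Suc t}"
          by (intro image_eqI[of _ _ "N + t"]) auto
      next
        case 2
        then show "w \<in> ((slp (+) (*) N L ds t r)(N + t := z)) ` {..<N + Suc t}"
          by (intro image_eqI[of _ _ k]) auto
      qed
    qed
    moreover have "\<forall>s<Suc t. ds' s < 2 * L * L"
      using ds(1) \<open>d < 2 * L * L\<close> by (simp add: ds'_def less_Suc_eq)
    ultimately show ?thesis by blast
  qed
  show ?thesis using assms(1,2)
  proof (induction rule: chain.induct)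
    case chain_refl
    then show ?case by auto
  next
    case (chain_plus t B x y)
    show ?case by (rule step[where p = 0, OF chain_plus.IH chain_plus.hyps(2,3)]) (use chain_plus.prems in auto)
  next
    case (chain_times t B x y)
    show ?case by (rule step[where p = 1, OF chain_times.IH chain_times.hyps(2,3)]) (use chain_times.prems in auto)
  qed
qed

lemma digits_exist:
  assumes "\<forall>s<t. ds s < b"
  shows "\<exists>u<b ^ t. \<forall>s<t. u div b ^ s mod b = (ds s :: nat)"
  using assms
proof (induction t)
  case (Suc t)
  then obtain u where u: "u < b ^ t" "\<forall>s<t. u div b ^ s mod b = ds s" by auto
  define u' where "u' = u + b ^ t * ds t"
  have b: "ds t < b" using Suc.prems by simp
  have "u' < b ^ t + b ^ t * ds t" using u by (simp add: u'_def)
  also have "\<dots> = b ^ t * Suc (ds t)" by simp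
  also have "\<dots> \<le> b ^ t * b" using b by (intro mult_le_mono2) simp
  finally have "u' < b ^ Suc t" by (simp add: mult.commute)
  moreover have "u' div b ^ s mod b = ds s" if s: "s < Suc t" for s
  proof (cases "s = t")
    case True
    then show ?thesis using u b by (simp add: u'_def)
  next
    case False
    then have "s < t" using s by simp
    from less_imp_Suc_add[OF this] obtain k where k: "t = s + Suc k" by auto
    have "u' = u + b ^ s * (b * (b ^ k * ds t))" by (simp add: u'_def k power_add mult_ac)
    then have "u' div b ^ s = u div b ^ s + b * (b ^ k * ds t)" using b by simp
    then show ?thesis using u k by simp
  qed
  ultimately show ?case by blast
qed simp

text \<open>
  The digits of \<open>u\<close> encode the steps, and the leading part encodes the output register.
\<close>

definition slp_out where
  "slp_out pl tm N t u r =
    slp pl tm N (N + t) (\<lambda>s. u div (2 * (N + t) * (N + t)) ^ s mod (2 * (N + t) * (N + t))) t r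
      (u div (2 * (N + t) * (N + t)) ^ t mod (N + t))"

lemma slp_out_exists:
  fixes r :: "nat \<Rightarrow> 'a::{plus,times}"
  assumes "chain (r ` {..<N}) t B" "0 < N" "z \<in> B"
  shows "\<exists>u<(2 * (N + t) * (N + t)) ^ t * (N + t). slp_out (+) (*) N t u r = z"
proof -
  define L where "L = N + t"
  define b where "b = 2 * L * L"
  have b: "b > 0" using assms(2) by (simp add: b_def L_def)
  obtain ds where ds: "\<forall>s<t. ds s < b" "B \<subseteq> slp (+) (*) N L ds t r ` {..<N + t}"
    using slp_exists[OF assms(1) _ assms(2), of L] by (auto simp: L_def b_def)
  obtain i where i: "i < L" "slp (+) (*) N L ds t r i = z" using ds(2) assms(3) by (auto simp: L_def)
  obtain v where v: "v < b ^ t" "\<forall>s<t. v div b ^ s mod b = ds s" using digits_exist[OF ds(1)] by blast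
  define u where "u = v + b ^ t * i"
  have dig: "u div b ^ s mod b = ds s" if "s < t" for s
  proof -
    from less_imp_Suc_add[OF that] obtain k where k: "t = s + Suc k" by auto
    have "u = v + b ^ s * (b * (b ^ k * i))" by (simp add: u_def k power_add mult_ac)
    then have "u div b ^ s = v div b ^ s + b * (b ^ k * i)" using b by simp
    then show ?thesis using v that by simp
  qed
  have top: "u div b ^ t = i" using v b by (simp add: u_def)
  have "u < b ^ t + b ^ t * i" using v by (simp add: u_def)
  also have "\<dots> = b ^ t * Suc i" by simp
  also have "\<dots> \<le> b ^ t * L" using i by (intro mult_le_mono2) simp
  finally have "u < b ^ t * L" .
  moreover have e: "slp (+) (*) N L (\<lambda>s. u div b ^ s mod b) t r = slp (+) (*) N L ds t r"
    by (rule slp_cong) (rule dig)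
  then have "slp_out (+) (*) N t u r = z"
    unfolding slp_out_def L_def[symmetric] b_def[symmetric] top e using i by simp
  ultimately show ?thesis unfolding L_def b_def by blast
qed

section \<open>Input cells as registers, and the formal partition function\<close>

definition cell_count :: "nat \<Rightarrow> nat" where
  "cell_count n = 1 + 2 * n + 4 * (n * n)"

definition unary_cell :: "nat \<Rightarrow> nat \<Rightarrow> nat" where
  "unary_cell v i = 1 + 2 * v + i"

text \<open>Every ordered pair has four registers, whether or not it is an edge, so that the
  numbering depends on n only and is inverted by division.\<close>

definition binary_cell :: "nat \<Rightarrow> nat \<Rightarrow> nat \<Rightarrow> nat \<Rightarrow> nat \<Rightarrow> nat" where
  "binary_cell n x y i j = 1 + 2 * n + 4 * (x * n + y) + 2 * i + j"

definition score_monomial :: "nat \<Rightarrow> nat set set \<Rightarrow> nat set \<Rightarrow> nat multiset" where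
  "score_monomial n E S = {#0#} + image_mset (\<lambda>v. unary_cell v (of_bool (v \<in> S))) (mset_set {..<n}) +
    image_mset (\<lambda>e. binary_cell n (Min e) (Max e) (of_bool (Min e \<in> S)) (of_bool (Max e \<in> S))) (mset_set E)"

definition formal_pf :: "nat \<Rightarrow> nat set set \<Rightarrow> formal" where
  "formal_pf n E = image_mset (score_monomial n E) (mset_set (Pow {..<n}))"

lemma binary_cell_less:
  assumes "x < n" "y < n" "i < 2" "j < 2"
  shows "binary_cell n x y i j < cell_count n"
proof -
  have "x * n + n \<le> n * n" using assms(1) by (metis Suc_leI add.commute mult_Suc mult_le_mono1)
  then show ?thesis using assms by (simp add: binary_cell_def cell_count_def)
qed

lemma finite_edges: "E \<subseteq> vertex_pairs {..<n::nat} \<Longrightarrow> finite E"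
  by (rule finite_subset[OF _ finite_vertex_pairs]) auto

lemma edge_MinMax:
  fixes E :: "nat set set"
  assumes "E \<subseteq> vertex_pairs {..<n}" "e \<in> E"
  shows "Min e < Max e" "Max e < n" "e = {Min e, Max e}"
proof -
  obtain x y where xy: "e = {x, y}" "x < n" "y < n" "x \<noteq> y" using assms by (auto simp: vertex_pairs_def)
  show "Min e < Max e" "Max e < n" "e = {Min e, Max e}"
    using xy unfolding xy(1) by (cases "x \<le> y"; auto)+
qed

lemma formal_pf_bounds:
  assumes "E \<subseteq> vertex_pairs {..<n}"
  shows "size (formal_pf n E) = 2 ^ n" "degree_le (1 + n + n * n) (formal_pf n E)"
proof -
  show "size (formal_pf n E) = 2 ^ n" by (simp add: formal_pf_def card_Pow)
  have "card E \<le> card (vertex_pairs {..<n})" by (intro card_mono finite_vertex_pairs assms) auto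
  also have "\<dots> \<le> n * n" by (simp add: card_vertex_pairs choose_two) (metis diff_le_self div_le_dividend le_trans mult_le_mono2)
  finally show "degree_le (1 + n + n * n) (formal_pf n E)"
    by (auto simp: degree_le_def formal_pf_def score_monomial_def)
qed

text \<open>A number of this shape arises from 2 by t + n + 3 squarings. It exceeds the bounds on
  size and degree for programs of length t, 2^2^t and 2^t, and for the partition function, 2^n and 1
  + n + n^2.\<close>

definition kron_base :: "nat \<Rightarrow> nat \<Rightarrow> nat" where
  "kron_base n t = 2 ^ 2 ^ (t + n + 3)"

definition kron :: "nat \<Rightarrow> nat \<Rightarrow> nat \<Rightarrow> nat" where
  "kron n t r = kron_base n t ^ kron_base n t ^ r"

lemma kron_base_bounds:
  "2 ^ 2 ^ t < kron_base n t" "2 ^ n < kron_base n t" "2 ^ t < kron_base n t" "1 + n + n * n < kron_base n t"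
proof -
  have n: "n < 2 ^ n" "t < 2 ^ t" by auto
  show 1: "2 ^ 2 ^ t < kron_base n t" unfolding kron_base_def
    by (intro power_strict_increasing) auto
  have "t < 2 ^ t" by simp
  then have "(2::nat) ^ t < 2 ^ 2 ^ t" by (intro power_strict_increasing) auto
  then show "2 ^ t < kron_base n t" using 1 by (rule less_trans)
  have "2 ^ n * 2 ^ 3 \<le> (2::nat) ^ (t + n + 3)" by (simp add: power_add)
  then have le: "8 * 2 ^ n \<le> (2::nat) ^ (t + n + 3)" by simp
  then have "n < (2::nat) ^ (t + n + 3)" using n by linarith
  then show "2 ^ n < kron_base n t" unfolding kron_base_def by (intro power_strict_increasing) auto
  have "1 + n + n * n \<le> (1 + n) * (1 + n)" by simp
  also have "\<dots> \<le> 2 ^ n * 2 ^ n" by (intro mult_le_mono) (simp_all add: Suc_le_eq)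
  also have "\<dots> = 2 ^ (2 * n)" by (simp add: power_add mult_2)
  also have "\<dots> < kron_base n t"
    unfolding kron_base_def
  proof (rule power_strict_increasing)
    show "2 * n < 2 ^ (t + n + 3)" using le n by linarith
  qed simp
  finally show "1 + n + n * n < kron_base n t" .
qed

definition accepts :: "nat \<Rightarrow> nat set set \<Rightarrow> nat \<Rightarrow> nat \<Rightarrow> bool" where
  "accepts n E t u \<longleftrightarrow>
    slp_out (+) (*) (cell_count n) t u (kron n t) = neval (kron n t) (formal_pf n E)"

lemma cell_count_pos: "0 < cell_count n"
  by (simp add: cell_count_def)

lemma neval_slp_out:
  "neval f (slp_out (+) fmult (cell_count n) t u (\<lambda>r. {#{#r#}#})) = slp_out (+) (*) (cell_count n) t u f"
  unfolding slp_out_def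
  by (rule slp_hom) (auto simp: neval_plus neval_fmult neval_single cell_count_pos)

text \<open>
  The base may belong to a larger length \<open>k\<close>: a program is obtained below from the values at the base
  for a bound \<open>k\<close> on its length, which is not known in advance.
\<close>

lemma slp_out_formal:
  assumes "E \<subseteq> vertex_pairs {..<n}" "t \<le> k"
    and eq: "slp_out (+) (*) (cell_count n) t u (kron n k) = neval (kron n k) (formal_pf n E)"
  shows "slp_out (+) fmult (cell_count n) t u (\<lambda>r. {#{#r#}#}) = formal_pf n E"
proof (rule neval_inj)
  let ?B = "kron_base n k" and ?p = "slp_out (+) fmult (cell_count n) t u (\<lambda>r. {#{#r#}#})"
  have "size ?p \<le> 2 ^ 2 ^ t" "degree_le (2 ^ t) ?p"
    unfolding slp_out_def using slp_formal_bounds[OF cell_count_pos] cell_count_pos[of n] by simp_all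
  moreover have "(2::nat) ^ 2 ^ t \<le> 2 ^ 2 ^ k" "(2::nat) ^ t \<le> 2 ^ k"
    using assms(2) by (auto intro!: power_increasing)
  ultimately show "size ?p < ?B" "degree_le (max (2 ^ k) (1 + n + n * n)) ?p"
    using kron_base_bounds(1)[of k n] by (meson le_less_trans order_trans, meson degree_le_mono max.coboundedI1)
  show "size (formal_pf n E) < ?B" using formal_pf_bounds[OF assms(1)] kron_base_bounds by simp
  show "degree_le (max (2 ^ k) (1 + n + n * n)) (formal_pf n E)"
    using formal_pf_bounds(2)[OF assms(1)] by (rule degree_le_mono) simp
  show "max (2 ^ k) (1 + n + n * n) < ?B" using kron_base_bounds(3)[of k n] kron_base_bounds(4)[of n k] by simp
  show "neval (\<lambda>r. ?B ^ ?B ^ r) ?p = neval (\<lambda>r. ?B ^ ?B ^ r) (formal_pf n E)"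
    using eq neval_slp_out[of "kron n k" n t u] unfolding kron_def[abs_def] by simp
qed

text \<open>The formal polynomial uses only the registers of edges in increasing orientation;
  reading a reversed pair from the same register makes the weights symmetric.\<close>

definition pair_weight :: "nat \<Rightarrow> (nat \<Rightarrow> 'a) \<Rightarrow> nat \<Rightarrow> nat \<Rightarrow> nat \<Rightarrow> nat \<Rightarrow> 'a" where
  "pair_weight n f x y i j = f (if x \<le> y then binary_cell n x y i j else binary_cell n y x j i)"

lemma neval_formal_pf:
  assumes "E \<subseteq> vertex_pairs {..<n}"
  shows "neval f (formal_pf n E) =
    pf {..<n} E (f 0) (\<lambda>v i. f (unary_cell v i)) (pair_weight n f)"
proof -
  have le: "Min e \<le> Max e" if "e \<in> E" for e using edge_MinMax(1)[OF assms that] by simp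
  have "neval f (formal_pf n E) = (\<Sum>S\<in>Pow {..<n}. \<Prod>x\<in>#score_monomial n E S. f x)"
    by (simp add: neval_def formal_pf_def multiset.map_comp o_def sum_unfold_sum_mset)
  also have "\<dots> = (\<Sum>S\<in>Pow {..<n}. f 0 * (\<Prod>v<n. f (unary_cell v (of_bool (v \<in> S)))) *
      (\<Prod>e\<in>E. edge_factor (pair_weight n f) S e))"
    using le by (intro sum.cong refl)
      (simp add: score_monomial_def multiset.map_comp o_def edge_factor_def pair_weight_def prod_unfold_prod_mset[symmetric] mult.assoc
        cong: prod.cong)
  finally show ?thesis by (simp add: pf_def)
qed

lemma pair_weight_sym: "edge_sym E (pair_weight n f)" if "E \<subseteq> vertex_pairs {..<n}"
  unfolding edge_sym_def
proof (intro allI impI)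
  fix x y i j assume "{x, y} \<in> E"
  from subsetD[OF that this] have "x \<noteq> y" by (simp add: doubleton_in_vertex_pairs)
  then show "pair_weight n f x y i j = pair_weight n f y x j i" by (auto simp: pair_weight_def)
qed

definition code_bound :: "nat \<Rightarrow> nat \<Rightarrow> nat" where
  "code_bound n t = (2 * (cell_count n + t) * (cell_count n + t)) ^ t * (cell_count n + t)"

lemma accepts_exists:
  assumes E: "E \<subseteq> vertex_pairs {..<n}"
  shows "\<exists>t u. u < code_bound n t \<and> accepts n E t u \<and>
    real t \<le> 24 * real n + 263 * component_sum (sqrt 2) {..<n} E"
proof -
  define bd where "bd = 24 * real n + 263 * component_sum (sqrt 2) {..<n} E"
  define k where "k = nat \<lfloor>bd\<rfloor>"
  define f where "f = kron n k"
  have sub: "entries {..<n} E (f 0) (\<lambda>v i. f (unary_cell v i)) (pair_weight n f) \<subseteq> f ` {..<cell_count n}"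
  proof -
    have "pair_weight n f x y i j \<in> f ` {..<cell_count n}" if "{x, y} \<in> E" "i < 2" "j < 2" for x y i j
    proof -
      have "x < n" "y < n" using subsetD[OF E that(1)] by (simp_all add: doubleton_in_vertex_pairs)
      then show ?thesis using that binary_cell_less by (auto simp: pair_weight_def)
    qed
    moreover have "f (unary_cell v i) \<in> f ` {..<cell_count n}" if "v < n" "i < 2" for v i
      using that by (intro imageI) (simp add: unary_cell_def cell_count_def)
    moreover have "f 0 \<in> f ` {..<cell_count n}" by (intro imageI) (simp add: cell_count_pos)
    ultimately show ?thesis by (auto simp: entries_def)
  qed
  obtain t B where tB: "chain (f ` {..<cell_count n}) t B" "neval f (formal_pf n E) \<in> B" "real t \<le> bd"
    using pf_chain[OF _ E pair_weight_sym[OF E] sub] neval_formal_pf[OF E, of f] unfolding bd_def by auto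
  obtain u where u: "u < code_bound n t" "slp_out (+) (*) (cell_count n) t u f = neval f (formal_pf n E)"
    using slp_out_exists[OF tB(1) cell_count_pos tB(2)] unfolding code_bound_def by blast
  have "t \<le> k" using tB(3) by (simp add: k_def le_nat_iff le_floor_iff)
  \<comment> \<open>Equality at the base for k lifts to formal polynomials and from there descends
    to the base for t, at which the test is made.\<close>
  then have "accepts n E t u"
    using slp_out_formal[OF E _ u(2)[unfolded f_def]] neval_slp_out[of "kron n t" n t u]
    by (simp add: accepts_def)
  then show ?thesis using u tB(3) unfolding bd_def by blast
qed

text \<open>The inverse of the register numbering: register r stands for the address at which h is
  read.\<close>

definition cell_value :: "nat \<Rightarrow> (nat list \<Rightarrow> 'r) \<Rightarrow> nat \<Rightarrow> 'r" where
  "cell_value n h r =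
    (if r = 0 then h []
     else if r < 1 + 2 * n then h [(r - 1) div 2, (r - 1) mod 2]
     else let q = r - (1 + 2 * n) in h [q div 4 div n, q div 4 mod n, q mod 4 div 2, q mod 2])"

lemma cell_value_unary: "v < n \<Longrightarrow> i < 2 \<Longrightarrow> cell_value n h (unary_cell v i) = h [v, i]"
  by (simp add: cell_value_def unary_cell_def)

lemma cell_value_binary:
  assumes "y < n" "i < 2" "j < 2"
  shows "cell_value n h (binary_cell n x y i j) = h [x, y, i, j]"
proof -
  define q where "q = 4 * (x * n + y) + 2 * i + j"
  have q: "q = (2 * i + j) + 4 * (x * n + y)" "2 * i + j < 4" using assms by (auto simp: q_def)
  have "q div 4 = x * n + y" "q mod 4 = 2 * i + j"
    unfolding q(1) mod_mult_self2 using q(2) by simp_all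
  moreover have "q mod 2 = j"
  proof -
    have "q = j + 2 * (2 * (x * n + y) + i)" by (simp add: q_def)
    then show ?thesis using assms by (simp only: mod_mult_self2 mod_less)
  qed
  moreover have "(2 * i + j) div 2 = i" using assms by simp
  ultimately show ?thesis using assms
    by (simp add: cell_value_def binary_cell_def Let_def add.assoc flip: q_def) (simp add: q_def add.assoc)
qed

context cring
begin

lemma reval_formal_pf:
  assumes E: "E \<subseteq> vertex_pairs {..<n}" and I: "rcsp_instance R 2 {..<n} E I"
  defines "f \<equiv> cell_value n (input_entries R 2 n E I)"
  shows "reval f (formal_pf n E) = partition_function R 2 {..<n} E I" "\<And>r. f r \<in> carrier R"
proof -
  have ent: "input_entries R 2 n E I a \<in> carrier R" for a
    using I by (auto simp: input_entries_def rcsp_instance_def split: list.splits)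
  show f: "f r \<in> carrier R" for r by (simp add: f_def cell_value_def Let_def ent)
  define S where "S \<sigma> = {v \<in> {..<n}. \<sigma> v = (1::nat)}" for \<sigma>
  have finE: "finite E" by (rule finite_edges[OF E])
  have sc: "rmon f (score_monomial n E T) = score R {..<n} E I (\<lambda>v\<in>{..<n}. of_bool (v \<in> T))"
    if "T \<subseteq> {..<n}" for T
  proof -
    have u: "f (unary_cell v (of_bool (v \<in> T))) = unary I v (of_bool (v \<in> T))" if "v < n" for v
      using that by (simp add: f_def cell_value_unary input_entries_def)
    have b: "f (binary_cell n (Min e) (Max e) (of_bool (Min e \<in> T)) (of_bool (Max e \<in> T))) =
        binary I (Min e) (Max e) (of_bool (Min e \<in> T)) (of_bool (Max e \<in> T))" if "e \<in> E" for e
      using edge_MinMax[OF E that] that by (simp add: f_def cell_value_binary input_entries_def)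
    have lt: "Min e < n" "Max e < n" if "e \<in> E" for e using edge_MinMax[OF E that] by auto
    have cu: "unary I v i \<in> carrier R" if "v < n" "i < 2" for v i
      using I that by (auto simp: rcsp_instance_def)
    have cb: "binary I (Min e) (Max e) i j \<in> carrier R" if "e \<in> E" "i < 2" "j < 2" for e i j
      using I that edge_MinMax(3)[OF E that(1)] unfolding rcsp_instance_def by metis
    have "rmon f (score_monomial n E T) = f 0 \<otimes>
        ((\<Otimes>v\<in>{..<n}. f (unary_cell v (of_bool (v \<in> T)))) \<otimes>
         (\<Otimes>e\<in>E. f (binary_cell n (Min e) (Max e) (of_bool (Min e \<in> T)) (of_bool (Max e \<in> T)))))"
      by (simp add: score_monomial_def rmon_plus rmon_add_mset rmon_empty rmon_image_mset_set f finE m_assoc finprod_closed Pi_I)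
    also have "f 0 = nullary I" by (simp add: f_def cell_value_def input_entries_def)
    also have "(\<Otimes>v\<in>{..<n}. f (unary_cell v (of_bool (v \<in> T)))) =
        (\<Otimes>v\<in>{..<n}. unary I v ((\<lambda>v\<in>{..<n}. of_bool (v \<in> T)) v))"
      by (rule finprod_cong') (auto simp: u intro!: cu)
    also have "(\<Otimes>e\<in>E. f (binary_cell n (Min e) (Max e) (of_bool (Min e \<in> T)) (of_bool (Max e \<in> T)))) =
        (\<Otimes>e\<in>E. binary I (Min e) (Max e) ((\<lambda>v\<in>{..<n}. of_bool (v \<in> T)) (Min e)) ((\<lambda>v\<in>{..<n}. of_bool (v \<in> T)) (Max e)))"
      by (rule finprod_cong') (auto simp: b lt intro!: cb)
    finally show ?thesis unfolding score_def
      using I by (subst m_assoc) (auto simp: lt rcsp_instance_def intro!: finprod_closed cu cb)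
  qed
  have bij: "inj_on (\<lambda>T. \<lambda>v\<in>{..<n}. of_bool (v \<in> T) :: nat) (Pow {..<n})"
    "(\<lambda>T. \<lambda>v\<in>{..<n}. of_bool (v \<in> T) :: nat) ` Pow {..<n} = {..<n} \<rightarrow>\<^sub>E {..<2}"
  proof -
    have S: "S (\<lambda>v\<in>{..<n}. of_bool (v \<in> T)) = T" if "T \<subseteq> {..<n}" for T
      using that by (auto simp: S_def)
    then show "inj_on (\<lambda>T. \<lambda>v\<in>{..<n}. of_bool (v \<in> T) :: nat) (Pow {..<n})"
      by (intro inj_on_inverseI[of _ S]) auto
    have "\<sigma> = (\<lambda>v\<in>{..<n}. of_bool (v \<in> S \<sigma>))" if "\<sigma> \<in> {..<n} \<rightarrow>\<^sub>E {..<2}" for \<sigma>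
    proof
      fix v
      show "\<sigma> v = (\<lambda>v\<in>{..<n}. of_bool (v \<in> S \<sigma>)) v"
      proof (cases "v < n")
        case True
        then have "\<sigma> v < 2" using PiE_mem[OF that, of v] by simp
        then consider "\<sigma> v = 0" | "\<sigma> v = 1" by linarith
        then show ?thesis by cases (simp_all add: S_def True)
      next
        case False
        then show ?thesis using PiE_arb[OF that, of v] by simp
      qed
    qed
    moreover have "S \<sigma> \<in> Pow {..<n}" for \<sigma> by (auto simp: S_def)
    ultimately show "(\<lambda>T. \<lambda>v\<in>{..<n}. of_bool (v \<in> T) :: nat) ` Pow {..<n} = {..<n} \<rightarrow>\<^sub>E {..<2}"
      by (intro subset_antisym subsetI) (auto simp: PiE_iff intro: image_eqI)
  qed
  have rc: "rmon f m \<in> carrier R" for m by (rule rmon_closed[OF f])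
  have "reval f (formal_pf n E) = (\<Oplus>T\<in>Pow {..<n}. rmon f (score_monomial n E T))"
    unfolding formal_pf_def by (rule reval_image_mset_set) (auto simp: f)
  also have "\<dots> = (\<Oplus>T\<in>Pow {..<n}. score R {..<n} E I (\<lambda>v\<in>{..<n}. of_bool (v \<in> T)))"
    using rc by (intro finsum_cong') (auto simp flip: sc)
  also have "\<dots> = (\<Oplus>\<sigma>\<in>{..<n} \<rightarrow>\<^sub>E {..<2}. score R {..<n} E I \<sigma>)"
    unfolding bij(2)[symmetric]
  proof (rule finsum_reindex[symmetric, OF _ bij(1)], rule Pi_I, erule imageE)
    fix \<sigma> :: "nat \<Rightarrow> nat" and T assume "\<sigma> = (\<lambda>v\<in>{..<n}. of_bool (v \<in> T))" "T \<in> Pow {..<n}"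
    then show "score R {..<n} E I \<sigma> \<in> carrier R" using rc by (simp only: Pow_iff sc[symmetric])
  qed
  finally show "reval f (formal_pf n E) = partition_function R 2 {..<n} E I"
    by (simp add: partition_function_def)
qed

text \<open>Acceptance is an equation between numbers. By injectivity of the evaluation it is an
  equation of formal polynomials, and this persists under evaluation in R.\<close>

lemma accepts_sound:
  assumes E: "E \<subseteq> vertex_pairs {..<n}" and I: "rcsp_instance R 2 {..<n} E I" and acc: "accepts n E t u"
  shows "slp_out (\<oplus>) (\<otimes>) (cell_count n) t u (cell_value n (input_entries R 2 n E I)) =
    partition_function R 2 {..<n} E I"
proof -
  define f where "f = cell_value n (input_entries R 2 n E I)"
  have f: "f r \<in> carrier R" for r using reval_formal_pf(2)[OF E I] by (simp add: f_def)
  have "reval f (slp_out (+) fmult (cell_count n) t u (\<lambda>r. {#{#r#}#})) = slp_out (\<oplus>) (\<otimes>) (cell_count n) t u f"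
    unfolding slp_out_def
    by (rule slp_hom) (auto simp: reval_plus[OF f] reval_fmult[OF f] reval_single[OF f] cell_count_pos)
  moreover have "slp_out (+) fmult (cell_count n) t u (\<lambda>r. {#{#r#}#}) = formal_pf n E"
    using acc by (intro slp_out_formal[OF E order_refl]) (simp add: accepts_def)
  ultimately show ?thesis using reval_formal_pf(1)[OF E I] by (simp add: f_def)
qed

end

section \<open>The program\<close>

definition run :: "('r, 'm) ring_scheme \<Rightarrow> com \<Rightarrow> (nat list \<Rightarrow> nat) \<Rightarrow> (nat list \<Rightarrow> 'r) \<Rightarrow>
    (nat \<Rightarrow> (nat list \<Rightarrow> nat) \<Rightarrow> (nat list \<Rightarrow> 'r) \<Rightarrow> bool) \<Rightarrow> bool" where
  "run R p m h P \<longleftrightarrow> (\<exists>t m' h'. exec R p (m, h) t (m', h') \<and> P t m' h')"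

text \<open>The case of code that leaves the ring memory alone and performs no ring operation; the
  whole search is of this kind.\<close>

definition nrun :: "('r, 'm) ring_scheme \<Rightarrow> com \<Rightarrow> (nat list \<Rightarrow> nat) \<Rightarrow> (nat list \<Rightarrow> 'r) \<Rightarrow>
    ((nat list \<Rightarrow> nat) \<Rightarrow> bool) \<Rightarrow> bool" where
  "nrun R p m h Q \<longleftrightarrow> run R p m h (\<lambda>t m' h'. t = 0 \<and> h' = h \<and> Q m')"

lemma run_mono: "run R p m h P \<Longrightarrow> (\<And>t m h. P t m h \<Longrightarrow> P' t m h) \<Longrightarrow> run R p m h P'"
  unfolding run_def by blast

lemma nrun_mono: "nrun R p m h Q \<Longrightarrow> (\<And>m. Q m \<Longrightarrow> Q' m) \<Longrightarrow> nrun R p m h Q'"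
  unfolding nrun_def by (erule run_mono) blast

lemma run_Seq: "run R p m h (\<lambda>t m' h'. run R q m' h' (\<lambda>t'. P (t + t'))) \<Longrightarrow> run R (Seq p q) m h P"
  unfolding run_def by (metis exec_Seq)

lemma run_Seq_nat: "nrun R p m h (\<lambda>m'. run R q m' h P) \<Longrightarrow> run R (Seq p q) m h P"
  by (rule run_Seq, unfold nrun_def, erule run_mono) auto

lemma run_Cond:
  "(val m e \<noteq> 0 \<Longrightarrow> run R p m h P) \<Longrightarrow> (val m e = 0 \<Longrightarrow> run R q m h P) \<Longrightarrow> run R (Cond e p q) m h P"
  unfolding run_def using exec_Cond_True[of "(m, h)" e R p] exec_Cond_False[of "(m, h)" e R q]
  by (metis fst_conv)

lemma run_Assign: "P 0 (m(addr m a := val m e)) h \<Longrightarrow> run R (Assign a e) m h P"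
  unfolding run_def using exec_Assign by fast

lemma run_RCopy: "P 0 m (h(addr m a := h (addr m b))) \<Longrightarrow> run R (RCopy a b) m h P"
  unfolding run_def using exec_RCopy by fast

lemma run_RAdd: "P 1 m (h(addr m a := h (addr m b) \<oplus>\<^bsub>R\<^esub> h (addr m c))) \<Longrightarrow> run R (RAdd a b c) m h P"
  unfolding run_def using exec_RAdd by fast

lemma run_RMult: "P 1 m (h(addr m a := h (addr m b) \<otimes>\<^bsub>R\<^esub> h (addr m c))) \<Longrightarrow> run R (RMult a b c) m h P"
  unfolding run_def using exec_RMult by fast

lemma nrun_Skip: "Q m \<Longrightarrow> nrun R Skip m h Q"
  unfolding nrun_def run_def using exec_Skip by fast

lemma nrun_Assign: "Q (m(addr m a := val m e)) \<Longrightarrow> nrun R (Assign a e) m h Q"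
  unfolding nrun_def run_def using exec_Assign by fast

lemma nrun_Seq: "nrun R p m h (\<lambda>m'. nrun R q m' h Q) \<Longrightarrow> nrun R (Seq p q) m h Q"
  unfolding nrun_def[of R "Seq p q"] by (rule run_Seq_nat) (simp add: nrun_def)

lemma nrun_Cond:
  "(val m e \<noteq> 0 \<Longrightarrow> nrun R p m h Q) \<Longrightarrow> (val m e = 0 \<Longrightarrow> nrun R q m h Q) \<Longrightarrow> nrun R (Cond e p q) m h Q"
  unfolding nrun_def by (rule run_Cond)

lemma run_nrun: "nrun R p m h (\<lambda>m'. P 0 m' h) \<Longrightarrow> run R p m h P"
  unfolding nrun_def by (erule run_mono) auto

lemma run_While_False: "val m e = 0 \<Longrightarrow> P 0 m h \<Longrightarrow> run R (While e p) m h P"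
  unfolding run_def using exec_While_False[of "(m, h)" e R p] by auto

lemma run_While_True:
  "val m e \<noteq> 0 \<Longrightarrow> run R p m h (\<lambda>t m' h'. run R (While e p) m' h' (\<lambda>t'. P (t + t'))) \<Longrightarrow>
    run R (While e p) m h P"
  unfolding run_def using exec_While_True[of "(m, h)" e R p] by (metis fst_conv)

definition For :: "nat \<Rightarrow> exp \<Rightarrow> com \<Rightarrow> com" where
  "For x e p = Seq (Assign [Const x] (Const 0))
    (While (Minus e (Cell [Const x])) (Seq p (Assign [Const x] (Plus (Cell [Const x]) (Const 1)))))"

text \<open>The loop evaluates e again in every round, hence the assumption that the invariant fixes
  its value. The increment belongs to the round, so the invariant for k + 1 is required of the
  memory with the counter already increased.\<close>

lemma run_For:
  assumes init: "I 0 0 (m([x] := 0)) h"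
    and step: "\<And>k t m h. k < N \<Longrightarrow> m [x] = k \<Longrightarrow> I k t m h \<Longrightarrow>
      run R p m h (\<lambda>t' m' h'. m' [x] = k \<and> I (Suc k) (t + t') (m'([x] := Suc k)) h')"
    and bound: "\<And>k t m h. I k t m h \<Longrightarrow> val m e = N"
    and fin: "\<And>t m h. m [x] = N \<Longrightarrow> I N t m h \<Longrightarrow> P t m h"
  shows "run R (For x e p) m h P"
proof -
  let ?w = "While (Minus e (Cell [Const x])) (Seq p (Assign [Const x] (Plus (Cell [Const x]) (Const 1))))"
  have loop: "run R ?w m h (\<lambda>t'. P (t + t'))" if "d = N - k" "k \<le> N" "m [x] = k" "I k t m h" for d k t m h
    using that
  proof (induction d arbitrary: k t m h)
    case 0
    then have "k = N" by simp
    then show ?case using 0 bound[of N t m h] fin[of m t h] by (intro run_While_False) auto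
  next
    case (Suc d)
    then have k: "k < N" by simp
    show ?case
    proof (rule run_While_True)
      show "val m (Minus e (Cell [Const x])) \<noteq> 0" using bound[OF Suc.prems(4)] Suc.prems(3) k by simp
      show "run R (Seq p (Assign [Const x] (Plus (Cell [Const x]) (Const 1)))) m h
          (\<lambda>t' m' h'. run R ?w m' h' (\<lambda>t''. P (t + (t' + t''))))"
      proof (rule run_Seq, rule run_mono[OF step[OF k Suc.prems(3,4)]])
        fix t' m' h' assume a: "m' [x] = k \<and> I (Suc k) (t + t') (m'([x] := Suc k)) h'"
        have "run R ?w (m'([x] := Suc k)) h' (\<lambda>t''. P (t + t' + t''))"
        proof (rule Suc.IH)
          show "d = N - Suc k" using Suc.prems(1) by simp
          show "Suc k \<le> N" using k by simp
          show "(m'([x] := Suc k)) [x] = Suc k" by simp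
          show "I (Suc k) (t + t') (m'([x] := Suc k)) h'" using a by blast
        qed
        then show "run R (Assign [Const x] (Plus (Cell [Const x]) (Const 1))) m' h'
            (\<lambda>t'' m' h'. run R ?w m' h' (\<lambda>t'''. P (t + (t' + t'' + t'''))))"
          using a by (intro run_Assign) (simp add: add.assoc)
      qed
    qed
  qed
  show ?thesis
    unfolding For_def
    by (rule run_Seq_nat, rule nrun_Assign) (use loop[of N 0 "m([x] := 0)" 0 h] init in simp)
qed

lemma nrun_For:
  assumes init: "I 0 (m([x] := 0))"
    and step: "\<And>k m. k < N \<Longrightarrow> m [x] = k \<Longrightarrow> I k m \<Longrightarrow>
      nrun R p m h (\<lambda>m'. m' [x] = k \<and> I (Suc k) (m'([x] := Suc k)))"
    and bound: "\<And>k m. I k m \<Longrightarrow> val m e = N"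
    and fin: "\<And>m. m [x] = N \<Longrightarrow> I N m \<Longrightarrow> Q m"
  shows "nrun R (For x e p) m h Q"
  unfolding nrun_def
proof (rule run_For[where I = "\<lambda>k t m h'. t = (0::nat) \<and> h' = h \<and> I k m" and N = N])
  fix k t m h' assume "k < N" "m [x] = k" "t = (0::nat) \<and> h' = h \<and> I k m"
  then show "run R p m h' (\<lambda>t' m' h''. m' [x] = k \<and> t + t' = 0 \<and> h'' = h \<and> I (Suc k) (m'([x] := Suc k)))"
    using step[of k m] unfolding nrun_def by (auto elim: run_mono)
qed (use init bound fin in auto)

section \<open>The search for a shortest program\<close>

text \<open>
  The addresses of length one hold scalars: \<open>[0]\<close> and \<open>[1]\<close> are the length and the code of the program
  under test, \<open>[2]\<close> is zero until a code \<open>u\<close> is accepted and \<open>Suc u\<close> afterwards, \<open>[3]\<close> is the base \<open>B\<close>,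
  \<open>[5]\<close> the number of input cells, \<open>[10]\<close> the number of registers, \<open>[11]\<close> the base for the codes of
  steps, \<open>[22]\<close> the number of codes, \<open>[16]\<close> and \<open>[17]\<close> the two values to be compared; the others are
  temporary.  The addresses \<open>[0, 0, r]\<close> hold the registers on the natural number side, \<open>[1, 0, v]\<close> the
  bits of an assignment, and the ring registers have the addresses \<open>[r]\<close> in the ring memory.
\<close>

abbreviation "Sc k \<equiv> Cell [Const k]"
abbreviation "Reg e \<equiv> Cell [Const 0, Const 0, e]"
abbreviation "Bit e \<equiv> Cell [Const 1, Const 0, e]"
abbreviation "asg k e \<equiv> Assign [Const k] e"

fun seqs :: "com list \<Rightarrow> com" where
  "seqs [] = Skip"
| "seqs (p # ps) = Seq p (seqs ps)"

definition "setup_prog = seqs [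
  asg 5 (Plus (Plus (Const 1) (Times (Const 2) (Cell []))) (Times (Const 4) (Times (Cell []) (Cell [])))),
  asg 10 (Plus (Sc 5) (Sc 0)),
  asg 11 (Times (Times (Const 2) (Sc 10)) (Sc 10)),
  asg 22 (Sc 10),
  For 7 (Sc 0) (asg 22 (Times (Sc 22) (Sc 11)))]"

definition "base_prog = seqs [
  asg 3 (Const 2),
  For 7 (Plus (Plus (Sc 0) (Cell [])) (Const 3)) (asg 3 (Times (Sc 3) (Sc 3)))]"

text \<open>Cell \<open>[6]\<close> holds the current Kronecker point; multiplying B copies of it
  gives its B-th power, which is the next point.\<close>

definition "kron_prog = seqs [
  asg 6 (Sc 3),
  For 7 (Sc 5) (seqs [
    Assign [Const 0, Const 0, Sc 7] (Sc 6),
    asg 8 (Const 1),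
    For 9 (Sc 3) (asg 8 (Times (Sc 8) (Sc 6))),
    asg 6 (Sc 8)])]"

definition "bits_prog = seqs [
  asg 12 (Sc 7),
  For 8 (Cell []) (seqs [
    Assign [Const 1, Const 0, Sc 8] (Modulo (Sc 12) (Const 2)),
    asg 12 (Divide (Sc 12) (Const 2))])]"

text \<open>Because subtraction is truncated, the condition is nonzero iff {x, y} is an edge with x
  < y, so each edge contributes one factor. The second loop runs over x * n + y, the offset used in
  \<open>binary_cell\<close>.\<close>

definition "term_prog = seqs [
  asg 19 (Reg (Const 0)),
  For 8 (Cell []) (asg 19 (Times (Sc 19) (Reg (Plus (Plus (Const 1) (Times (Const 2) (Sc 8))) (Bit (Sc 8)))))),
  For 8 (Times (Cell []) (Cell [])) (seqs [
    asg 20 (Divide (Sc 8) (Cell [])),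
    asg 21 (Modulo (Sc 8) (Cell [])),
    Cond (Times (Cell [Sc 20, Sc 21]) (Minus (Sc 21) (Sc 20)))
      (asg 19 (Times (Sc 19) (Reg (Plus (Plus (Plus (Plus (Const 1) (Times (Const 2) (Cell [])))
        (Times (Const 4) (Sc 8))) (Times (Const 2) (Bit (Sc 20)))) (Bit (Sc 21))))))
      Skip])]"

definition "target_prog = seqs [
  asg 17 (Const 0),
  asg 18 (Const 1),
  For 7 (Cell []) (asg 18 (Times (Sc 18) (Const 2))),
  For 7 (Sc 18) (seqs [bits_prog, term_prog, asg 17 (Plus (Sc 17) (Sc 19))])]"

definition "decode_prog = seqs [
  asg 13 (Modulo (Sc 12) (Sc 11)),
  asg 12 (Divide (Sc 12) (Sc 11)),
  asg 14 (Modulo (Modulo (Divide (Sc 13) (Const 2)) (Sc 10)) (Plus (Sc 5) (Sc 7))),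
  asg 15 (Modulo (Divide (Divide (Sc 13) (Const 2)) (Sc 10)) (Plus (Sc 5) (Sc 7)))]"

text \<open>Each step removes one digit from \<open>[12]\<close>; what is left after the last step
  encodes the output register.\<close>

definition "slp_prog = seqs [
  asg 12 (Sc 1),
  For 7 (Sc 0) (seqs [
    decode_prog,
    Cond (Modulo (Sc 13) (Const 2))
      (Assign [Const 0, Const 0, Plus (Sc 5) (Sc 7)] (Times (Reg (Sc 14)) (Reg (Sc 15))))
      (Assign [Const 0, Const 0, Plus (Sc 5) (Sc 7)] (Plus (Reg (Sc 14)) (Reg (Sc 15))))]),
  asg 16 (Reg (Modulo (Sc 12) (Sc 10)))]"

lemma nrun_seqs_Cons: "nrun R p m h (\<lambda>m'. nrun R (seqs ps) m' h Q) \<Longrightarrow> nrun R (seqs (p # ps)) m h Q"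
  by (simp add: nrun_Seq)

lemma nrun_seqs_Nil: "Q m \<Longrightarrow> nrun R (seqs []) m h Q"
  by (simp add: nrun_Skip)

lemma setup_spec:
  assumes "m [] = n" "m [0] = t"
    and Q: "\<And>m'. \<forall>a. a \<notin> {[5], [7], [10], [11], [22]} \<longrightarrow> m' a = m a \<Longrightarrow> m' [5] = cell_count n \<Longrightarrow>
      m' [10] = cell_count n + t \<Longrightarrow> m' [11] = 2 * (cell_count n + t) * (cell_count n + t) \<Longrightarrow>
      m' [22] = code_bound n t \<Longrightarrow> Q m'"
  shows "nrun R setup_prog m h Q"
proof -
  define L where "L = cell_count n + t"
  define I where "I k m' \<longleftrightarrow> (\<forall>a. a \<notin> {[5], [7], [10], [11], [22]} \<longrightarrow> m' a = m a) \<and> m' [5] = cell_count n \<and>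
    m' [10] = L \<and> m' [11] = 2 * L * L \<and> m' [22] = (2 * L * L) ^ k * L" for k m'
  show ?thesis
    unfolding setup_prog_def
    apply (rule nrun_seqs_Cons nrun_Assign)+
    apply (rule nrun_For[where I = I and N = t])
    subgoal using assms by (simp add: I_def L_def cell_count_def)
    subgoal for k m' by (rule nrun_Assign) (simp add: I_def)
    subgoal for k m' using assms by (simp add: I_def)
    subgoal for m' by (rule nrun_seqs_Nil, rule Q) (simp_all add: I_def L_def code_bound_def)
    done
qed

lemma base_spec:
  assumes "m [] = n" "m [0] = t"
    and Q: "\<And>m'. \<forall>a. a \<notin> {[3], [7]} \<longrightarrow> m' a = m a \<Longrightarrow> m' [3] = kron_base n t \<Longrightarrow> Q m'"
  shows "nrun R base_prog m h Q"
proof -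
  define I where "I k m' \<longleftrightarrow> (\<forall>a. a \<notin> {[3], [7]} \<longrightarrow> m' a = m a) \<and> m' [3] = 2 ^ 2 ^ k" for k :: nat and m'
  show ?thesis
    unfolding base_prog_def
    apply (rule nrun_seqs_Cons nrun_Assign)+
    apply (rule nrun_For[where I = I and N = "t + n + 3"])
    subgoal by (simp add: I_def)
    subgoal for k m' by (rule nrun_Assign) (simp add: I_def mult_2 power_add)
    subgoal for k m' using assms by (simp add: I_def)
    subgoal for m' by (rule nrun_seqs_Nil, rule Q) (simp_all add: I_def kron_base_def)
    done
qed

lemma kron_spec:
  assumes "m [3] = b" "m [5] = N"
    and Q: "\<And>m'. \<forall>a. a \<notin> {[6], [7], [8], [9]} \<union> {a. length a = 3 \<and> hd a = 0} \<longrightarrow> m' a = m a \<Longrightarrow>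
      \<forall>r<N. m' [0, 0, r] = b ^ b ^ r \<Longrightarrow> Q m'"
  shows "nrun R kron_prog m h Q"
proof -
  define I where "I k m' \<longleftrightarrow> (\<forall>a. a \<notin> {[6], [7], [8], [9]} \<union> {a. length a = 3 \<and> hd a = 0} \<longrightarrow> m' a = m a) \<and>
    (\<forall>r<k. m' [0, 0, r] = b ^ b ^ r) \<and> m' [6] = b ^ b ^ k" for k :: nat and m'
  define J where "J k i m' \<longleftrightarrow> (\<forall>a. a \<notin> {[6], [7], [8], [9]} \<union> {a. length a = 3 \<and> hd a = 0} \<longrightarrow> m' a = m a) \<and>
    (\<forall>r<Suc k. m' [0, 0, r] = b ^ b ^ r) \<and> m' [6] = b ^ b ^ k \<and> m' [7] = k \<and> m' [8] = (b ^ b ^ k) ^ i"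
    for k i :: nat and m'
  have inner: "nrun R (seqs [Assign [Const 0, Const 0, Sc 7] (Sc 6), asg 8 (Const 1),
      For 9 (Sc 3) (asg 8 (Times (Sc 8) (Sc 6))), asg 6 (Sc 8)]) m' h
      (\<lambda>m'. m' [7] = k \<and> I (Suc k) (m'([7] := Suc k)))" if "m' [7] = k" "I k m'" for k m'
    apply (rule nrun_seqs_Cons nrun_Assign)+
    apply (rule nrun_For[where I = "J k" and N = b])
    subgoal using that by (auto simp: I_def J_def less_Suc_eq)
    subgoal for i m'' by (rule nrun_Assign) (simp add: J_def)
    subgoal for i m'' using assms by (simp add: J_def)
    subgoal for m''
      by (rule nrun_seqs_Cons nrun_Assign nrun_seqs_Nil)+ (auto simp: I_def J_def power_mult[symmetric] mult.commute)
    done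
  show ?thesis
    unfolding kron_prog_def
    apply (rule nrun_seqs_Cons nrun_Assign)+
    apply (rule nrun_For[where I = I and N = N])
    subgoal using assms by (simp add: I_def)
    subgoal for k m' by (rule inner)
    subgoal for k m' using assms by (simp add: I_def)
    subgoal for m' by (rule nrun_seqs_Nil, rule Q) (simp_all add: I_def)
    done
qed

lemma bits_spec:
  assumes "m [] = n" "m [7] = a"
    and Q: "\<And>m'. \<forall>c. c \<notin> {[8], [12]} \<union> {a. length a = 3 \<and> hd a \<noteq> 0} \<longrightarrow> m' c = m c \<Longrightarrow>
      \<forall>v<n. m' [1, 0, v] = a div 2 ^ v mod 2 \<Longrightarrow> Q m'"
  shows "nrun R bits_prog m h Q"
proof -
  define I where "I k m' \<longleftrightarrow> (\<forall>c. c \<notin> {[8], [12]} \<union> {a. length a = 3 \<and> hd a \<noteq> 0} \<longrightarrow> m' c = m c) \<and>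
    (\<forall>v<k. m' [1, 0, v] = a div 2 ^ v mod 2) \<and> m' [12] = a div 2 ^ k" for k :: nat and m'
  show ?thesis
    unfolding bits_prog_def
    apply (rule nrun_seqs_Cons nrun_Assign)+
    apply (rule nrun_For[where I = I and N = n])
    subgoal using assms by (simp add: I_def)
    subgoal for k m'
      by (rule nrun_seqs_Cons nrun_Assign nrun_seqs_Nil)+
        (auto simp: I_def less_Suc_eq div_mult2_eq[symmetric] mult.commute)
    subgoal for k m' using assms by (simp add: I_def)
    subgoal for m' by (rule nrun_seqs_Nil, rule Q) (simp_all add: I_def)
    done
qed

text \<open>The result of \<open>term_prog\<close> for the assignment given by the binary digits of
  a, with one factor per round of its loops.\<close>

definition assignment_weight :: "nat \<Rightarrow> nat set set \<Rightarrow> (nat \<Rightarrow> nat) \<Rightarrow> nat \<Rightarrow> nat" where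
  "assignment_weight n E f a =
    f 0 * (\<Prod>v<n. f (unary_cell v (a div 2 ^ v mod 2))) *
    (\<Prod>q<n * n. if {q div n, q mod n} \<in> E \<and> q div n < q mod n
      then f (binary_cell n (q div n) (q mod n) (a div 2 ^ (q div n) mod 2) (a div 2 ^ (q mod n) mod 2)) else 1)"

lemma term_spec:
  assumes m: "m [] = n" "\<forall>x y. m [x, y] = (if {x, y} \<in> E then 1 else 0)"
    "\<forall>r<cell_count n. m [0, 0, r] = f r" "\<forall>v<n. m [1, 0, v] = a div 2 ^ v mod 2"
    and Q: "\<And>m'. \<forall>c. c \<notin> {[8], [19], [20], [21]} \<longrightarrow> m' c = m c \<Longrightarrow>
      m' [19] = assignment_weight n E f a \<Longrightarrow> Q m'"
  shows "nrun R term_prog m h Q"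
proof -
  define X where "X = {[8::nat], [19], [20], [21]}"
  define fa where "fa v = a div 2 ^ v mod 2" for v
  define g where "g q = (if {q div n, q mod n} \<in> E \<and> q div n < q mod n
      then f (binary_cell n (q div n) (q mod n) (fa (q div n)) (fa (q mod n))) else 1)" for q
  define I where "I k m' \<longleftrightarrow> (\<forall>c. c \<notin> X \<longrightarrow> m' c = m c) \<and>
    m' [19] = f 0 * (\<Prod>v<k. f (unary_cell v (fa v)))" for k m'
  define J where "J k m' \<longleftrightarrow> (\<forall>c. c \<notin> X \<longrightarrow> m' c = m c) \<and>
    m' [19] = f 0 * (\<Prod>v<n. f (unary_cell v (fa v))) * (\<Prod>q<k. g q)" for k m'
  have fa: "fa v < 2" for v by (simp add: fa_def)
  have aw: "assignment_weight n E f a = f 0 * (\<Prod>v<n. f (unary_cell v (fa v))) * (\<Prod>q<n * n. g q)"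
    unfolding assignment_weight_def g_def fa_def ..
  have u: "1 + 2 * v + fa v < cell_count n" if "v < n" for v
    using that fa[of v] by (simp add: cell_count_def)
  have bd: "1 + 2 * n + 4 * q + 2 * fa x + fa y < cell_count n" if "q < n * n" for q x y
    using that fa[of x] fa[of y] by (simp add: cell_count_def)
  have body: "nrun R (seqs [asg 20 (Divide (Sc 8) (Cell [])), asg 21 (Modulo (Sc 8) (Cell [])),
    Cond (Times (Cell [Sc 20, Sc 21]) (Minus (Sc 21) (Sc 20)))
      (asg 19 (Times (Sc 19) (Reg (Plus (Plus (Plus (Plus (Const 1) (Times (Const 2) (Cell [])))
        (Times (Const 4) (Sc 8))) (Times (Const 2) (Bit (Sc 20)))) (Bit (Sc 21))))))
      Skip]) m' h (\<lambda>m'. m' [8] = k \<and> J (Suc k) (m'([8] := Suc k)))"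
    if k: "k < n * n" and m': "m' [8] = k" "J k m'" for k m'
  proof -
    have n: "n > 0" using k by (cases n) auto
    have xy: "k div n < n" "k mod n < n" using k n by (auto simp: less_mult_imp_div_less)
    have frame: "\<forall>c. c \<notin> X \<longrightarrow> m' c = m c" using m' by (simp add: J_def)
    have cells: "m' [] = n" "\<And>x y. m' [x, y] = (if {x, y} \<in> E then 1 else 0)"
      "m [Suc 0, 0, k div n] = fa (k div n)" "m [Suc 0, 0, k mod n] = fa (k mod n)"
      using m frame xy by (auto simp: X_def fa_def)
    have idx: "binary_cell n (k div n) (k mod n) i j = 1 + 2 * n + 4 * k + 2 * i + j" for i j
      by (simp add: binary_cell_def)
    have b2: "m [0, 0, Suc (2 * n + 4 * k + 2 * fa x + fa y)] = f (Suc (2 * n + 4 * k + 2 * fa x + fa y))" for x y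
      using bd[OF k, of x y] m(3) by simp
    show ?thesis
      apply (rule nrun_seqs_Cons nrun_Assign)+
      apply (rule nrun_Cond)
      subgoal
        apply (rule nrun_Assign nrun_seqs_Nil)+
        using m' by (simp add: J_def cells xy X_def g_def idx b2 split: if_splits)
      subgoal
        apply (rule nrun_Skip nrun_seqs_Nil)+
        using m' by (auto simp: J_def cells xy X_def g_def)
      done
  qed
  show ?thesis
    unfolding term_prog_def
    apply (rule nrun_seqs_Cons nrun_Assign)+
    apply (rule nrun_For[where I = I and N = n])
    subgoal using m cell_count_pos by (simp add: I_def X_def)
    subgoal for k m' using m u[of k]
      by (intro nrun_Assign) (simp add: I_def X_def unary_cell_def fa_def)
    subgoal for k m' using m by (simp add: I_def X_def)
    subgoal for m'
      apply (rule nrun_seqs_Cons)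
      apply (rule nrun_For[where I = J and N = "n * n"])
      subgoal by (simp add: I_def J_def X_def)
      subgoal for k m'' by (rule body)
      subgoal for k m'' using m by (simp add: J_def X_def)
      subgoal for m'' by (rule nrun_seqs_Nil, rule Q) (simp_all add: J_def X_def aw)
      done
    done
qed

lemma target_spec:
  assumes m: "m [] = n" "\<forall>x y. m [x, y] = (if {x, y} \<in> E then 1 else 0)"
    "\<forall>r<cell_count n. m [0, 0, r] = f r"
    and Q: "\<And>m'. \<forall>c. c \<notin> {[7], [8], [12], [17], [18], [19], [20], [21]} \<union> {a. length a = 3 \<and> hd a \<noteq> 0} \<longrightarrow> m' c = m c \<Longrightarrow>
      m' [17] = (\<Sum>a<2 ^ n. assignment_weight n E f a) \<Longrightarrow> Q m'"
  shows "nrun R target_prog m h Q"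
proof -
  define X where "X = {[7::nat], [8], [12], [17], [18], [19], [20], [21]} \<union> {a. length a = 3 \<and> hd a \<noteq> 0}"
  define I where "I k m' \<longleftrightarrow> (\<forall>c. c \<notin> X \<longrightarrow> m' c = m c) \<and> m' [17] = 0 \<and> m' [18] = 2 ^ k" for k :: nat and m'
  define J where "J k m' \<longleftrightarrow> (\<forall>c. c \<notin> X \<longrightarrow> m' c = m c) \<and> m' [18] = 2 ^ n \<and>
    m' [17] = (\<Sum>a<k. assignment_weight n E f a)" for k :: nat and m'
  have body: "nrun R (seqs [bits_prog, term_prog, asg 17 (Plus (Sc 17) (Sc 19))]) m' h
    (\<lambda>m'. m' [7] = k \<and> J (Suc k) (m'([7] := Suc k)))" if m': "m' [7] = k" "J k m'" for k m'
  proof -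
    have fr: "\<forall>c. c \<notin> X \<longrightarrow> m' c = m c" using m' by (simp add: J_def)
    have mm: "m' [] = n" "\<forall>x y. m' [x, y] = (if {x, y} \<in> E then 1 else 0)" "\<forall>r<cell_count n. m' [0, 0, r] = f r"
      using m fr by (auto simp: X_def)
    show ?thesis
      apply (rule nrun_seqs_Cons)
      apply (rule bits_spec[OF mm(1) m'(1)])
      apply (rule nrun_seqs_Cons)
      subgoal for m1
        apply (rule term_spec[where E = E and f = f and a = k and n = n])
        subgoal using mm by auto
        subgoal using mm by auto
        subgoal using mm by auto
        subgoal by auto
        subgoal for m2
          apply (rule nrun_seqs_Cons nrun_Assign nrun_seqs_Nil)+
          using m' by (auto simp: J_def X_def)
        done
      done
  qed
  show ?thesis
    unfolding target_prog_def
    apply (rule nrun_seqs_Cons nrun_Assign)+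
    apply (rule nrun_For[where I = I and N = n])
    subgoal by (simp add: I_def X_def)
    subgoal for k m' by (rule nrun_Assign) (simp add: I_def X_def)
    subgoal for k m' using m by (simp add: I_def X_def)
    subgoal for m'
      apply (rule nrun_seqs_Cons)
      apply (rule nrun_For[where I = J and N = "2 ^ n"])
      subgoal by (simp add: I_def J_def X_def)
      subgoal for k m'' by (rule body)
      subgoal for k m'' using m by (simp add: J_def X_def)
      subgoal for m'' by (rule nrun_seqs_Nil, rule Q) (simp_all add: J_def X_def)
      done
    done
qed

lemma decode_spec:
  assumes "m [5] = N" "m [7] = k" "m [10] = L" "m [11] = b" "m [12] = u div b ^ k"
  shows "nrun R decode_prog m h (\<lambda>m'. m' = m([13] := u div b ^ k mod b, [12] := u div b ^ Suc k,
    [14] := (u div b ^ k mod b) div 2 mod L mod (N + k),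
    [15] := (u div b ^ k mod b) div 2 div L mod (N + k)))"
proof -
  have "u div b ^ k div b = u div b ^ Suc k" by (metis div_mult2_eq mult.commute power_Suc)
  then show ?thesis
    unfolding decode_prog_def
    by (intro nrun_seqs_Cons nrun_Assign nrun_seqs_Nil) (simp add: assms)
qed

lemma slp_spec:
  assumes m: "m [0] = t" "m [1] = u" "m [5] = N" "m [10] = N + t" "m [11] = 2 * (N + t) * (N + t)"
    "\<forall>r<N. m [0, 0, r] = f r" and N: "0 < N"
    and Q: "\<And>m'. \<forall>a. a \<notin> {[7], [12], [13], [14], [15], [16]} \<union> {a. length a = 3 \<and> hd a = 0 \<and> N \<le> a ! 2} \<longrightarrow> m' a = m a \<Longrightarrow>
      m' [16] = slp_out (+) (*) N t u f \<Longrightarrow> Q m'"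
  shows "nrun R slp_prog m h Q"
proof -
  define L b where "L = N + t" and "b = 2 * L * L"
  define ds where "ds s = u div b ^ s mod b" for s
  define X where "X = {[7::nat], [12], [13], [14], [15], [16]} \<union> {a. length a = 3 \<and> hd a = 0 \<and> N \<le> a ! 2}"
  define I where "I k m' \<longleftrightarrow> (\<forall>a. a \<notin> X \<longrightarrow> m' a = m a) \<and>
    (\<forall>r<N + k. m' [0, 0, r] = slp (+) (*) N L ds k f r) \<and> m' [12] = u div b ^ k" for k m'
  have body: "nrun R (seqs [decode_prog, Cond (Modulo (Sc 13) (Const 2))
      (Assign [Const 0, Const 0, Plus (Sc 5) (Sc 7)] (Times (Reg (Sc 14)) (Reg (Sc 15))))
      (Assign [Const 0, Const 0, Plus (Sc 5) (Sc 7)] (Plus (Reg (Sc 14)) (Reg (Sc 15))))]) m' h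
    (\<lambda>m'. m' [7] = k \<and> I (Suc k) (m'([7] := Suc k)))" if m': "m' [7] = k" "I k m'" for k m'
  proof -
    define i j where "i = ds k div 2 mod L mod (N + k)" and "j = ds k div 2 div L mod (N + k)"
    have ij: "i < N + k" "j < N + k" using N by (auto simp: i_def j_def)
    define r where "r = slp (+) (*) N L ds k f"
    have fr: "\<forall>a. a \<notin> X \<longrightarrow> m' a = m a" and regs: "\<And>q. q < N + k \<Longrightarrow> m' [0, 0, q] = r q" and w: "m' [12] = u div b ^ k"
      using m' by (auto simp: I_def r_def)
    have c: "m' [5] = N" "m' [10] = L" "m' [11] = b" using fr m by (auto simp: X_def L_def b_def)
    define m1 where "m1 = m'([13] := ds k, [12] := u div b ^ Suc k, [14] := i, [15] := j)"
    have new: "slp (+) (*) N L ds (Suc k) f = r(N + k := (if ds k mod 2 = 0 then r i + r j else r i * r j))"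
      by (simp add: Let_def r_def i_def j_def)
    have fin: "(m1([0, 0, N + k] := v)) [7] = k \<and> I (Suc k) ((m1([0, 0, N + k] := v))([7] := Suc k))"
      if "v = (if ds k mod 2 = 0 then r i + r j else r i * r j)" for v
      using m' fr regs that unfolding I_def new by (auto simp: m1_def X_def less_Suc_eq)
    have m1: "m1 [13] = ds k" "m1 [5] = N" "m1 [7] = k" "m1 [14] = i" "m1 [15] = j"
      "m1 [0, 0, i] = r i" "m1 [0, 0, j] = r j"
      using c m' regs ij by (simp_all add: m1_def)
    have dec: "nrun R decode_prog m' h (\<lambda>m2. m2 = m1)"
      unfolding m1_def ds_def i_def j_def by (rule decode_spec[OF c(1) m'(1) c(2,3) w])
    show ?thesis
      apply (rule nrun_seqs_Cons)
      apply (rule nrun_mono[OF dec])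
      apply (simp only:)
      apply (rule nrun_seqs_Cons)
      apply (rule nrun_Cond)
      subgoal
        apply (rule nrun_Assign, rule nrun_seqs_Nil)
        using fin[of "r i * r j"] m1 by simp
      subgoal
        apply (rule nrun_Assign, rule nrun_seqs_Nil)
        using fin[of "r i + r j"] m1 by simp
      done
  qed
  show ?thesis
    unfolding slp_prog_def
    apply (rule nrun_seqs_Cons nrun_Assign)+
    apply (rule nrun_For[where I = I and N = t])
    subgoal using m by (auto simp: I_def X_def)
    subgoal for k m' by (rule body)
    subgoal for k m' using m by (simp add: I_def X_def)
    subgoal for m'
    proof -
      assume I: "I t m'"
      have fr: "\<forall>a. a \<notin> X \<longrightarrow> m' a = m a" using I by (simp add: I_def)
      have c: "m' [10] = L" "m' [12] = u div b ^ t" using I fr m by (auto simp: I_def X_def L_def)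
      have o: "u div b ^ t mod L < N + t" using N by (simp add: L_def)
      have v: "m' [0, 0, u div b ^ t mod L] = slp_out (+) (*) N t u f"
        using I o unfolding I_def slp_out_def L_def[symmetric] b_def[symmetric] ds_def[abs_def] by simp
      show "nrun R (seqs [asg 16 (Reg (Modulo (Sc 12) (Sc 10)))]) m' h Q"
        apply (rule nrun_seqs_Cons nrun_Assign nrun_seqs_Nil)+
        apply (rule Q)
        subgoal using fr by (auto simp: X_def)
        subgoal using c v by simp
        done
    qed
    done
qed

text \<open>Binary digits identify the numbers below 2^n with the subsets of {..<n}, and the pair
  indices that pass the test of \<open>term_prog\<close> correspond one to one to the edges.\<close>

lemma sum_assignment_weight:
  assumes E: "E \<subseteq> vertex_pairs {..<n}"
  shows "(\<Sum>a<2 ^ n. assignment_weight n E f a) = neval f (formal_pf n E)"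
proof -
  have bit: "a div 2 ^ v mod 2 = of_bool (v \<in> set_decode a)" for a v :: nat
    by (simp add: set_decode_def mod2_eq_if)
  define t where "t S = f 0 * (\<Prod>v<n. f (unary_cell v (of_bool (v \<in> S)))) *
    (\<Prod>e\<in>E. edge_factor (pair_weight n f) S e)" for S
  have w: "assignment_weight n E f a = t (set_decode a)" for a
  proof -
    define g where "g q = f (binary_cell n (q div n) (q mod n) (of_bool (q div n \<in> set_decode a)) (of_bool (q mod n \<in> set_decode a)))" for q
    define A where "A = {q \<in> {..<n * n}. {q div n, q mod n} \<in> E \<and> q div n < q mod n}"
    have "(\<Prod>q<n * n. if {q div n, q mod n} \<in> E \<and> q div n < q mod n then g q else 1) = (\<Prod>q\<in>A. g q)"
      unfolding A_def by (rule prod.inter_filter[symmetric]) simp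
    also have "\<dots> = (\<Prod>e\<in>E. edge_factor (pair_weight n f) (set_decode a) e)"
    proof (rule prod.reindex_bij_witness[where i = "\<lambda>e. Min e * n + Max e" and j = "\<lambda>q. {q div n, q mod n}"])
      fix q assume q: "q \<in> A"
      then show "{q div n, q mod n} \<in> E" by (simp add: A_def)
      show "Min {q div n, q mod n} * n + Max {q div n, q mod n} = q" using q by (simp add: A_def min_def max_def)
      show "edge_factor (pair_weight n f) (set_decode a) {q div n, q mod n} = g q"
        using q by (simp add: A_def edge_factor_def pair_weight_def g_def min_def max_def)
    next
      fix e assume e: "e \<in> E"
      note mm = edge_MinMax[OF E e]
      have dm: "(Min e * n + Max e) div n = Min e" "(Min e * n + Max e) mod n = Max e" using mm by simp_all
      show "{(Min e * n + Max e) div n, (Min e * n + Max e) mod n} = e" unfolding dm using mm(3) by simp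
      have "Min e < n" using mm by simp
      then have "Min e * n + n \<le> n * n" by (metis Suc_leI add.commute mult_Suc mult_le_mono1)
      then show "Min e * n + Max e \<in> A" unfolding A_def using mm e dm by simp
    qed
    finally show ?thesis unfolding assignment_weight_def t_def bit g_def by simp
  qed
  have "(\<Sum>a<2 ^ n. assignment_weight n E f a) = (\<Sum>S\<in>Pow {..<n}. t S)"
    unfolding w
  proof (rule sum.reindex_bij_witness[where i = set_encode and j = set_decode])
    fix a :: nat assume a: "a \<in> {..<2 ^ n}"
    show "set_encode (set_decode a) = a" by simp
    have "v < n" if "v \<in> set_decode a" for v
    proof (rule ccontr)
      assume "\<not> v < n"
      then have "(2::nat) ^ n \<le> 2 ^ v" by (intro power_increasing) auto
      moreover have "a < 2 ^ n" using a by simp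
      ultimately have "a < 2 ^ v" by (rule less_le_trans[rotated])
      then have "a div 2 ^ v = 0" by simp
      then show False using that by (simp add: set_decode_def)
    qed
    then show "set_decode a \<in> Pow {..<n}" by auto
  next
    fix S assume S: "S \<in> Pow {..<n}"
    then have fin: "finite S" by (auto intro: finite_subset)
    then show "set_decode (set_encode S) = S" by simp
    have "set_encode S \<le> (\<Sum>v<n. 2 ^ v)" unfolding set_encode_def using S by (intro sum_mono2) auto
    also have "\<dots> < 2 ^ n" by (induction n) auto
    finally show "set_encode S \<in> {..<2 ^ n}" by simp
  qed simp
  then show ?thesis unfolding neval_formal_pf[OF E] pf_def t_def by simp
qed

text \<open>The two values agree iff both truncated differences are zero, hence iff their sum
  is.\<close>

definition "test_prog = seqs [
  slp_prog,
  Cond (Plus (Minus (Sc 16) (Sc 17)) (Minus (Sc 17) (Sc 16))) Skip (asg 2 (Plus (Sc 1) (Const 1)))]"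

text \<open>The loop cannot be left early, so once \<open>[2]\<close> is set the remaining codes are
  skipped. The Kronecker points and the target value are computed anew for each length, because the
  base grows with it.\<close>

definition "round_prog = seqs [
  setup_prog, base_prog, kron_prog, target_prog,
  For 1 (Sc 22) (Cond (Sc 2) Skip test_prog),
  Cond (Sc 2) Skip (asg 0 (Plus (Sc 0) (Const 1)))]"

definition found :: "nat \<Rightarrow> nat set set \<Rightarrow> nat \<Rightarrow> (nat list \<Rightarrow> nat) \<Rightarrow> bool" where
  "found n E t m \<longleftrightarrow> (\<exists>u<code_bound n t. accepts n E t u \<and> m [2] = Suc u) \<and> m [0] = t \<and> m [] = n \<and>
    m [5] = cell_count n \<and> m [10] = cell_count n + t \<and> m [11] = 2 * (cell_count n + t) * (cell_count n + t)"

lemma round_spec: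
  assumes E: "E \<subseteq> vertex_pairs {..<n}"
    and m: "m [] = n" "\<forall>x y. m [x, y] = (if {x, y} \<in> E then 1 else 0)" "m [0] = t" "m [2] = 0"
    and Q1: "\<And>m'. found n E t m' \<Longrightarrow> Q m'"
    and Q2: "\<And>m'. \<forall>u<code_bound n t. \<not> accepts n E t u \<Longrightarrow> m' [] = n \<Longrightarrow>
      \<forall>x y. m' [x, y] = (if {x, y} \<in> E then 1 else 0) \<Longrightarrow> m' [0] = Suc t \<Longrightarrow> m' [2] = 0 \<Longrightarrow> Q m'"
  shows "nrun R round_prog m h Q"
proof -
  define N where "N = cell_count n"
  define f where "f = kron n t"
  define z where "z = neval f (formal_pf n E)"
  define J where "J m' \<longleftrightarrow> m' [] = n \<and> (\<forall>x y. m' [x, y] = (if {x, y} \<in> E then 1 else 0)) \<and> m' [0] = t \<and>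
    m' [5] = N \<and> m' [10] = N + t \<and> m' [11] = 2 * (N + t) * (N + t) \<and> m' [22] = code_bound n t \<and>
    m' [17] = z \<and> (\<forall>r<N. m' [0, 0, r] = f r)" for m'
  define I where "I k m' \<longleftrightarrow> J m' \<and> ((m' [2] = 0 \<and> (\<forall>u<k. \<not> accepts n E t u)) \<or>
    (\<exists>u<k. accepts n E t u \<and> m' [2] = Suc u))" for k m'
  have N: "N > 0" by (simp add: N_def cell_count_pos)
  have body: "nrun R (Cond (Sc 2) Skip test_prog) m' h (\<lambda>m'. m' [1] = k \<and> I (Suc k) (m'([1] := Suc k)))"
    if m': "m' [1] = k" "I k m'" for k m'
  proof (rule nrun_Cond)
    assume "val m' (Sc 2) \<noteq> 0"
    then show "nrun R Skip m' h (\<lambda>m'. m' [1] = k \<and> I (Suc k) (m'([1] := Suc k)))"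
      using m' by (intro nrun_Skip) (auto simp: I_def J_def less_Suc_eq)
  next
    assume "val m' (Sc 2) = 0"
    then have z2: "m' [2] = 0" "\<forall>u<k. \<not> accepts n E t u" and J: "J m'" using m' by (auto simp: I_def)
    have acc: "accepts n E t k \<longleftrightarrow> slp_out (+) (*) N t k f = z" by (simp add: accepts_def N_def f_def z_def)
    show "nrun R test_prog m' h (\<lambda>m'. m' [1] = k \<and> I (Suc k) (m'([1] := Suc k)))"
      unfolding test_prog_def
      apply (rule nrun_seqs_Cons)
      apply (rule slp_spec[where N = N and t = t and u = k and f = f])
      using J m'(1) N apply (simp_all add: J_def)[7]
      subgoal for m2
        apply (rule nrun_seqs_Cons)
        apply (rule nrun_Cond)
        subgoal
          apply (rule nrun_Skip nrun_seqs_Nil)+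
          using J m'(1) z2 by (auto simp: I_def J_def acc less_Suc_eq)
        subgoal
          apply (rule nrun_Assign nrun_seqs_Nil)+
          using J m'(1) z2 by (auto simp: I_def J_def acc less_Suc_eq)
        done
      done
  qed
  show ?thesis
    unfolding round_prog_def
    apply (rule nrun_seqs_Cons)
    apply (rule setup_spec[OF m(1,3)])
    apply (rule nrun_seqs_Cons)
    subgoal for m1
      apply (rule base_spec[where n = n and t = t])
      subgoal using m by simp
      subgoal using m by simp
      apply (rule nrun_seqs_Cons)
      subgoal for m2
        apply (rule kron_spec[where b = "kron_base n t" and N = N])
        subgoal by simp
        subgoal by (simp add: N_def)
        apply (rule nrun_seqs_Cons)
        subgoal for m3
          apply (rule target_spec[where n = n and E = E and f = f])
          subgoal using m by simp
          subgoal using m by simp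
          subgoal by (simp add: f_def kron_def N_def)
          apply (rule nrun_seqs_Cons)
          subgoal for m4
            apply (rule nrun_For[where I = I and N = "code_bound n t"])
            subgoal using m by (simp add: I_def J_def sum_assignment_weight[OF E] z_def N_def f_def kron_def)
            subgoal for k m' by (rule body)
            subgoal for k m' by (simp add: I_def J_def)
            subgoal for m'
              apply (rule nrun_seqs_Cons)
              apply (rule nrun_Cond)
              subgoal
                apply (rule nrun_Skip nrun_seqs_Nil)+
                apply (rule Q1)
                by (auto simp: I_def J_def found_def N_def)
              subgoal
                apply (rule nrun_Assign nrun_seqs_Nil)+
                apply (rule Q2)
                by (auto simp: I_def J_def)
              done
            done
          done
        done
      done
    done
qed

definition "search_prog = While (Minus (Const 1) (Sc 2)) round_prog"

lemma nrun_While_True: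
  "val m e \<noteq> 0 \<Longrightarrow> nrun R p m h (\<lambda>m'. nrun R (While e p) m' h Q) \<Longrightarrow> nrun R (While e p) m h Q"
  unfolding nrun_def[of R "While e p"] by (rule run_While_True, assumption) (auto simp: nrun_def elim: run_mono)

lemma nrun_While_False: "val m e = 0 \<Longrightarrow> Q m \<Longrightarrow> nrun R (While e p) m h Q"
  unfolding nrun_def by (rule run_While_False) auto

definition min_length :: "nat \<Rightarrow> nat set set \<Rightarrow> nat" where
  "min_length n E = (LEAST t. \<exists>u<code_bound n t. accepts n E t u)"

text \<open>Lengths are tried in the order 0, 1, 2, and so on. By \<open>accepts_exists\<close> some
  length succeeds, so the loop terminates, and it does so at the least such length.\<close>

lemma search_spec:
  assumes E: "E \<subseteq> vertex_pairs {..<n}"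
  shows "nrun R search_prog (input_graph n E) h (found n E (min_length n E))"
proof -
  define T where "T = min_length n E"
  have T: "\<exists>u<code_bound n T. accepts n E T u"
    unfolding T_def min_length_def by (rule LeastI_ex) (use accepts_exists[OF E] in blast)
  have T_min: "\<forall>u<code_bound n t. \<not> accepts n E t u" if "t < T" for t
    using not_less_Least[OF that[unfolded T_def min_length_def]] by blast
  have "nrun R search_prog m h (found n E T)"
    if "d = T - t" "t \<le> T" "m [] = n" "\<forall>x y. m [x, y] = (if {x, y} \<in> E then 1 else 0)" "m [0] = t" "m [2] = 0" for d t m
    using that
  proof (induction d arbitrary: t m)
    case 0
    then have t: "t = T" by simp
    show ?case
      unfolding search_prog_def
    proof (rule nrun_While_True)
      show "nrun R round_prog m h (\<lambda>m'. nrun R (While (Minus (Const 1) (Sc 2)) round_prog) m' h (found n E T))"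
      proof (rule round_spec[OF E 0(3-6)])
        fix m' assume "found n E t m'"
        then show "nrun R (While (Minus (Const 1) (Sc 2)) round_prog) m' h (found n E T)"
          unfolding t by (intro nrun_While_False) (auto simp: found_def)
      qed (use T t in auto)
    qed (use 0 in simp)
  next
    case (Suc d)
    then have t: "t < T" by simp
    show ?case
      unfolding search_prog_def
    proof (rule nrun_While_True)
      show "nrun R round_prog m h (\<lambda>m'. nrun R (While (Minus (Const 1) (Sc 2)) round_prog) m' h (found n E T))"
      proof (rule round_spec[OF E Suc.prems(3-6)])
        fix m' assume "found n E t m'"
        then show "nrun R (While (Minus (Const 1) (Sc 2)) round_prog) m' h (found n E T)"
          using T_min[OF t] by (auto simp: found_def)
      next
        fix m' assume "m' [] = n" "\<forall>x y. m' [x, y] = (if {x, y} \<in> E then 1 else 0)" "m' [0] = Suc t" "m' [2] = 0"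
        then show "nrun R (While (Minus (Const 1) (Sc 2)) round_prog) m' h (found n E T)"
          using Suc.IH[of "Suc t" m'] Suc.prems(1) t unfolding search_prog_def by simp
      qed
    qed (use Suc.prems in simp)
  qed
  from this[of T 0 "input_graph n E"] show ?thesis
    by (simp add: T_def input_graph_def)
qed

section \<open>The single run over the ring\<close>

definition "ring_prog = seqs [
  asg 1 (Minus (Sc 2) (Const 1)),
  RCopy [Const 0] [],
  For 7 (Times (Const 2) (Cell []))
    (RCopy [Plus (Const 1) (Sc 7)] [Divide (Sc 7) (Const 2), Modulo (Sc 7) (Const 2)]),
  For 7 (Times (Const 4) (Times (Cell []) (Cell [])))
    (RCopy [Plus (Plus (Const 1) (Times (Const 2) (Cell []))) (Sc 7)]
      [Divide (Divide (Sc 7) (Const 4)) (Cell []), Modulo (Divide (Sc 7) (Const 4)) (Cell []),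
       Divide (Modulo (Sc 7) (Const 4)) (Const 2), Modulo (Sc 7) (Const 2)]),
  asg 12 (Sc 1),
  For 7 (Sc 0) (seqs [
    decode_prog,
    Cond (Modulo (Sc 13) (Const 2))
      (RMult [Plus (Sc 5) (Sc 7)] [Sc 14] [Sc 15])
      (RAdd [Plus (Sc 5) (Sc 7)] [Sc 14] [Sc 15])]),
  RCopy [] [Modulo (Sc 12) (Sc 10)]]"

lemma run_seqs_Cons: "run R p m h (\<lambda>t m' h'. run R (seqs ps) m' h' (\<lambda>t'. P (t + t'))) \<Longrightarrow> run R (seqs (p # ps)) m h P"
  by (simp add: run_Seq)

lemma run_seqs_nat: "nrun R p m h (\<lambda>m'. run R (seqs ps) m' h P) \<Longrightarrow> run R (seqs (p # ps)) m h P"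
  by (simp add: run_Seq_nat)

lemma run_seqs_Nil: "P 0 m h \<Longrightarrow> run R (seqs []) m h P"
  by (rule run_nrun, rule nrun_seqs_Nil)

text \<open>Copying is free, so the input is moved to the registers \<open>[r]\<close> before the
  steps are executed. Input is stored at addresses of length 0, 2 or 4 and registers have length 1,
  so copying overwrites no input. Each step then performs one ring operation, t in total.\<close>

lemma ring_spec:
  assumes m: "m [] = n" "m [0] = t" "m [2] = Suc u" "m [5] = N" "m [10] = N + t"
    "m [11] = 2 * (N + t) * (N + t)" and N: "N = cell_count n"
  shows "run R ring_prog m h (\<lambda>s m' h'. s = t \<and> h' [] = slp_out (\<oplus>\<^bsub>R\<^esub>) (\<otimes>\<^bsub>R\<^esub>) N t u (cell_value n h))"
proof -
  define L b where "L = N + t" and "b = 2 * L * L"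
  define ds where "ds s = u div b ^ s mod b" for s
  define f where "f = cell_value n h"
  define G where "G m' \<longleftrightarrow> m' [] = n \<and> m' [0] = t \<and> m' [1] = u \<and> m' [5] = N \<and> m' [10] = L \<and> m' [11] = b" for m' :: "nat list \<Rightarrow> nat"
  define H where "H k h' \<longleftrightarrow> (\<forall>a. length a \<noteq> 1 \<longrightarrow> h' a = h a) \<and> (\<forall>r<k. h' [r] = f r)" for k h'
  define I where "I k s m' h' \<longleftrightarrow> s = (0::nat) \<and> G m' \<and> H (1 + k) h'" for k s m' h'
  define J where "J k s m' h' \<longleftrightarrow> s = (0::nat) \<and> G m' \<and> H (1 + 2 * n + k) h'" for k s m' h'
  define K where "K k s m' h' \<longleftrightarrow> s = k \<and> G m' \<and> m' [12] = u div b ^ k \<and>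
    (\<forall>r<N + k. h' [r] = slp (\<oplus>\<^bsub>R\<^esub>) (\<otimes>\<^bsub>R\<^esub>) N L ds k f r)" for k s m' h'
  have N0: "N > 0" by (simp add: N cell_count_pos)
  have body: "run R (seqs [decode_prog, Cond (Modulo (Sc 13) (Const 2))
      (RMult [Plus (Sc 5) (Sc 7)] [Sc 14] [Sc 15]) (RAdd [Plus (Sc 5) (Sc 7)] [Sc 14] [Sc 15])]) m' h'
    (\<lambda>s' m' h'. m' [7] = k \<and> K (Suc k) (s + s') (m'([7] := Suc k)) h')" if m': "m' [7] = k" "K k s m' h'" for k s m' h'
  proof -
    define i j where "i = ds k div 2 mod L mod (N + k)" and "j = ds k div 2 div L mod (N + k)"
    have ij: "i < N + k" "j < N + k" using N0 by (auto simp: i_def j_def)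
    define r where "r = slp (\<oplus>\<^bsub>R\<^esub>) (\<otimes>\<^bsub>R\<^esub>) N L ds k f"
    have regs: "\<And>q. q < N + k \<Longrightarrow> h' [q] = r q" and w: "m' [12] = u div b ^ k"
      and c: "m' [5] = N" "m' [10] = L" "m' [11] = b" and G: "G m'" and s: "s = k"
      using m' by (auto simp: K_def r_def G_def)
    define m1 where "m1 = m'([13] := ds k, [12] := u div b ^ Suc k, [14] := i, [15] := j)"
    have new: "slp (\<oplus>\<^bsub>R\<^esub>) (\<otimes>\<^bsub>R\<^esub>) N L ds (Suc k) f = r(N + k := (if ds k mod 2 = 0 then r i \<oplus>\<^bsub>R\<^esub> r j else r i \<otimes>\<^bsub>R\<^esub> r j))"
      by (simp add: Let_def r_def i_def j_def)
    have m1: "m1 [13] = ds k" "m1 [5] = N" "m1 [7] = k" "m1 [14] = i" "m1 [15] = j"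
      using c m' by (simp_all add: m1_def)
    have fin: "m1 [7] = k \<and> K (Suc k) (s + 1) (m1([7] := Suc k)) (h'([N + k] := v))"
      if "v = (if ds k mod 2 = 0 then r i \<oplus>\<^bsub>R\<^esub> r j else r i \<otimes>\<^bsub>R\<^esub> r j)" for v
      using m1 G s regs that unfolding K_def new by (auto simp: m1_def G_def less_Suc_eq)
    have dec: "nrun R decode_prog m' h' (\<lambda>m2. m2 = m1)"
      unfolding m1_def ds_def i_def j_def by (rule decode_spec[OF c(1) m'(1) c(2,3) w])
    show ?thesis
      apply (rule run_seqs_nat)
      apply (rule nrun_mono[OF dec])
      apply (simp only:)
      apply (rule run_seqs_Cons)
      apply (rule run_Cond)
      subgoal
        apply (rule run_RMult, rule run_seqs_Nil)
        using fin[of "r i \<otimes>\<^bsub>R\<^esub> r j"] m1 regs ij by simp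
      subgoal
        apply (rule run_RAdd, rule run_seqs_Nil)
        using fin[of "r i \<oplus>\<^bsub>R\<^esub> r j"] m1 regs ij by simp
      done
  qed
  have Lt: "x mod L < L" for x using N0 by (simp add: L_def)
  have c1: "f (Suc k) = h [k div 2, k mod 2]" if "k < 2 * n" for k
    using that by (simp add: f_def cell_value_def)
  have c2: "f (Suc (2 * n + k)) = h [k div 4 div n, k div 4 mod n, k mod 4 div 2, k mod 2]" for k
    by (simp add: f_def cell_value_def)
  show ?thesis
    unfolding ring_prog_def
    apply (rule run_seqs_nat, rule nrun_Assign)
    apply (rule run_seqs_Cons, rule run_RCopy)
    apply (rule run_seqs_Cons)
    apply (rule run_For[where I = I and N = "2 * n"])
    subgoal using m by (simp add: I_def G_def H_def f_def cell_value_def L_def b_def)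
    subgoal for k s m' h' by (rule run_RCopy) (auto simp: I_def G_def H_def c1 less_Suc_eq)
    subgoal for k s m' h' by (simp add: I_def G_def)
    subgoal for s m' h'
      apply (rule run_seqs_Cons)
      apply (rule run_For[where I = J and N = "4 * (n * n)"])
      subgoal by (simp add: I_def J_def G_def)
      subgoal for k s m' h' by (rule run_RCopy) (auto simp: J_def G_def H_def c2 less_Suc_eq)
      subgoal for k s m' h' by (simp add: J_def G_def)
      subgoal for s' m2 h2
        apply (rule run_seqs_nat, rule nrun_Assign)
        apply (rule run_seqs_Cons)
        apply (rule run_For[where I = K and N = t])
        subgoal by (auto simp: J_def K_def G_def H_def N cell_count_def)
        subgoal for k s m' h' by (rule body)
        subgoal for k s m' h' by (simp add: K_def G_def)
        subgoal for s'' m3 h3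
          apply (rule run_seqs_Cons run_RCopy)+
          apply (rule run_seqs_Nil)
          using Lt by (simp add: I_def J_def K_def G_def slp_out_def L_def[symmetric] b_def[symmetric] ds_def[abs_def, symmetric] f_def[symmetric])
        done
      done
    done
qed

definition "algorithm = Seq search_prog ring_prog"

lemma algorithm_correct:
  fixes R :: "('r, 'm) ring_scheme"
  assumes "cring R" "E \<subseteq> vertex_pairs {..<n}" "rcsp_instance R 2 {..<n} E I"
  shows "computes_in R algorithm 2 n E I (partition_function R 2 {..<n} E I) (min_length n E)"
proof -
  interpret cring R by fact
  define t h where "t = min_length n E" and "h = input_entries R 2 n E I"
  have "run R algorithm (input_graph n E) h (\<lambda>s m' h'. s = t \<and> h' [] = partition_function R 2 {..<n} E I)"
    unfolding algorithm_def
  proof (rule run_Seq_nat, rule nrun_mono[OF search_spec[OF assms(2)]])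
    fix m assume "found n E (min_length n E) m"
    then obtain u where u: "accepts n E t u" "m [2] = Suc u" and m: "m [0] = t" "m [] = n"
      "m [5] = cell_count n" "m [10] = cell_count n + t" "m [11] = 2 * (cell_count n + t) * (cell_count n + t)"
      by (auto simp: found_def t_def)
    show "run R ring_prog m h (\<lambda>s m' h'. s = t \<and> h' [] = partition_function R 2 {..<n} E I)"
      using ring_spec[OF m(2,1) u(2) m(3-5) refl, of R h] accepts_sound[OF assms(2,3) u(1)]
      by (simp add: h_def)
  qed
  then show ?thesis by (auto simp: run_def computes_in_def t_def h_def)
qed

section \<open>The expected number of ring operations\<close>

lemma min_length_le:
  assumes "E \<subseteq> vertex_pairs {..<n}"
  shows "real (min_length n E) \<le> 24 * real n + 263 * component_sum (sqrt 2) {..<n} E"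
proof -
  obtain t u where tu: "u < code_bound n t" "accepts n E t u"
    "real t \<le> 24 * real n + 263 * component_sum (sqrt 2) {..<n} E"
    using accepts_exists[OF assms] by blast
  have "min_length n E \<le> t" unfolding min_length_def by (rule Least_le) (use tu in blast)
  then show ?thesis using tu(3) by linarith
qed

lemma expectation_min_length_le:
  obtains K :: real where "K > 0"
    "\<And>n c. 4 \<le> n \<Longrightarrow> 0 \<le> c \<Longrightarrow> c \<le> real n \<Longrightarrow>
      measure_pmf.expectation (random_graph n (c / real n)) (\<lambda>E. real (min_length n E))
        \<le> K * (real n * exp (real n * max 0 (c - 1) ^ 3))"
proof -
  obtain C where C: "C > 0" "\<And>n c. 4 \<le> n \<Longrightarrow> 0 \<le> c \<Longrightarrow> c \<le> real n \<Longrightarrow>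
      (\<Sum>k=1..n. component_weight n (c / real n) k) \<le> C * real n * exp (real n * max 0 (c - 1) ^ 3)"
    using sum_component_weight_le by blast
  show thesis
  proof (rule that[of "24 + 263 * C"])
    fix n and c :: real assume n: "4 \<le> n" and c: "0 \<le> c" "c \<le> real n"
    define p where "p = c / real n"
    have p: "0 \<le> p" "p \<le> 1" using n c by (auto simp: p_def)
    let ?P = "vertex_pairs {..<n}" and ?e = "exp (real n * max 0 (c - 1) ^ 3)"
    have fin: "finite ?P" by (simp add: finite_vertex_pairs)
    have "measure_pmf.expectation (random_graph n p) (\<lambda>E. real (min_length n E)) =
        bsum p ?P (\<lambda>E. real (min_length n E))"
      by (rule expectation_random_graph[OF p])
    also have "\<dots> \<le> bsum p ?P (\<lambda>E. 24 * real n + 263 * component_sum (sqrt 2) {..<n} E)"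
      by (rule bsum_mono[OF p min_length_le])
    also have "\<dots> = 24 * real n + 263 * bsum p ?P (component_sum (sqrt 2) {..<n})"
      by (simp only: bsum_add bsum_const[OF fin] bsum_cmult)
    also have "bsum p ?P (component_sum (sqrt 2) {..<n}) \<le> (\<Sum>k=1..n. component_weight n p k)"
      using bsum_component_sum_le[of "{..<n}" p "sqrt 2"] p by (simp add: component_weight_def)
    also have "\<dots> \<le> C * real n * ?e"
      unfolding p_def by (rule C(2)[OF n c])
    finally have "measure_pmf.expectation (random_graph n p) (\<lambda>E. real (min_length n E)) \<le>
        24 * real n + 263 * (C * real n * ?e)" by simp
    moreover have "24 * real n \<le> 24 * real n * ?e"
      using mult_left_mono[of 1 ?e "24 * real n"] by simp
    ultimately show "measure_pmf.expectation (random_graph n (c / real n)) (\<lambda>E. real (min_length n E))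
        \<le> (24 + 263 * C) * (real n * ?e)"
      by (simp add: p_def algebra_simps)
  qed (use C in simp)
qed

theorem theorem8p1:
  shows "\<exists>(algo :: com) (ops :: nat \<Rightarrow> nat set set \<Rightarrow> nat).
    (\<forall>(R :: 'r ring) (n :: nat) (E :: nat set set) (I :: 'r rcsp).
        cring R \<and> E \<subseteq> vertex_pairs {..<n} \<and> rcsp_instance R 2 {..<n} E I \<longrightarrow>
        computes_in R algo 2 n E I (partition_function R 2 {..<n} E I) (ops n E)) \<and>
    (\<forall>(lam :: nat \<Rightarrow> real) (c :: nat \<Rightarrow> real).
        (\<forall>n\<ge>1. 0 \<le> lam n \<and> 0 \<le> c n \<and> c n \<le> real n \<and>
                 c n \<le> 1 + lam n * real n powr (-1/3)) \<longrightarrow>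
        (\<lambda>n. measure_pmf.expectation (random_graph n (c n / real n)) (\<lambda>E. real (ops n E)))
          \<in> O(\<lambda>n. real n * exp (1 + lam n ^ 3)))"
proof (intro exI[of _ algorithm] exI[of _ min_length] conjI allI impI)
  fix R :: "'r ring" and n E and I :: "'r rcsp"
  assume "cring R \<and> E \<subseteq> vertex_pairs {..<n} \<and> rcsp_instance R 2 {..<n} E I"
  then show "computes_in R algorithm 2 n E I (partition_function R 2 {..<n} E I) (min_length n E)"
    by (intro algorithm_correct) auto
next
  fix lam c :: "nat \<Rightarrow> real"
  assume H: "\<forall>n\<ge>1. 0 \<le> lam n \<and> 0 \<le> c n \<and> c n \<le> real n \<and> c n \<le> 1 + lam n * real n powr (-1/3)"
  obtain K where K: "K > 0" "\<And>n c. 4 \<le> n \<Longrightarrow> 0 \<le> c \<Longrightarrow> c \<le> real n \<Longrightarrow>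
      measure_pmf.expectation (random_graph n (c / real n)) (\<lambda>E. real (min_length n E))
        \<le> K * (real n * exp (real n * max 0 (c - 1) ^ 3))"
    using expectation_min_length_le by blast
  \<comment> \<open>From n = 4 on, c \<le> 2 implies p \<le> 1/2, as \<open>conn_factor_le\<close>
    demands; finitely many n do not affect the O bound.\<close>
  have "norm (measure_pmf.expectation (random_graph n (c n / real n)) (\<lambda>E. real (min_length n E)))
      \<le> K * norm (real n * exp (1 + lam n ^ 3))" if n: "n \<ge> 4" for n
  proof -
    have h: "0 \<le> lam n" "0 \<le> c n" "c n \<le> real n" "c n \<le> 1 + lam n * real n powr (-1/3)"
      using H n by auto
    have "max 0 (c n - 1) \<le> lam n * real n powr (-1/3)" using h by simp
    then have "max 0 (c n - 1) ^ 3 \<le> (lam n * real n powr (-1/3)) ^ 3" by (rule power_mono) simp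
    also have "\<dots> = lam n ^ 3 * real n powr (- 1)"
      using n by (simp add: power_mult_distrib powr_power)
    also have "\<dots> = lam n ^ 3 / real n" using n by (simp add: powr_minus_divide)
    finally have "real n * max 0 (c n - 1) ^ 3 \<le> lam n ^ 3" using n by (simp add: field_simps)
    then have "exp (real n * max 0 (c n - 1) ^ 3) \<le> exp (1 + lam n ^ 3)" by simp
    then have "K * (real n * exp (real n * max 0 (c n - 1) ^ 3)) \<le> K * (real n * exp (1 + lam n ^ 3))"
      using K(1) by (intro mult_left_mono) auto
    moreover have "0 \<le> measure_pmf.expectation (random_graph n (c n / real n)) (\<lambda>E. real (min_length n E))"
      by (intro Bochner_Integration.integral_nonneg) simp
    ultimately show ?thesis using K(2)[OF n h(2,3)] by simp
  qed
  then show "(\<lambda>n. measure_pmf.expectation (random_graph n (c n / real n)) (\<lambda>E. real (min_length n E)))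
      \<in> O(\<lambda>n. real n * exp (1 + lam n ^ 3))"
    by (intro bigoI[of _ K] eventually_mono[OF eventually_ge_at_top[of 4]])
qed

end
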